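(* Let $n\ge2$ and $p\in\mathbb{N}$. For any $K\in\mathcal{K}(\mathbb{R}^n)$ and $\bm t=(t_0,\dots,t_p)\in\Theta_p$, one has $$\sum_{\bm j\in\mathcal{J}^n_p}\bm t^{\,n-\bm j}\,W_{p,K}(\bm j)\leq\frac{(n!)^p}{(np)!}\sum_{\bm j\in\mathcal{J}^n_p}\binom{n}{\bm j}\bm t^{\,n-\bm j}|K|^p.$$ If $\dim K=n$ and equality holds for some $\bm t\in\mathrm{relint}(\Theta_p)$, then $K$ is a simplex.
   Context: $\mathcal{K}(\mathbb{R}^n)$ denotes the set of convex bodies, i.e. nonempty compact convex subsets of $\mathbb{R}^n$; $|\cdot|$ is Lebesgue measure (in the dimension of the ambient space); $\dim K$ is the dimension of the affine span of $K$; a simplex is the convex hull of affinely independent points. The mixed volume of $K_1,\dots,K_N\in\mathcal{K}(\mathbb{R}^N)$ is $V(K_1,\dots,K_N)=\frac1{N!}\frac{\partial^N}{\partial s_1\cdots\partial s_N}\big|_{s_1=\dots=s_N=0}|s_1K_1+\dots+s_NK_N|$ (Minkowski sums; the volume is a homogeneous polynomial of degree $N$ in $s_1,\dots,s_N\ge0$). $L[k]$ means that $L$ is repeated $k$ times. Identify $\mathbb{R}^{pn}=(\mathbb{R}^n)^p$; $\Delta_p(x)=(x,\dots,x)$ is the diagonal embedding $\mathbb{R}^n\to\mathbb{R}^{pn}$ and $\iota_i:\mathbb{R}^n\to\mathbb{R}^{pn}$, $1\le i\le p$, the inclusion into the $i$-th factor. $\mathcal{J}_p^n=\{\bm j=(j_0,\dots,j_p)\in\mathbb{N}_0^{p+1}:j_0+\dots+j_p=n\}$;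 $\binom{n}{\bm j}=\frac{n!}{j_0!\cdots j_p!}$; $W_{p,K}(\bm j)=V\big(-\Delta_pK[n-j_0],\iota_1K[n-j_1],\dots,\iota_pK[n-j_p]\big)$. $\Theta_p=\{(t_0,\dots,t_p)\in\mathbb{R}^{p+1}:t_l\ge0,\ t_0+\dots+t_p=1\}$, with relative interior $\mathrm{relint}(\Theta_p)$ (all $t_l>0$); $\bm t^{\,n-\bm j}=\prod_{l=0}^pt_l^{n-j_l}$, with $0^0=1$. *)

theory Defs
  imports "HOL-Analysis.Analysis"
begin

definition convex_body :: "'a::euclidean_space set \<Rightarrow> bool" where
  "convex_body K \<longleftrightarrow> K \<noteq> {} \<and> compact K \<and> convex K"

text \<open>
  The function \<open>s \<mapsto> |s\<^sub>1 K\<^sub>1 + \<dots> + s\<^sub>N K\<^sub>N|\<close>, with indices shifted to start at \<open>0\<close>. The sum over sets is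
  the Minkowski sum of \<open>HOL-Library.Set_Algebras\<close>.
\<close>

definition combination_volume :: "'a::euclidean_space set list \<Rightarrow> (nat \<Rightarrow> real) \<Rightarrow> real" where
  "combination_volume Ks s = measure lebesgue (\<Sum>i<length Ks. (\<lambda>x. s i *\<^sub>R x) ` (Ks ! i))"

text \<open>
  Partial derivative in the \<open>i\<close>-th variable of a function on the nonnegative orthant: two-sided
  where \<open>s i > 0\<close>, one-sided where \<open>s i = 0\<close>. The volume above is polynomial only for nonnegative
  arguments, so derivatives at the origin have to be taken relative to the orthant; they agree with
  those of the polynomial.
\<close>

definition orthant_partial ::
    "nat \<Rightarrow> ((nat \<Rightarrow> real) \<Rightarrow> real) \<Rightarrow> (nat \<Rightarrow> real) \<Rightarrow> real" where
  "orthant_partial i f s = vector_derivative (\<lambda>x. f (s(i := x))) (at (s i) within {0..})"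

text \<open>The mixed volume of a list of \<open>DIM('a)\<close> convex bodies; not meant for lists of other lengths.\<close>

definition mixed_volume :: "'a::euclidean_space set list \<Rightarrow> real" where
  "mixed_volume Ks =
     1 / fact (length Ks) *
     foldr orthant_partial [0..<length Ks] (combination_volume Ks) (\<lambda>_. 0)"

text \<open>
  \<open>(\<real>\<^sup>n)\<^sup>p\<close> is \<^typ>\<open>real^'n^'p\<close>, with \<open>n = CARD('n)\<close> and \<open>p = CARD('p)\<close>. The indices \<open>0,\<dots>,p\<close> are the
  elements of \<^typ>\<open>'p option\<close>: \<^term>\<open>None\<close> is the index \<open>0\<close>, and \<^term>\<open>Some i\<close> belongs to the
  \<open>i\<close>-th factor. The linear order on \<open>'p\<close> serves only to list the factors.
\<close>

definition diag_embed :: "real^'n \<Rightarrow> real^'n^'p" where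
  "diag_embed x = (\<chi> i. x)"

definition factor_embed :: "'p \<Rightarrow> real^'n \<Rightarrow> real^'n^'p" where
  "factor_embed i x = axis i x"

definition compositions :: "nat \<Rightarrow> ('p::finite option \<Rightarrow> nat) set" where
  "compositions n = {j. (\<Sum>l\<in>UNIV. j l) = n}"

definition multinom :: "nat \<Rightarrow> ('p::finite option \<Rightarrow> nat) \<Rightarrow> real" where
  "multinom n j = fact n / (\<Prod>l\<in>UNIV. fact (j l))"

definition W :: "(real^'n) set \<Rightarrow> ('p::{finite,linorder} option \<Rightarrow> nat) \<Rightarrow> real" where
  "W K j = mixed_volume
     (replicate (CARD('n) - j None) ((\<lambda>x. - diag_embed x :: real^'n^'p::{finite,linorder}) ` K) @
      concat (map (\<lambda>i. replicate (CARD('n) - j (Some i)) (factor_embed i ` K))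
                  (sorted_list_of_set UNIV)))"

definition Theta :: "(real^('p::finite option)) set" where
  "Theta = {t. (\<forall>l. 0 \<le> t $ l) \<and> (\<Sum>l\<in>UNIV. t $ l) = 1}"

definition weight :: "nat \<Rightarrow> real^('p::finite option) \<Rightarrow> ('p option \<Rightarrow> nat) \<Rightarrow> real" where
  "weight n t j = (\<Prod>l\<in>UNIV. (t $ l) ^ (n - j l))"

end

theory Submission
  imports Defs "HOL-Probability.Distributions"
begin

text \<open>
  Let \<open>P(s) = -s\<^sub>0\<Delta>\<^sub>pK + \<Sum>\<^sub>i s\<^sub>i\<iota>\<^sub>iK\<close>; a point \<open>x\<close> lies in \<open>P(s)\<close> iff the fiber
  \<open>h(s, x) = s\<^sub>0K \<inter> \<Inter>\<^sub>i (s\<^sub>iK - x\<^sub>i)\<close> is nonempty. With \<open>\<alpha>\<^sub>l = 1/t\<^sub>l\<close>, the left-hand side of the inequality is, up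
  to a constant, the integral of \<open>exp(-\<alpha>\<cdot>s)\<close> over the convex cone \<open>C\<close> of all \<open>(s, x)\<close> with \<open>x \<in> P(s)\<close>, because
  the volume of \<open>P(s)\<close> is a polynomial in \<open>s\<close>. The integral of \<open>exp(-\<alpha>\<cdot>s) |h(s, x)|\<close> is explicit by
  Fubini's theorem. If \<open>z - \<rho>u \<in> C\<close> for \<open>u = (1,\<dots>,1; 0)\<close>, then \<open>h(z)\<close> contains a translate of \<open>\<rho>K\<close>;
  integrating \<open>|h(z)| \<ge> \<rho>(z)\<^sup>n|K|\<close> for the largest such \<open>\<rho>(z)\<close> by layers gives the inequality.

  In the case of equality, all fibers are homothets of \<open>K\<close>. Hence the cone over \<open>K\<close> defines a lattice order,
  whose extreme rays are linearly independent by the Riesz decomposition property. So the extreme points of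
  \<open>K\<close> are affinely independent.

  That \<open>|P(s)|\<close> is a polynomial is proved for polytopes by slicing a regular triangulation of the cone over
  the Cayley polytope, and in general by approximation from outside.
\<close>

subsection \<open>Mixed volumes of repeated bodies\<close>

text \<open>The exponential weight is chosen because a monomial s^k integrates to the product of the
  k_l! t_l^(k_l + 1): these factorials are the ones relating a coefficient of the volume polynomial
  to a mixed volume, so the weighted sum of mixed volumes appears as one integral. Write T for the
  product of the t_l and H for the sum of the 1/t_l. Fubini yields (n!)^(p+1) T^(n+1) |K|^(p+1), the
  layers contribute the factor n! T |K| / H^n, and the quotient is (n!)^p T^n H^n |K|^p. Here T^n
  H^n is the multinomial sum on the right, and (np)! normalises the mixed volumes. All of this holds
  for every t with positive coordinates, so points of \<open>Theta\<close> with vanishing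
  coordinates are reached by adding a small constant to each coordinate. Two obstacles remain.
  Equality of integrals controls almost every fiber only; it spreads to every fiber of positive
  volume because fibers are superadditive, so moving z by a vector of the cone cannot shrink the
  volume of its fiber. And mixed volumes are iterated one-sided derivatives, which are computable
  only once the volume is known to be polynomial on the closed orthant.\<close>

lemma scaleR_image_add:
  fixes K :: "'a::real_vector set"
  assumes "convex K" "0 \<le> a" "0 \<le> b"
  shows "(*\<^sub>R) (a + b) ` K = (*\<^sub>R) a ` K + (*\<^sub>R) b ` K"
proof (intro equalityI subsetI)
  fix x assume "x \<in> (*\<^sub>R) (a + b) ` K"
  then show "x \<in> (*\<^sub>R) a ` K + (*\<^sub>R) b ` K"
    by (auto simp: scaleR_add_left intro!: set_plus_intro)
next
  fix x assume "x \<in> (*\<^sub>R) a ` K + (*\<^sub>R) b ` K"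
  then obtain u v where uv: "u \<in> K" "v \<in> K" "x = a *\<^sub>R u + b *\<^sub>R v"
    by (auto elim!: set_plus_elim)
  show "x \<in> (*\<^sub>R) (a + b) ` K"
  proof (cases "a + b = 0")
    case True
    then have "a = 0" "b = 0" using assms by auto
    then show ?thesis using uv by auto
  next
    case False
    then have pos: "a + b > 0" using assms by auto
    have "(a / (a + b)) *\<^sub>R u + (b / (a + b)) *\<^sub>R v \<in> K"
      using assms pos uv by (intro convexD) (auto simp: add_divide_distrib[symmetric])
    moreover have "x = (a + b) *\<^sub>R ((a / (a + b)) *\<^sub>R u + (b / (a + b)) *\<^sub>R v)"
      using pos uv by (simp add: scaleR_add_right)
    ultimately show ?thesis by blast
  qed
qed

abbreviation minkowski :: "('l::finite \<Rightarrow> real) \<Rightarrow> ('l \<Rightarrow> 'a::real_vector set) \<Rightarrow> 'a set" where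
  "minkowski s K \<equiv> \<Sum>l\<in>UNIV. (*\<^sub>R) (s l) ` K l"

lemma scaleR_image_sum:
  fixes K :: "'a::real_vector set"
  assumes "convex K" "K \<noteq> {}" "finite I" "\<And>i. i \<in> I \<Longrightarrow> 0 \<le> s i"
  shows "(\<Sum>i\<in>I. (*\<^sub>R) (s i) ` K) = (*\<^sub>R) (sum s I) ` K"
  using assms(3,4)
proof (induction I)
  case empty
  then show ?case using \<open>K \<noteq> {}\<close> by (auto simp: image_constant_conv)
next
  case (insert i I)
  then show ?case using \<open>convex K\<close> by (simp add: scaleR_image_add sum_nonneg)
qed

text \<open>\<open>ls\<close> assigns to each list position the body standing there, so
  \<open>f\<close> depends on \<open>s\<close> only through the total weight
  \<open>\<sigma> s l\<close> of each body, and every partial derivative differentiates in one of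
  these totals. The formula is proved at all nonnegative \<open>s\<close>, not only at 0, because
  the next derivative needs the previous one along a whole half-line.\<close>

lemma iterated_orthant_partial:
  fixes ls :: "'l::finite list" and a :: "('l \<Rightarrow> nat) \<Rightarrow> real" and f :: "(nat \<Rightarrow> real) \<Rightarrow> real"
  defines "\<sigma> \<equiv> \<lambda>s l. \<Sum>i | i < length ls \<and> ls ! i = l. s i"
  assumes "finite S"
    and f: "\<And>s. (\<And>i. 0 \<le> s i) \<Longrightarrow> f s = (\<Sum>k\<in>S. a k * (\<Prod>l\<in>UNIV. \<sigma> s l ^ k l))"
    and "set xs \<subseteq> {..<length ls}" "\<And>i. 0 \<le> s i"
  shows "foldr orthant_partial xs f s =
    (\<Sum>k\<in>S. a k * (\<Prod>l\<in>UNIV. (\<Prod>i<count_list (map ((!) ls) xs) l. real (k l) - real i) *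
                            \<sigma> s l ^ (k l - count_list (map ((!) ls) xs) l)))"
  using assms(4,5)
proof (induction xs arbitrary: s)
  case Nil
  then show ?case using f by simp
next
  case (Cons j xs)
  define c where "c = count_list (map ((!) ls) xs)"
  define l0 where "l0 = ls ! j"
  define P where "P k = (\<Prod>l\<in>UNIV-{l0}. (\<Prod>i<c l. real (k l) - real i) * \<sigma> s l ^ (k l - c l))" for k
  define p where "p k = (\<Prod>i<c l0. real (k l0) - real i)" for k
  have j: "j < length ls" using Cons.prems by auto
  have \<sigma>': "\<sigma> (s(j := x)) l = (if l = l0 then \<sigma> s l0 + (x - s j) else \<sigma> s l)" for x l
  proof (cases "l = l0")
    case True
    have "\<sigma> (s(j := x)) l0 = (\<Sum>i | i < length ls \<and> ls ! i = l0. s i + (if i = j then x - s j else 0))"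
      unfolding \<sigma>_def by (intro sum.cong) auto
    also have "\<dots> = \<sigma> s l0 + (x - s j)"
      using j unfolding \<sigma>_def by (subst sum.distrib) (simp add: sum.delta l0_def)
    finally show ?thesis using True by simp
  next
    case False
    then show ?thesis unfolding \<sigma>_def by (auto intro!: sum.cong simp: l0_def)
  qed
  have split: "(\<Prod>l\<in>UNIV. h l) = h l0 * (\<Prod>l\<in>UNIV-{l0}. h l)" for h :: "'l \<Rightarrow> real"
    by (subst prod.remove[of _ l0]) auto
  have G: "foldr orthant_partial xs f (s(j := x)) =
      (\<Sum>k\<in>S. a k * (p k * (\<sigma> s l0 + (x - s j)) ^ (k l0 - c l0) * P k))" if "x \<in> {0..}" for x
  proof -
    have "foldr orthant_partial xs f (s(j := x)) = (\<Sum>k\<in>S. a k * (\<Prod>l\<in>UNIV. (\<Prod>i<c l. real (k l) - real i) *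
                            \<sigma> (s(j := x)) l ^ (k l - c l)))"
      unfolding c_def using Cons.prems that by (intro Cons.IH) auto
    also have "\<dots> = (\<Sum>k\<in>S. a k * (p k * (\<sigma> s l0 + (x - s j)) ^ (k l0 - c l0) * P k))"
      unfolding P_def p_def by (subst split) (auto simp: \<sigma>' intro!: sum.cong prod.cong)
    finally show ?thesis .
  qed
  let ?D = "\<Sum>k\<in>S. a k * (p k * (real (k l0 - c l0) * \<sigma> s l0 ^ (k l0 - c l0 - 1)) * P k)"
  have "((\<lambda>x. \<Sum>k\<in>S. a k * (p k * (\<sigma> s l0 + (x - s j)) ^ (k l0 - c l0) * P k)) has_real_derivative ?D)
          (at (s j) within {0..})"
    by (auto intro!: derivative_eq_intros sum.cong simp: mult_ac)
  then have "((\<lambda>x. foldr orthant_partial xs f (s(j := x))) has_vector_derivative ?D) (at (s j) within {0..})"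
    unfolding has_real_derivative_iff_has_vector_derivative
    using Cons.prems(2)[of j] by (rule_tac has_vector_derivative_transform) (auto simp: G)
  \<comment> \<open>\<open>vector_derivative\<close> is a choice; it is determined because no point
    of the half-line is isolated in it, not even 0.\<close>
  moreover have "at (s j) within {0..} \<noteq> bot"
    using Cons.prems(2)[of j] by (cases "s j = 0") (auto simp: at_within_Ici_at_right at_within_interior[of "s j" "{0..}"])
  ultimately have "foldr orthant_partial (j # xs) f s = ?D"
    by (simp add: orthant_partial_def vector_derivative_within)
  also have "\<dots> = (\<Sum>k\<in>S. a k * (\<Prod>l\<in>UNIV. (\<Prod>i<count_list (map ((!) ls) (j # xs)) l. real (k l) - real i) *
                            \<sigma> s l ^ (k l - count_list (map ((!) ls) (j # xs)) l)))"
  proof (intro sum.cong refl arg_cong[where f="\<lambda>x. a _ * x"])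
    fix k
    have "p k * (real (k l0 - c l0) * \<sigma> s l0 ^ (k l0 - c l0 - 1)) =
      (\<Prod>i<Suc (c l0). real (k l0) - real i) * \<sigma> s l0 ^ (k l0 - Suc (c l0))"
    proof (cases "c l0 \<le> k l0")
      case True
      then show ?thesis by (simp add: p_def of_nat_diff)
    next
      \<comment> \<open>The truncated exponent is wrong here, but the falling factorial then
        contains the factor 0.\<close>
      case False
      then have "(\<Prod>i<c l0. real (k l0) - real i) = 0" by (auto simp: not_le intro!: prod_zero)
      then show ?thesis by (simp add: p_def)
    qed
    moreover have "P k = (\<Prod>l\<in>UNIV-{l0}. (\<Prod>i<count_list (map ((!) ls) (j # xs)) l. real (k l) - real i) *
                            \<sigma> s l ^ (k l - count_list (map ((!) ls) (j # xs)) l))"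
      unfolding P_def c_def l0_def by (intro prod.cong) auto
    ultimately show "p k * (real (k l0 - c l0) * \<sigma> s l0 ^ (k l0 - c l0 - 1)) * P k =
       (\<Prod>l\<in>UNIV. (\<Prod>i<count_list (map ((!) ls) (j # xs)) l. real (k l) - real i) *
                            \<sigma> s l ^ (k l - count_list (map ((!) ls) (j # xs)) l))"
      by (subst split) (simp add: l0_def c_def)
  qed
  finally show ?case .
qed

lemma prod_diff_eq_fact: "(\<Prod>i<n. real n - real i) = fact n"
  by (simp add: fact_prod_rev of_nat_diff atLeast0LessThan)

lemma finite_exponents: "finite {k :: 'l::finite \<Rightarrow> nat. (\<Sum>l\<in>UNIV. k l) = N}"
proof (rule finite_subset)
  show "{k :: 'l \<Rightarrow> nat. (\<Sum>l\<in>UNIV. k l) = N} \<subseteq> UNIV \<rightarrow>\<^sub>E {..N}"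
  proof
    fix k :: "'l \<Rightarrow> nat" assume k: "k \<in> {k. (\<Sum>l\<in>UNIV. k l) = N}"
    have "k l \<le> N" for l using member_le_sum[of l UNIV k] k by auto
    then show "k \<in> UNIV \<rightarrow>\<^sub>E {..N}" by auto
  qed
qed (intro finite_PiE; simp)

text \<open>Differentiating a homogeneous polynomial as often as its degree and evaluating at 0
  isolates one coefficient. Any other exponent of the same total exceeds
  \<open>count_list ls\<close> at some index, so a positive power of 0 survives there; the matching
  exponent leaves only \<open>0 ^ 0 = 1\<close>.\<close>

lemma mixed_volume_map:
  fixes \<K> :: "'l::finite \<Rightarrow> 'a::euclidean_space set" and ls :: "'l list"
  defines "S \<equiv> {k. (\<Sum>l\<in>UNIV. k l) = length ls}"
  assumes \<K>: "\<And>l. convex (\<K> l)" "\<And>l. \<K> l \<noteq> {}"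
    and vol: "\<And>\<sigma>. (\<And>l. 0 \<le> \<sigma> l) \<Longrightarrow>
      measure lebesgue (minkowski \<sigma> \<K>) = (\<Sum>k\<in>S. a k * (\<Prod>l\<in>UNIV. \<sigma> l ^ k l))"
  shows "mixed_volume (map \<K> ls) =
    a (count_list ls) * (\<Prod>l\<in>UNIV. fact (count_list ls l)) / fact (length ls)"
proof -
  define N where "N = length ls"
  have finS: "finite S" unfolding S_def by (rule finite_exponents)
  have "combination_volume (map \<K> ls) s =
      (\<Sum>k\<in>S. a k * (\<Prod>l\<in>UNIV. (\<Sum>i | i < length ls \<and> ls ! i = l. s i) ^ k l))"
    if "\<And>i. 0 \<le> s i" for s
  proof -
    have "(\<Sum>i<length (map \<K> ls). (\<lambda>x. s i *\<^sub>R x) ` (map \<K> ls ! i)) =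
          (\<Sum>i<length ls. (*\<^sub>R) (s i) ` \<K> (ls ! i))" by (auto intro!: sum.cong)
    also have "\<dots> = (\<Sum>l\<in>UNIV. \<Sum>i | i \<in> {..<length ls} \<and> ls ! i = l. (*\<^sub>R) (s i) ` \<K> (ls ! i))"
      by (rule sum.group[symmetric]) auto
    also have "\<dots> = (\<Sum>l\<in>UNIV. \<Sum>i | i < length ls \<and> ls ! i = l. (*\<^sub>R) (s i) ` \<K> l)"
      by (auto intro!: sum.cong)
    also have "\<dots> = (\<Sum>l\<in>UNIV. (*\<^sub>R) (\<Sum>i | i < length ls \<and> ls ! i = l. s i) ` \<K> l)"
      using that \<K> by (simp add: scaleR_image_sum)
    finally show ?thesis
      unfolding combination_volume_def using that by (simp add: vol sum_nonneg)
  qed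
  then have "foldr orthant_partial [0..<N] (combination_volume (map \<K> ls)) (\<lambda>_. 0) =
    (\<Sum>k\<in>S. a k * (\<Prod>l\<in>UNIV. (\<Prod>i<count_list (map ((!) ls) [0..<N]) l. real (k l) - real i) *
                   (\<Sum>i | i < length ls \<and> ls ! i = l. 0) ^ (k l - count_list (map ((!) ls) [0..<N]) l)))"
    by (intro iterated_orthant_partial finS) (auto simp: N_def)
  also have "map ((!) ls) [0..<N] = ls" by (simp add: N_def map_nth)
  also have "(\<Sum>k\<in>S. a k * (\<Prod>l\<in>UNIV. (\<Prod>i<count_list ls l. real (k l) - real i) *
                   (\<Sum>i | i < length ls \<and> ls ! i = l. 0) ^ (k l - count_list ls l))) =
      (\<Sum>k\<in>S. if k = count_list ls then a k * (\<Prod>l\<in>UNIV. fact (count_list ls l)) else 0)"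
  proof (intro sum.cong refl)
    fix k assume k: "k \<in> S"
    show "a k * (\<Prod>l\<in>UNIV. (\<Prod>i<count_list ls l. real (k l) - real i) *
                   (\<Sum>i | i < length ls \<and> ls ! i = l. 0) ^ (k l - count_list ls l)) =
      (if k = count_list ls then a k * (\<Prod>l\<in>UNIV. fact (count_list ls l)) else 0)"
    proof (cases "k = count_list ls")
      case True
      then show ?thesis by (simp add: prod_diff_eq_fact)
    next
      case False
      have "(\<Sum>l\<in>UNIV. count_list ls l) = (\<Sum>l\<in>set ls. count_list ls l)"
        by (rule sum.mono_neutral_right) (auto simp: count_list_0_iff)
      then have c: "(\<Sum>l\<in>UNIV. count_list ls l) = (\<Sum>l\<in>UNIV. k l)"
        using k by (simp add: S_def sum_count_set)
      have "\<exists>l. count_list ls l < k l"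
      proof (rule ccontr)
        assume "\<not> ?thesis"
        then have le: "k l \<le> count_list ls l" for l by (simp add: not_less)
        obtain l where "k l \<noteq> count_list ls l" using False by auto
        then have "k l < count_list ls l" using le[of l] by simp
        then have "(\<Sum>l\<in>UNIV. k l) < (\<Sum>l\<in>UNIV. count_list ls l)"
          by (intro sum_strict_mono_ex1) (auto simp: le)
        then show False using c by simp
      qed
      then obtain l where "count_list ls l < k l" by blast
      then have "(\<Prod>l\<in>UNIV. (\<Prod>i<count_list ls l. real (k l) - real i) *
                   (\<Sum>i | i < length ls \<and> ls ! i = l. 0 :: real) ^ (k l - count_list ls l)) = 0"
        by (intro prod_zero) (auto intro!: exI[of _ l])
      then show ?thesis using False by simp
    qed
  qed
  also have "\<dots> = a (count_list ls) * (\<Prod>l\<in>UNIV. fact (count_list ls l))"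
  proof -
    have "(\<Sum>l\<in>UNIV. count_list ls l) = (\<Sum>l\<in>set ls. count_list ls l)"
      by (rule sum.mono_neutral_right) (auto simp: count_list_0_iff)
    then have "count_list ls \<in> S" by (simp add: S_def sum_count_set)
    then show ?thesis using finS by (simp add: sum.delta)
  qed
  finally show ?thesis by (simp add: mixed_volume_def N_def)
qed

subsection \<open>Volume under linear maps\<close>

lemma nn_integral_lborel_translate_reflect:
  fixes t :: "'a::euclidean_space"
  assumes "h \<in> borel_measurable borel" "\<bar>c\<bar> = (1::real)"
  shows "(\<integral>\<^sup>+x. h (t + c *\<^sub>R x) \<partial>lborel) = (\<integral>\<^sup>+x. h x \<partial>lborel)"
proof -
  have "c \<noteq> 0" using assms(2) by auto
  have "(\<integral>\<^sup>+x. h x \<partial>lborel) = (\<integral>\<^sup>+x. h x \<partial>density (distr lborel borel (\<lambda>x. t + c *\<^sub>R x)) (\<lambda>_. \<bar>c\<bar>^DIM('a)))"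
    using lborel_affine[OF \<open>c \<noteq> 0\<close>, of t] by simp
  also have "\<dots> = (\<integral>\<^sup>+x. h (t + c *\<^sub>R x) \<partial>lborel)"
    using assms by (simp add: nn_integral_density nn_integral_distr)
  finally show ?thesis by simp
qed

text \<open>
  Uniqueness of Haar measure: both sides are the integral of \<open>1\<^sub>A(x) 1\<^sub>B(x + g y)\<close> over all \<open>x\<close>, \<open>y\<close>.
\<close>

lemma emeasure_linear_image_swap:
  fixes f :: "'a::euclidean_space \<Rightarrow> 'a"
  assumes f: "linear f" "inj f" and A[measurable]: "A \<in> sets borel" and B[measurable]: "B \<in> sets borel"
  shows "emeasure lborel A * emeasure lborel (f ` B) = emeasure lborel B * emeasure lborel (f ` A)"
proof -
  obtain g where g: "linear g" "\<And>x. g (f x) = x" "\<And>x. f (g x) = x"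
    using linear_injective_isomorphism[OF f] by metis
  have [measurable]: "g \<in> borel_measurable borel" using g(1)
    by (intro borel_measurable_continuous_onI) (simp add: linear_continuous_on linear_conv_bounded_linear)
  have [measurable]: "f \<in> borel_measurable borel" using f(1)
    by (intro borel_measurable_continuous_onI) (simp add: linear_continuous_on linear_conv_bounded_linear)
  have ind: "emeasure lborel (f ` X) = (\<integral>\<^sup>+y. indicator X (g y) \<partial>lborel)" if [measurable]: "X \<in> sets borel" for X
  proof -
    have "f ` X = g -` X" using g by (auto simp: image_iff) metis
    moreover have "g -` X \<inter> space borel \<in> sets borel" by measurable
    ultimately show ?thesis by (simp add: nn_integral_indicator[symmetric] indicator_def flip: nn_integral_indicator)
  qed
  have "emeasure lborel A * emeasure lborel (f ` B) = (\<integral>\<^sup>+x. indicator A x * (\<integral>\<^sup>+y. indicator B (g y) \<partial>lborel) \<partial>lborel)"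
    by (simp add: ind nn_integral_multc)
  also have "\<dots> = (\<integral>\<^sup>+x. (\<integral>\<^sup>+y. indicator A x * indicator B (g y + x) \<partial>lborel) \<partial>lborel)"
  proof (rule nn_integral_cong)
    fix x
    have "(\<integral>\<^sup>+y. indicator B (g y) \<partial>lborel) = (\<integral>\<^sup>+y. indicator B (g (f x + 1 *\<^sub>R y)) \<partial>lborel)"
      by (rule nn_integral_lborel_translate_reflect[symmetric]) auto
    then show "(indicator A x :: ennreal) * (\<integral>\<^sup>+y. indicator B (g y) \<partial>lborel) = (\<integral>\<^sup>+y. indicator A x * indicator B (g y + x) \<partial>lborel)"
      using g by (simp add: linear_add add.commute nn_integral_cmult)
  qed
  also have "\<dots> = (\<integral>\<^sup>+y. (\<integral>\<^sup>+x. indicator A x * indicator B (g y + x) \<partial>lborel) \<partial>lborel)"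
    by (rule lborel_pair.Fubini') simp
  also have "\<dots> = (\<integral>\<^sup>+y. (\<integral>\<^sup>+x. indicator A (x - g y) * indicator B x \<partial>lborel) \<partial>lborel)"
  proof (rule nn_integral_cong)
    fix y
    show "(\<integral>\<^sup>+x. (indicator A x :: ennreal) * indicator B (g y + x) \<partial>lborel) = (\<integral>\<^sup>+x. indicator A (x - g y) * indicator B x \<partial>lborel)"
      using nn_integral_lborel_translate_reflect[of "\<lambda>x. indicator A (x - g y) * indicator B x" 1 "g y"] by simp
  qed
  also have "\<dots> = (\<integral>\<^sup>+x. (\<integral>\<^sup>+y. indicator A (x - g y) * indicator B x \<partial>lborel) \<partial>lborel)"
    by (rule lborel_pair.Fubini') simp
  also have "\<dots> = (\<integral>\<^sup>+x. indicator B x * (\<integral>\<^sup>+y. indicator A (g y) \<partial>lborel) \<partial>lborel)"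
  proof (rule nn_integral_cong)
    fix x
    have "(\<integral>\<^sup>+y. (indicator A (g y) :: ennreal) \<partial>lborel) = (\<integral>\<^sup>+y. indicator A (g (f x + (-1) *\<^sub>R y)) \<partial>lborel)"
      by (rule nn_integral_lborel_translate_reflect[symmetric]) auto
    then show "(\<integral>\<^sup>+y. (indicator A (x - g y) :: ennreal) * indicator B x \<partial>lborel) = indicator B x * (\<integral>\<^sup>+y. indicator A (g y) \<partial>lborel)"
      using g by (simp add: linear_diff mult.commute nn_integral_cmult)
  qed
  also have "\<dots> = emeasure lborel B * emeasure lborel (f ` A)"
    by (simp add: ind nn_integral_multc)
  finally show ?thesis .
qed

text \<open>The volume of the image of the unit cube acts as the absolute determinant. The preceding
  swap identity, applied to this cube and a box, gives the scaling of boxes, and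
  \<open>measure_linear_sufficient\<close> carries it to all sets of finite measure.\<close>

lemma
  fixes f :: "'a::euclidean_space \<Rightarrow> 'a"
  assumes f: "linear f" "inj f" and S: "S \<in> lmeasurable"
  shows lmeasurable_linear_inj_image: "f ` S \<in> lmeasurable"
    and measure_linear_image_scale: "measure lebesgue (f ` S) = measure lebesgue (f ` cbox 0 One) * measure lebesgue S"
proof -
  have borel: "f ` cbox a b \<in> sets borel" for a b
    using f(1) by (intro borel_compact compact_continuous_image) (auto simp: linear_continuous_on linear_conv_bounded_linear)
  have fin: "emeasure lborel (f ` cbox a b) = ennreal (measure lebesgue (f ` cbox a b))" for a b
  proof -
    have "compact (f ` cbox a b)"
      using f(1) by (intro compact_continuous_image) (auto simp: linear_continuous_on linear_conv_bounded_linear)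
    then have "emeasure lborel (f ` cbox a b) \<noteq> top"
      using emeasure_compact_finite by fastforce
    then have "emeasure lborel (f ` cbox a b) = ennreal (measure lborel (f ` cbox a b))"
      by (rule emeasure_eq_ennreal_measure)
    then show ?thesis using borel by (simp add: measure_completion)
  qed
  have cbox: "measure lebesgue (f ` cbox a b) = measure lebesgue (f ` cbox 0 One) * measure lebesgue (cbox a b)" for a b
  proof -
    have "emeasure lborel (cbox 0 One :: 'a set) = 1" by (simp add: emeasure_lborel_cbox_eq)
    moreover have "emeasure lborel (cbox a b) = ennreal (measure lebesgue (cbox a b))"
      
    proof -
      have "emeasure lborel (cbox a b) \<noteq> top"
        using emeasure_compact_finite[OF compact_cbox[of a b]] by simp
      then have "emeasure lborel (cbox a b) = ennreal (measure lborel (cbox a b))"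
        by (rule emeasure_eq_ennreal_measure)
      then show ?thesis by (simp add: measure_completion)
    qed
    ultimately have "ennreal (measure lebesgue (f ` cbox a b)) =
        ennreal (measure lebesgue (cbox a b)) * ennreal (measure lebesgue (f ` cbox 0 One))"
      using emeasure_linear_image_swap[OF f, of "cbox 0 One" "cbox a b"] by (simp add: fin)
    then show ?thesis by (simp flip: ennreal_mult' add: mult.commute)
  qed
  have *: "f ` S \<in> lmeasurable \<and> measure lebesgue (f ` cbox 0 One) * measure lebesgue S = measure lebesgue (f ` S)"
    by (rule measure_linear_sufficient[OF f(1) S cbox])
  show "f ` S \<in> lmeasurable" by (rule conjunct1[OF *])
  show "measure lebesgue (f ` S) = measure lebesgue (f ` cbox 0 One) * measure lebesgue S"
    by (rule conjunct2[OF *, symmetric])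
qed

text \<open>The unit cube becomes the box with side lengths \<open>d j\<close>, which evaluates the
  factor of the preceding lemma.\<close>

lemma
  fixes S :: "'a::euclidean_space set"
  assumes d: "\<And>j. j \<in> Basis \<Longrightarrow> 0 < d j" and S: "S \<in> lmeasurable"
  shows lmeasurable_stretch_Basis: "(\<lambda>x. \<Sum>j\<in>Basis. (d j * (x \<bullet> j)) *\<^sub>R j) ` S \<in> lmeasurable"
    and measure_stretch_Basis: "measure lebesgue ((\<lambda>x. \<Sum>j\<in>Basis. (d j * (x \<bullet> j)) *\<^sub>R j) ` S) = (\<Prod>j\<in>Basis. d j) * measure lebesgue S"
proof -
  let ?D = "\<lambda>x::'a. \<Sum>j\<in>Basis. (d j * (x \<bullet> j)) *\<^sub>R j"
  have lin: "linear ?D"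
    by (auto intro!: linearI simp: inner_left_distrib algebra_simps sum.distrib scaleR_sum_right)
  have inner: "?D x \<bullet> j = d j * (x \<bullet> j)" if "j \<in> Basis" for x j using that by simp
  have inj: "inj ?D"
  proof (rule injI)
    fix x y assume "?D x = ?D y"
    then have "d j * (x \<bullet> j) = d j * (y \<bullet> j)" if "j \<in> Basis" for j using inner[OF that] by metis
    then have "x \<bullet> j = y \<bullet> j" if "j \<in> Basis" for j using d[OF that] that by fastforce
    then show "x = y" by (rule euclidean_eqI)
  qed
  have box: "?D ` cbox 0 One = cbox 0 (\<Sum>j\<in>Basis. d j *\<^sub>R j)"
  proof (intro equalityI subsetI)
    fix x :: 'a assume "x \<in> cbox 0 (\<Sum>j\<in>Basis. d j *\<^sub>R j)"
    then have x: "0 \<le> x \<bullet> j \<and> x \<bullet> j \<le> d j" if "j \<in> Basis" for j using that by (auto simp: mem_box)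
    have "x = ?D (\<Sum>j\<in>Basis. (x \<bullet> j / d j) *\<^sub>R j)"
    proof (rule euclidean_eqI)
      fix j :: 'a assume "j \<in> Basis"
      then show "x \<bullet> j = ?D (\<Sum>j\<in>Basis. (x \<bullet> j / d j) *\<^sub>R j) \<bullet> j" using d[of j] by simp
    qed
    moreover have "(\<Sum>j\<in>Basis. (x \<bullet> j / d j) *\<^sub>R j) \<in> cbox 0 One" using x d by (force simp: mem_box)
    ultimately show "x \<in> ?D ` cbox 0 One" by blast
  next
    fix x :: 'a assume "x \<in> ?D ` cbox 0 One"
    then obtain y where y: "x = ?D y" "y \<in> cbox 0 One" by (rule imageE)
    then have y1: "0 \<le> y \<bullet> j \<and> y \<bullet> j \<le> 1" if "j \<in> Basis" for j
      using that by (simp add: mem_box)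
    have "0 \<le> x \<bullet> j \<and> x \<bullet> j \<le> d j" if "j \<in> Basis" for j
      using y1[OF that] d[OF that] unfolding y(1) inner[OF that] by (simp add: mult_left_le)
    then show "x \<in> cbox 0 (\<Sum>j\<in>Basis. d j *\<^sub>R j)" by (simp add: mem_box)
  qed
  have vol: "measure lebesgue (cbox 0 (\<Sum>j\<in>Basis. d j *\<^sub>R j) :: 'a set) = (\<Prod>j\<in>Basis. d j)"
  proof -
    have "measure lborel (cbox 0 (\<Sum>j\<in>Basis. d j *\<^sub>R j) :: 'a set) = (\<Prod>j\<in>Basis. (\<Sum>j\<in>Basis. d j *\<^sub>R j) \<bullet> j - 0 \<bullet> j)"
      using d by (intro content_cbox') (auto simp: box_ne_empty less_imp_le)
    then show ?thesis by (simp add: measure_completion)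
  qed
  show "?D ` S \<in> lmeasurable" by (rule lmeasurable_linear_inj_image[OF lin inj S])
  show "measure lebesgue (?D ` S) = (\<Prod>j\<in>Basis. d j) * measure lebesgue S"
    using measure_linear_image_scale[OF lin inj S] unfolding box vol .
qed

subsection \<open>Triangulations of polyhedral cones\<close>

text \<open>The cone generated by \<open>E\<close>. It has this meaning for finite \<open>E\<close>
  only, as sums over infinite sets are 0.\<close>

definition pos_span :: "'a::real_vector set \<Rightarrow> 'a set" where
  "pos_span E = {\<Sum>e\<in>E. c e *\<^sub>R e | c. \<forall>e\<in>E. 0 \<le> c e}"

lemma pos_spanI: "(\<And>e. e \<in> E \<Longrightarrow> 0 \<le> c e) \<Longrightarrow> z = (\<Sum>e\<in>E. c e *\<^sub>R e) \<Longrightarrow> z \<in> pos_span E"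
  unfolding pos_span_def by blast

lemma pos_spanE:
  assumes "z \<in> pos_span E"
  obtains c where "\<And>e. e \<in> E \<Longrightarrow> 0 \<le> c e" "z = (\<Sum>e\<in>E. c e *\<^sub>R e)"
  using assms unfolding pos_span_def by blast

lemma pos_span_mono:
  assumes "finite E" "B \<subseteq> E"
  shows "pos_span B \<subseteq> pos_span E"
proof
  fix z assume "z \<in> pos_span B"
  then obtain c where c: "\<And>e. e \<in> B \<Longrightarrow> 0 \<le> c e" "z = (\<Sum>e\<in>B. c e *\<^sub>R e)" by (rule pos_spanE) blast
  have "z = (\<Sum>e\<in>E. (if e \<in> B then c e else 0) *\<^sub>R e)"
    unfolding c(2) using assms by (intro sum.mono_neutral_cong_left) auto
  then show "z \<in> pos_span E" using c(1) by (intro pos_spanI[where c="\<lambda>e. if e \<in> B then c e else 0"]) auto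
qed

lemma convex_pos_span: "convex (pos_span E)"
proof (rule convexI)
  fix x y u v assume "x \<in> pos_span E" "y \<in> pos_span E" and uv: "0 \<le> u" "0 \<le> v" "u + v = (1::real)"
  then obtain c d where "\<And>e. e \<in> E \<Longrightarrow> 0 \<le> c e" "x = (\<Sum>e\<in>E. c e *\<^sub>R e)"
     "\<And>e. e \<in> E \<Longrightarrow> 0 \<le> d e" "y = (\<Sum>e\<in>E. d e *\<^sub>R e)" by (auto elim!: pos_spanE)
  then show "u *\<^sub>R x + v *\<^sub>R y \<in> pos_span E" using uv
    by (intro pos_spanI[where c="\<lambda>e. u * c e + v * d e"])
       (auto simp: scaleR_add_left sum.distrib scaleR_sum_right)
qed

text \<open>The minimum ratio rule: the chosen quotient is the largest step along \<open>- u\<close>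
  that keeps all coefficients nonnegative, and the coefficient of \<open>v\<close> drops to 0. It
  serves both the shrinking of a dependent generating set and the pivot step.\<close>

lemma ratio_test:
  fixes c u :: "'a \<Rightarrow> real"
  assumes "finite S" "\<And>w. w \<in> S \<Longrightarrow> 0 \<le> c w" "\<exists>v\<in>S. 0 < u v"
  obtains v where "v \<in> S" "0 < u v" "\<And>w. w \<in> S \<Longrightarrow> 0 \<le> c w - c v / u v * u w"
proof -
  let ?T = "{v \<in> S. 0 < u v}"
  have "finite ?T" "?T \<noteq> {}" using assms by auto
  then obtain v where v: "v \<in> ?T" "\<And>w. w \<in> ?T \<Longrightarrow> c v / u v \<le> c w / u w"
    using ex_min_if_finite[of "(\<lambda>v. c v / u v) ` ?T"] by (fastforce simp: not_less)
  have "0 \<le> c w - c v / u v * u w" if w: "w \<in> S" for w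
  proof (cases "0 < u w")
    case True
    then show ?thesis using v(2)[of w] w by (simp add: pos_le_divide_eq)
  next
    case False
    then have "c v / u v * u w \<le> 0" using v(1) assms(2) by (intro mult_nonneg_nonpos) auto
    then show ?thesis using assms(2)[OF w] by linarith
  qed
  then show thesis using v(1) that by auto
qed

text \<open>In a generating set of least size, a linear dependence could be subtracted from the
  coefficients until one of them vanishes, which would give a smaller set.\<close>

lemma caratheodory_pos_span:
  assumes "finite E" "z \<in> pos_span E"
  obtains B where "B \<subseteq> E" "independent B" "z \<in> pos_span B"
proof -
  let ?P = "\<lambda>n. \<exists>B\<subseteq>E. z \<in> pos_span B \<and> card B = n"
  have "?P (LEAST n. ?P n)" using assms(2) by (intro LeastI[of ?P "card E"]) blast
  then obtain B where B: "B \<subseteq> E" "z \<in> pos_span B" "card B = (LEAST n. ?P n)" by blast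
  then have fB: "finite B" using assms(1) finite_subset by blast
  obtain c where c: "\<And>e. e \<in> B \<Longrightarrow> 0 \<le> c e" "z = (\<Sum>e\<in>B. c e *\<^sub>R e)"
    using B(2) by (rule pos_spanE) blast
  have "independent B"
  proof (rule ccontr)
    assume "\<not> independent B"
    then obtain u0 v0 where u0: "v0 \<in> B" "u0 v0 \<noteq> 0" "(\<Sum>e\<in>B. u0 e *\<^sub>R e) = 0"
      using real_vector.dependent_finite[OF fB] by blast
    \<comment> \<open>Changing the sign if necessary makes some coefficient of the dependence
      positive, as the ratio test requires.\<close>
    define u where "u e = (if u0 v0 > 0 then u0 e else - u0 e)" for e
    have u: "u v0 > 0" "(\<Sum>e\<in>B. u e *\<^sub>R e) = 0"
      using u0 by (cases "u0 v0 > 0"; auto simp: u_def sum_negf)+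
    obtain v where v: "v \<in> B" "0 < u v" "\<And>w. w \<in> B \<Longrightarrow> 0 \<le> c w - c v / u v * u w"
      using ratio_test[OF fB, of c u] c(1) u(1) u0(1) by blast
    have "z = (\<Sum>e\<in>B. (c e - c v / u v * u e) *\<^sub>R e)"
      using u(2) by (simp add: c(2) scaleR_diff_left sum_subtractf flip: scaleR_scaleR scaleR_sum_right
          del: times_divide_eq_left)
    also have "\<dots> = (\<Sum>e\<in>B-{v}. (c e - c v / u v * u e) *\<^sub>R e)"
      using v(1,2) fB by (intro sum.mono_neutral_right) auto
    finally have "z \<in> pos_span (B - {v})" using v(3) by (intro pos_spanI) auto
    then have "?P (card (B - {v}))" using B(1) by blast
    then have "(LEAST n. ?P n) \<le> card (B - {v})" by (rule Least_le)
    then show False using B(3) v(1) fB by (metis card_Diff1_less not_less)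
  qed
  then show thesis using B that by blast
qed

section \<open>The simplex method and regular triangulations\<close>

lemma sum_pivot:
  assumes "finite B" "v \<notin> B"
  shows "(\<Sum>e\<in>insert v (B - {b}). h (if e = v then x else y e) e) = h x v + (\<Sum>e\<in>B-{b}. h (y e) e)"
proof -
  have "(\<Sum>e\<in>B-{b}. h (if e = v then x else y e) e) = (\<Sum>e\<in>B-{b}. h (y e) e)"
    using assms by (intro sum.cong) auto
  then show ?thesis using assms by (subst sum.insert) auto
qed

lemma independent_full_span:
  fixes B :: "'a::euclidean_space set"
  assumes "independent B" "card B = DIM('a)"
  shows "span B = UNIV"
proof -
  have "finite B" using assms(1) by (rule independent_imp_finite)
  then have "UNIV \<subseteq> span B" using assms by (intro card_ge_dim_independent) auto
  then show ?thesis by auto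
qed

lemma span_full_independent:
  fixes B :: "'a::euclidean_space set"
  assumes "span B = UNIV" "finite B" "card B \<le> DIM('a)"
  shows "independent B" "card B = DIM('a)"
proof -
  show "independent B" using assms by (intro card_le_dim_spanning[of B UNIV]) auto
  have "DIM('a) \<le> card B" using dim_le_card[of UNIV B] assms by simp
  then show "card B = DIM('a)" using assms(3) by simp
qed

text \<open>
  This is the simplex algorithm: among the bases whose cone contains \<open>z\<close>, one of least cost is dual
  feasible, since otherwise a pivot step would lower the cost.
\<close>

lemma dual_feasible_basis:
  fixes E :: "'a::euclidean_space set" and \<omega> :: "'a \<Rightarrow> real"
  assumes E: "finite E" and \<omega>: "\<And>e. e \<in> E \<Longrightarrow> 0 < \<omega> e"
    and z: "z \<in> pos_span E" and nondeg: "\<And>S. S \<subseteq> E \<Longrightarrow> card S < DIM('a) \<Longrightarrow> z \<notin> span S"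
  shows "\<exists>B\<subseteq>E. independent B \<and> card B = DIM('a) \<and> z \<in> pos_span B \<and>
    (\<exists>f. linear f \<and> (\<forall>b\<in>B. f b = \<omega> b) \<and> (\<forall>e\<in>E. f e \<le> \<omega> e))"
proof -
  define \<B> where "\<B> = {B. B \<subseteq> E \<and> independent B \<and> card B = DIM('a) \<and> z \<in> pos_span B}"
  \<comment> \<open>\<open>F B\<close> is the dual solution belonging to the basis \<open>B\<close>.
    At \<open>z\<close> it equals the cost of the representation of \<open>z\<close> in
    \<open>B\<close>, so minimising \<open>F B z\<close> selects the cheapest basis.\<close>
  have "\<exists>f::'a \<Rightarrow> real. linear f \<and> (\<forall>b\<in>B. f b = \<omega> b)" if "B \<in> \<B>" for B
    using that by (intro linear_independent_extend) (auto simp: \<B>_def)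
  then obtain F :: "'a set \<Rightarrow> 'a \<Rightarrow> real"
    where F: "\<And>B. B \<in> \<B> \<Longrightarrow> linear (F B)" "\<And>B b. B \<in> \<B> \<Longrightarrow> b \<in> B \<Longrightarrow> F B b = \<omega> b"
    by metis
  have "finite \<B>" unfolding \<B>_def using E by simp
  moreover have "\<B> \<noteq> {}"
  proof -
    obtain B where B: "B \<subseteq> E" "independent B" "z \<in> pos_span B"
      using caratheodory_pos_span[OF E z] by blast
    have "z \<in> span B" using B(3)
      by (auto elim!: pos_spanE intro!: span_sum span_scale intro: span_base)
    then have "\<not> card B < DIM('a)" using nondeg B(1) by blast
    moreover have "card B \<le> DIM('a)" using independent_bound_general[OF B(2)] dim_subset_UNIV[of B] by linarith
    ultimately show ?thesis using B by (auto simp: \<B>_def)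
  qed
  ultimately obtain B where B: "B \<in> \<B>" "\<And>B'. B' \<in> \<B> \<Longrightarrow> F B z \<le> F B' z"
    by (metis ex_is_arg_min_if_finite is_arg_min_linorder)
  have B': "B \<subseteq> E" "independent B" "card B = DIM('a)" "z \<in> pos_span B" "span B = UNIV"
    using B(1) by (auto simp: \<B>_def independent_full_span)
  have fB: "finite B" using B'(1) E finite_subset by blast
  obtain c where c: "\<And>e. e \<in> B \<Longrightarrow> 0 \<le> c e" "z = (\<Sum>e\<in>B. c e *\<^sub>R e)"
    using B'(4) by (rule pos_spanE) blast
  have "F B v \<le> \<omega> v" if v: "v \<in> E" for v
  proof (rule ccontr)
    assume "\<not> F B v \<le> \<omega> v"
    then have gt: "\<omega> v < F B v" by simp
    then have vB: "v \<notin> B" using F(2)[OF B(1)] by force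
    have "v \<in> span B" using B'(5) by simp
    then obtain a where a: "v = (\<Sum>b\<in>B. a b *\<^sub>R b)"
      using span_finite[OF fB] by blast
    have Fv: "F B v = (\<Sum>b\<in>B. a b * \<omega> b)"
      unfolding a using F[OF B(1)] by (simp add: linear_sum linear_cmul)
    \<comment> \<open>The costs are positive, so \<open>v\<close> cannot be a nonpositive
      combination of \<open>B\<close>: its value under \<open>F B\<close> would then be at most
      0.\<close>
    have "\<exists>b\<in>B. 0 < a b"
    proof (rule ccontr)
      assume "\<not> ?thesis"
      then have "F B v \<le> 0" unfolding Fv using \<omega> B'(1)
        by (intro sum_nonpos mult_nonpos_nonneg) (auto simp: not_less less_imp_le subset_eq)
      then show False using gt \<omega>[OF v] by simp
    qed
    then obtain b where b: "b \<in> B" "0 < a b" "\<And>w. w \<in> B \<Longrightarrow> 0 \<le> c w - c b / a b * a w"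
      using ratio_test[OF fB, of c a] c(1) by blast
    define \<theta> where "\<theta> = c b / a b"
    define B1 where "B1 = insert v (B - {b})"
    define c1 where "c1 e = (if e = v then \<theta> else c e - \<theta> * a e)" for e
    have sum1: "(\<Sum>e\<in>B1. c1 e *\<^sub>R e) = \<theta> *\<^sub>R v + (\<Sum>e\<in>B-{b}. (c e - \<theta> * a e) *\<^sub>R e)"
      "(\<Sum>e\<in>B1. c1 e * \<omega> e) = \<theta> * \<omega> v + (\<Sum>e\<in>B-{b}. (c e - \<theta> * a e) * \<omega> e)"
      unfolding B1_def c1_def using fB vB 
      by (fact sum_pivot[where h="(*\<^sub>R)"], fact sum_pivot[where h="\<lambda>x e. x * \<omega> e"])
    have "(\<Sum>e\<in>B-{b}. (c e - \<theta> * a e) *\<^sub>R e) = (\<Sum>e\<in>B. (c e - \<theta> * a e) *\<^sub>R e)"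
      using b fB by (intro sum.mono_neutral_left) (auto simp: \<theta>_def)
    also have "\<dots> = z - \<theta> *\<^sub>R v"
      unfolding c(2) a by (simp add: scaleR_diff_left sum_subtractf scaleR_sum_right)
    finally have z1: "z = (\<Sum>e\<in>B1. c1 e *\<^sub>R e)" by (simp add: sum1(1))
    have \<theta>0: "0 \<le> \<theta>" using b c(1) by (auto simp: \<theta>_def)
    have c1: "0 \<le> c1 e" if "e \<in> B1" for e
      using that b(3) \<theta>0 by (auto simp: c1_def B1_def \<theta>_def)
    have "b \<in> span B1"
    proof -
      have "v = a b *\<^sub>R b + (\<Sum>e\<in>B-{b}. a e *\<^sub>R e)"
        unfolding a using b(1) fB by (simp add: sum.remove)
      then have "b = (1 / a b) *\<^sub>R (v - (\<Sum>e\<in>B-{b}. a e *\<^sub>R e))"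
        using b(2) by simp
      moreover have "v \<in> span B1" "(\<Sum>e\<in>B-{b}. a e *\<^sub>R e) \<in> span B1"
        by (auto simp: B1_def intro!: span_base span_sum span_scale)
      ultimately show ?thesis by (metis span_diff span_scale)
    qed
    then have "B \<subseteq> span B1" by (auto simp: B1_def intro: span_base)
    then have "span B \<subseteq> span B1" by (simp add: span_minimal)
    then have sp: "span B1 = UNIV" using B'(5) by auto
    have fB1: "finite B1" by (simp add: B1_def fB)
    have "card B1 = card B"
      using b(1) vB fB card_Suc_Diff1[of B b] by (simp add: B1_def card_insert_if)
    then have cB1: "card B1 = DIM('a)" using B'(3) by simp
    then have B1: "B1 \<in> \<B>"
      using span_full_independent[OF sp fB1] B'(1) v c1 z1
      by (auto simp: \<B>_def B1_def intro!: pos_spanI[where c=c1])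
    \<comment> \<open>Nondegeneracy of \<open>z\<close> makes the step length positive, so the pivot
      lowers the cost by the positive amount \<open>\<theta> * (F B v - \<omega> v)\<close>.\<close>
    have "\<theta> \<noteq> 0"
    proof
      assume "\<theta> = 0"
      then have "z = (\<Sum>e\<in>B-{b}. c e *\<^sub>R e)" using z1 by (simp add: sum1(1))
      then have "z \<in> span (B - {b})" by (auto intro!: span_sum span_scale intro: span_base)
      moreover have "card (B - {b}) < DIM('a)" using b(1) fB B'(3) by (metis card_Diff1_less)
      ultimately show False using nondeg[of "B - {b}"] B'(1) by blast
    qed
    then have \<theta>pos: "0 < \<theta>" using \<theta>0 by simp
    have "F B1 z = (\<Sum>e\<in>B1. c1 e * \<omega> e)"
      by (subst z1) (simp add: linear_sum[OF F(1)[OF B1]] linear_cmul[OF F(1)[OF B1]] F(2)[OF B1])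
    also have "\<dots> = \<theta> * \<omega> v + (\<Sum>e\<in>B-{b}. (c e - \<theta> * a e) * \<omega> e)"
      by (rule sum1(2))
    also have "(\<Sum>e\<in>B-{b}. (c e - \<theta> * a e) * \<omega> e) = (\<Sum>e\<in>B. (c e - \<theta> * a e) * \<omega> e)"
      using b fB by (intro sum.mono_neutral_left) (auto simp: \<theta>_def)
    also have "\<dots> = F B z - \<theta> * F B v"
      unfolding Fv unfolding c(2) using F[OF B(1)]
      by (simp add: linear_sum linear_cmul left_diff_distrib sum_subtractf sum_distrib_left mult.assoc)
    also have "\<theta> * \<omega> v + (F B z - \<theta> * F B v) < F B z"
      using mult_strict_left_mono[OF gt \<theta>pos] by simp
    finally show False using B(2)[OF B1] by simp
  qed
  then show ?thesis using B' F[OF B(1)] by blast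
qed

text \<open>The heights are powers \<open>\<epsilon> ^ k e\<close> with distinct exponents. That the
  lifted \<open>e\<close> lies on the hyperplane through the lifted \<open>B\<close> is a polynomial
  equation in \<open>\<epsilon>\<close> whose coefficient at exponent \<open>k e\<close> is -1.
  Hence each of the finitely many pairs \<open>(B, e)\<close> excludes only finitely many
  \<open>\<epsilon>\<close>.\<close>

lemma generic_heights:
  fixes E :: "'a::euclidean_space set"
  assumes "finite E"
  obtains \<omega> :: "'a \<Rightarrow> real" where "\<And>e. e \<in> E \<Longrightarrow> 0 < \<omega> e"
    "\<And>B f e. \<lbrakk>B \<subseteq> E; independent B; card B = DIM('a); linear f; \<And>b. b \<in> B \<Longrightarrow> f b = \<omega> b; e \<in> E - B\<rbrakk>
       \<Longrightarrow> f e \<noteq> \<omega> e"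
proof -
  obtain k :: "'a \<Rightarrow> nat" where k: "inj_on k E"
    using assms finite_imp_inj_to_nat_seg by blast
  define p where "p B e = (\<Sum>b\<in>B. monom (representation B e b) (k b)) - monom 1 (k e)" for B e
  let ?I = "{(B, e). B \<subseteq> E \<and> e \<in> E - B}"
  have "p B e \<noteq> 0" if "(B, e) \<in> ?I" for B e
  proof -
    have "coeff (p B e) (k e) = (\<Sum>b\<in>B. if k b = k e then representation B e b else 0) - 1"
      by (simp add: p_def coeff_sum)
    also have "(\<Sum>b\<in>B. if k b = k e then representation B e b else 0) = 0"
      using that k by (intro sum.neutral) (auto dest: inj_onD)
    finally show ?thesis by auto
  qed
  moreover have "finite ?I"
    by (rule finite_subset[of _ "Pow E \<times> E"]) (use assms in auto)
  ultimately have "finite (\<Union>(B, e)\<in>?I. {x. poly (p B e) x = 0})"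
    by (auto intro!: poly_roots_finite)
  moreover have "infinite {0<..<1::real}" by simp
  ultimately have "\<not> {0<..<1} \<subseteq> (\<Union>(B, e)\<in>?I. {x. poly (p B e) x = 0})"
    by (metis (no_types, lifting) finite_subset)
  then obtain \<epsilon> where \<epsilon>: "\<epsilon> \<in> {0<..<1}" "\<epsilon> \<notin> (\<Union>(B, e)\<in>?I. {x. poly (p B e) x = 0})"
    by blast
  show thesis
  proof (rule that[of "\<lambda>e. \<epsilon> ^ k e"])
    show "0 < \<epsilon> ^ k e" for e using \<epsilon> by simp
  next
    fix B f e
    assume B: "B \<subseteq> E" "independent B" "card B = DIM('a)" and f: "linear f" "\<And>b. b \<in> B \<Longrightarrow> f b = \<epsilon> ^ k b"
      and e: "e \<in> E - B"
    have "finite B" using B(1) assms finite_subset by blast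
    then have "e = (\<Sum>b\<in>B. representation B e b *\<^sub>R b)"
      using B independent_full_span[of B] by (subst real_vector.sum_representation_eq) auto
    then have "f e = f (\<Sum>b\<in>B. representation B e b *\<^sub>R b)" by (rule arg_cong)
    also have "\<dots> = (\<Sum>b\<in>B. representation B e b * \<epsilon> ^ k b)"
      using f by (simp add: linear_sum linear_cmul)
    finally have "f e = (\<Sum>b\<in>B. representation B e b * \<epsilon> ^ k b)" .
    moreover have "poly (p B e) \<epsilon> \<noteq> 0" using \<epsilon>(2) B e by auto
    ultimately show "f e \<noteq> \<epsilon> ^ k e" by (simp add: p_def poly_sum poly_monom)
  qed
qed

text \<open>
  The cones over the sets in \<open>\<T>\<close> triangulate the cone over \<open>E\<close>: they are the projections of the lower
  faces of the cone over the lifted points \<open>(e, \<omega> e)\<close>.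
\<close>

lemma simplicial_cone_decomposition:
  fixes E :: "'a::euclidean_space set"
  assumes E: "finite E"
  obtains \<T> where "finite \<T>" "\<And>B. B \<in> \<T> \<Longrightarrow> B \<subseteq> E \<and> independent B \<and> card B = DIM('a)"
    "\<And>z. \<lbrakk>z \<in> pos_span E; \<And>S. S \<subseteq> E \<Longrightarrow> card S < DIM('a) \<Longrightarrow> z \<notin> span S\<rbrakk> \<Longrightarrow> \<exists>B\<in>\<T>. z \<in> pos_span B"
    "\<And>z B B'. \<lbrakk>B \<in> \<T>; B' \<in> \<T>; z \<in> pos_span B; z \<in> pos_span B';
       \<And>S. S \<subseteq> E \<Longrightarrow> card S < DIM('a) \<Longrightarrow> z \<notin> span S\<rbrakk> \<Longrightarrow> B = B'"
proof -
  obtain \<omega> :: "'a \<Rightarrow> real" where \<omega>: "\<And>e. e \<in> E \<Longrightarrow> 0 < \<omega> e"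
    "\<And>B f e. \<lbrakk>B \<subseteq> E; independent B; card B = DIM('a); linear f; \<And>b. b \<in> B \<Longrightarrow> f b = \<omega> b; e \<in> E - B\<rbrakk>
       \<Longrightarrow> f e \<noteq> \<omega> e"
    by (rule generic_heights[OF E]) blast
  define \<T> where "\<T> = {B. B \<subseteq> E \<and> independent B \<and> card B = DIM('a) \<and>
      (\<exists>f. linear f \<and> (\<forall>b\<in>B. f b = \<omega> b) \<and> (\<forall>e\<in>E. f e \<le> \<omega> e))}"
  show thesis
  proof (rule that[of \<T>])
    show "finite \<T>" unfolding \<T>_def using E by simp
    show "B \<subseteq> E \<and> independent B \<and> card B = DIM('a)" if "B \<in> \<T>" for B using that by (auto simp: \<T>_def)
    show "\<exists>B\<in>\<T>. z \<in> pos_span B"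
      if "z \<in> pos_span E" "\<And>S. S \<subseteq> E \<Longrightarrow> card S < DIM('a) \<Longrightarrow> z \<notin> span S" for z
    proof -
      have "\<exists>B\<subseteq>E. independent B \<and> card B = DIM('a) \<and> z \<in> pos_span B \<and>
          (\<exists>f. linear f \<and> (\<forall>b\<in>B. f b = \<omega> b) \<and> (\<forall>e\<in>E. f e \<le> \<omega> e))"
        by (rule dual_feasible_basis) (use E \<omega>(1) that in auto)
      then show ?thesis unfolding \<T>_def by blast
    qed
  next
    fix z B B'
    assume B: "B \<in> \<T>" "B' \<in> \<T>" and z: "z \<in> pos_span B" "z \<in> pos_span B'"
      and nondeg: "\<And>S. S \<subseteq> E \<Longrightarrow> card S < DIM('a) \<Longrightarrow> z \<notin> span S"
    obtain f g where f: "linear f" "\<And>b. b \<in> B \<Longrightarrow> f b = \<omega> b" "\<And>e. e \<in> E \<Longrightarrow> f e \<le> \<omega> e"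
      and g: "linear g" "\<And>b. b \<in> B' \<Longrightarrow> g b = \<omega> b" "\<And>e. e \<in> E \<Longrightarrow> g e \<le> \<omega> e"
      using B by (auto simp: \<T>_def)
    have sub: "B \<subseteq> E" "B' \<subseteq> E" "card B = DIM('a)" "card B' = DIM('a)" "independent B'" using B by (auto simp: \<T>_def)
    have fin: "finite B" "finite B'" using sub E finite_subset by blast+
    obtain c where c: "\<And>e. e \<in> B \<Longrightarrow> 0 \<le> c e" "z = (\<Sum>e\<in>B. c e *\<^sub>R e)" using z(1) by (rule pos_spanE) blast
    obtain d where d: "\<And>e. e \<in> B' \<Longrightarrow> 0 \<le> d e" "z = (\<Sum>e\<in>B'. d e *\<^sub>R e)" using z(2) by (rule pos_spanE) blast
    \<comment> \<open>A nondegenerate \<open>z\<close> has only positive coefficients, since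
      otherwise fewer than \<open>DIM('a)\<close> vectors would span it.\<close>
    have cpos: "0 < c b" if b: "b \<in> B" for b
    proof (rule ccontr)
      assume "\<not> 0 < c b"
      then have "c b = 0" using c(1)[OF b] by simp
      then have "z = (\<Sum>e\<in>B-{b}. c e *\<^sub>R e)" unfolding c(2) using fin b by (simp add: sum.remove)
      then have "z \<in> span (B - {b})" by (auto intro!: span_sum span_scale intro: span_base)
      moreover have "card (B - {b}) < DIM('a)" using b fin sub by (metis card_Diff1_less)
      ultimately show False using nondeg[of "B - {b}"] sub by blast
    qed
    have fz: "f z = (\<Sum>e\<in>B. c e * \<omega> e)" unfolding c(2) using f by (simp add: linear_sum linear_cmul)
    have gz: "g z = (\<Sum>e\<in>B. c e * g e)" unfolding c(2) using g by (simp add: linear_sum linear_cmul)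
    have gz': "g z = (\<Sum>e\<in>B'. d e * \<omega> e)" unfolding d(2) using g by (simp add: linear_sum linear_cmul)
    have fz': "f z = (\<Sum>e\<in>B'. d e * f e)" unfolding d(2) using f by (simp add: linear_sum linear_cmul)
    \<comment> \<open>Weak duality over \<open>B'\<close>, where \<open>g\<close> attains the
      heights and \<open>f\<close> stays below them. A vector of \<open>B\<close> outside
      \<open>B'\<close> would give the strict opposite inequality over \<open>B\<close>: by
      genericity \<open>g\<close> is strictly below the height there, and its coefficient is
      positive.\<close>
    have "f z \<le> g z" unfolding gz' fz' using d(1) f(3) sub by (intro sum_mono mult_left_mono) auto
    have "b \<in> B'" if b: "b \<in> B" for b
    proof (rule ccontr)
      assume nb: "b \<notin> B'"
      have "g b \<noteq> \<omega> b" using \<omega>(2)[of B' g b] sub g nb b by auto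
      then have "g b < \<omega> b" using g(3)[of b] sub b by auto
      then have "g z < f z" unfolding fz gz using fin b cpos g(3) sub
        by (intro sum_strict_mono_ex1) (auto intro!: mult_left_mono mult_strict_left_mono simp: less_imp_le subset_eq)
      then show False using \<open>f z \<le> g z\<close> by simp
    qed
    then show "B = B'" using fin sub by (metis card_subset_eq subsetI)
  qed
qed

subsection \<open>Mixed subdivisions of Minkowski sums of polytopes\<close>

text \<open>In the Cayley encoding, a point \<open>v\<close> of the body with index \<open>l\<close>
  is stored as \<open>(axis l 1, v)\<close>, and \<open>idx\<close> recovers \<open>l\<close>. The
  first component of a combination then records how much weight each body receives.\<close>

lemma slice_sum:
  fixes B :: "((real^'l) \<times> 'b::euclidean_space) set"
  assumes "finite B" "\<And>b. b \<in> B \<Longrightarrow> fst b = axis (idx b) 1"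
  shows "(\<Sum>b\<in>B. c b *\<^sub>R b) = ((\<chi> l. \<Sum>b | b \<in> B \<and> idx b = l. c b), (\<Sum>b\<in>B. c b *\<^sub>R snd b))"
proof (rule prod_eqI)
  show "snd (\<Sum>b\<in>B. c b *\<^sub>R b) = snd ((\<chi> l. \<Sum>b | b \<in> B \<and> idx b = l. c b), (\<Sum>b\<in>B. c b *\<^sub>R snd b))"
    by (simp add: snd_sum)
  have "fst (\<Sum>b\<in>B. c b *\<^sub>R b) = (\<Sum>b\<in>B. c b *\<^sub>R axis (idx b) 1)"
    using assms by (simp add: fst_sum)
  also have "\<dots> = (\<chi> l. \<Sum>b | b \<in> B \<and> idx b = l. c b)"
    using assms(1) by (simp add: vec_eq_iff axis_def if_distrib[of "(*) _"] sum.If_cases cong: if_cong)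
       (auto intro!: sum.cong)
  finally show "fst (\<Sum>b\<in>B. c b *\<^sub>R b) = fst ((\<chi> l. \<Sum>b | b \<in> B \<and> idx b = l. c b), (\<Sum>b\<in>B. c b *\<^sub>R snd b))"
    by simp
qed

text \<open>The slice is empty or a translate of the subspace \<open>Y\<close>. If \<open>Y\<close>
  were everything, then subtracting second components would put every \<open>axis l 1\<close> into
  the span, because positivity of \<open>s\<close> forces each index to occur in \<open>S\<close>.
  The span would be the whole space, against the bound on the cardinality.\<close>

lemma negligible_slice_span:
  fixes S :: "((real^'l) \<times> 'b::euclidean_space) set"
  assumes S: "finite S" "\<And>b. b \<in> S \<Longrightarrow> fst b = axis (idx b) 1"
    and card: "card S < DIM((real^'l) \<times> 'b)" and s: "\<And>l. 0 < s $ l"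
  shows "negligible {x. (s, x) \<in> span S}"
proof (cases "\<exists>x0. (s, x0) \<in> span S")
  case False
  then show ?thesis by simp
next
  case True
  then obtain x0 where x0: "(s, x0) \<in> span S" by blast
  define Y where "Y = {y. (0, y) \<in> span S}"
  have Y: "subspace Y"
    unfolding Y_def subspace_def
    using span_add[of "(0, _)" S "(0, _)"] span_scale[of "(0, _)" S] by (auto simp: zero_prod_def[symmetric] span_zero)
  have "{x. (s, x) \<in> span S} = (+) x0 ` Y"
  proof -
    have "(s, x) \<in> span S \<longleftrightarrow> (0, x - x0) \<in> span S" for x
      using span_add[OF x0, of "(0, x - x0)"] span_diff[OF _ x0, of "(s, x)"] by auto
    then show ?thesis unfolding Y_def by (force simp: image_iff algebra_simps)
  qed
  moreover have "dim Y < DIM('b)"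
  proof (rule ccontr)
    assume "\<not> dim Y < DIM('b)"
    then have "dim Y = DIM('b)" using dim_subset_UNIV[of Y] by simp
    then have YU: "Y = UNIV" using Y by (metis dim_eq_full span_eq_iff)
    have ax: "(axis l 1, 0) \<in> span S" for l
    proof -
      have "\<exists>b\<in>S. idx b = l"
      proof (rule ccontr)
        assume no: "\<not> ?thesis"
        obtain c where "(s, x0) = (\<Sum>b\<in>S. c b *\<^sub>R b)" using x0 span_finite[OF S(1)] by auto
        then have "s $ l = (\<Sum>b | b \<in> S \<and> idx b = l. c b)"
          using slice_sum[OF S, of c] by (auto simp: vec_eq_iff)
        also have "{b. b \<in> S \<and> idx b = l} = {}" using no by auto
        finally show False using s[of l] by simp
      qed
      then obtain b where b: "b \<in> S" "idx b = l" by blast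
      have "(0, snd b) \<in> span S" using YU by (auto simp: Y_def)
      then have "b - (0, snd b) \<in> span S" using b span_base by (intro span_diff) auto
      moreover have "b - (0, snd b) = (axis l 1, 0)" using b S(2)[of b] by (simp add: prod_eq_iff)
      ultimately show ?thesis by simp
    qed
    have "(\<sigma>, y) \<in> span S" for \<sigma> y
    proof -
      have "(\<sigma>, 0) = (\<Sum>l\<in>UNIV. (\<sigma> $ l) *\<^sub>R (axis l 1, 0 :: 'b))"
        using basis_expansion[of \<sigma>, symmetric] by (simp add: prod_eq_iff fst_sum snd_sum scalar_mult_eq_scaleR)
      then have "(\<sigma>, 0) \<in> span S" using ax by (metis (no_types, lifting) span_scale span_sum)
      moreover have "(0, y) \<in> span S" using YU by (auto simp: Y_def)
      ultimately show ?thesis using span_add[of "(\<sigma>, 0)" S "(0, y)"] by simp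
    qed
    then have "span S = UNIV" by auto
    then have "DIM((real^'l) \<times> 'b) \<le> card S"
      using dim_le_card'[OF S(1)] dim_span[of S] dim_UNIV[where 'a="(real^'l) \<times> 'b"] by metis
    then show False using card by simp
  qed
  ultimately show ?thesis by (simp add: negligible_lowdim negligible_translation)
qed

lemma bounded_slice:
  fixes B :: "((real^'l) \<times> 'b::euclidean_space) set"
  assumes B: "finite B" "\<And>b. b \<in> B \<Longrightarrow> fst b = axis (idx b) 1"
  shows "bounded {x. (s, x) \<in> pos_span B}"
proof (rule boundedI)
  fix x assume "x \<in> {x. (s, x) \<in> pos_span B}"
  then obtain c where c: "\<And>e. e \<in> B \<Longrightarrow> 0 \<le> c e" "(s, x) = (\<Sum>e\<in>B. c e *\<^sub>R e)" by (auto elim!: pos_spanE)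
  have sx: "s = (\<chi> l. \<Sum>b | b \<in> B \<and> idx b = l. c b)" "x = (\<Sum>b\<in>B. c b *\<^sub>R snd b)"
    using c(2) slice_sum[OF B, of c] by auto
  have "c b \<le> s $ idx b" if "b \<in> B" for b
    using c(1) that B(1) unfolding sx by (auto intro!: member_le_sum)
  then have "norm x \<le> (\<Sum>b\<in>B. s $ idx b * norm (snd b))"
    unfolding sx(2) using c(1) by (intro order_trans[OF norm_sum] sum_mono) (auto intro!: mult_right_mono)
  then show "norm x \<le> (\<Sum>b\<in>B. s $ idx b * norm (snd b))" .
qed

lemma convex_slice:
  assumes "convex C"
  shows "convex {x. (s, x) \<in> C}"
proof (rule convexI)
  fix x y u v assume "x \<in> {x. (s, x) \<in> C}" "y \<in> {x. (s, x) \<in> C}" and uv: "0 \<le> u" "0 \<le> v" "u + v = (1::real)"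
  then have "u *\<^sub>R (s, x) + v *\<^sub>R (s, y) \<in> C" by (intro convexD[OF assms]) auto
  moreover have "u *\<^sub>R s + v *\<^sub>R s = s" using uv by (metis scaleR_add_left scaleR_one)
  ultimately show "u *\<^sub>R x + v *\<^sub>R y \<in> {x. (s, x) \<in> C}" by simp
qed

lemma lmeasurable_slice:
  fixes B :: "((real^'l) \<times> 'b::euclidean_space) set"
  assumes "finite B" "\<And>b. b \<in> B \<Longrightarrow> fst b = axis (idx b) 1"
  shows "{x. (s, x) \<in> pos_span B} \<in> lmeasurable"
proof (rule measurable_convex[OF convex_slice[OF convex_pos_span]])
  show "bounded {x. (s, x) \<in> pos_span B}" by (rule bounded_slice[of B idx]) (use assms in auto)
qed

text \<open>
  The slices of a simplicial cone are affine images of each other, by a linear map that is diagonal in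
  the basis formed by the edge vectors of the simplices whose Minkowski sum is the slice.
\<close>

lemma measure_slice_simplicial:
  fixes B :: "((real^'l) \<times> 'b::euclidean_space) set"
  assumes B: "\<And>b. b \<in> B \<Longrightarrow> fst b = axis (idx b) 1"
    and ind: "independent B" and card: "card B = DIM((real^'l) \<times> 'b)"
  obtains k :: "'l \<Rightarrow> nat" where "(\<Sum>l\<in>UNIV. k l) = DIM('b)"
    "\<And>s. (\<And>l. 0 < s $ l) \<Longrightarrow> measure lebesgue {x. (s, x) \<in> pos_span B} =
       measure lebesgue {x. (vec 1, x) \<in> pos_span B} * (\<Prod>l\<in>UNIV. (s $ l) ^ k l)"
proof -
  have fB: "finite B" using ind by (rule independent_imp_finite)
  have span: "span B = UNIV" using ind card by (rule independent_full_span)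
  have "\<exists>b\<in>B. idx b = l" for l
  proof (rule ccontr)
    assume no: "\<not> ?thesis"
    obtain c where "(axis l 1, 0) = (\<Sum>b\<in>B. c b *\<^sub>R b)" using span span_finite[OF fB] by blast
    then have "axis l 1 = (\<chi> l. \<Sum>b | b \<in> B \<and> idx b = l. c b)" using slice_sum[OF fB B, of c] by auto
    then have "axis l 1 $ l = (\<Sum>b | b \<in> B \<and> idx b = l. c b)" by simp
    also have "{b. b \<in> B \<and> idx b = l} = {}" using no by auto
    finally show False by simp
  qed
  then obtain r where r: "\<And>l. r l \<in> B" "\<And>l. idx (r l) = l" by metis
  have injr: "inj r" using r by (metis injI)
  \<comment> \<open>One base vertex \<open>r l\<close> is chosen for each body. The remaining
    generators yield the edge vectors \<open>u b\<close>, taken from the base vertex of the same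
    body, and \<open>P\<close> maps the standard basis to these.\<close>
  define U where "U = B - range r"
  have "card U = DIM('b)"
    unfolding U_def using r injr fB card by (subst card_Diff_subset) (auto simp: card_image)
  then obtain \<beta> :: "'b \<Rightarrow> _" where \<beta>: "bij_betw \<beta> Basis U"
    using finite_same_card_bij[of "Basis::'b set" U] fB by (auto simp: U_def)
  define u where "u b = snd b - snd (r (idx b))" for b
  define P where "P x = (\<Sum>i\<in>Basis. (x \<bullet> i) *\<^sub>R u (\<beta> i))" for x :: 'b
  have linP: "linear P" unfolding P_def
    by (auto intro!: linearI simp: inner_left_distrib scaleR_add_left sum.distrib scaleR_sum_right)
  have "surj P"
  proof (unfold surj_def, intro allI)
    fix y :: 'b
    obtain c where c: "(0, y) = (\<Sum>b\<in>B. c b *\<^sub>R b)" using span span_finite[OF fB] by blast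
    have c0: "(\<Sum>b | b \<in> B \<and> idx b = l. c b) = 0" for l
      using c slice_sum[OF fB B, of c] by (auto simp: vec_eq_iff)
    have "(\<Sum>b\<in>B. c b *\<^sub>R snd (r (idx b))) = (\<Sum>l\<in>UNIV. \<Sum>b | b \<in> B \<and> idx b = l. c b *\<^sub>R snd (r (idx b)))"
      by (rule sum.group[symmetric]) (use fB in auto)
    also have "\<dots> = (\<Sum>l\<in>UNIV. (\<Sum>b | b \<in> B \<and> idx b = l. c b) *\<^sub>R snd (r l))"
      by (simp add: scaleR_sum_left)
    finally have "(\<Sum>b\<in>B. c b *\<^sub>R snd (r (idx b))) = 0" by (simp add: c0)
    then have "(\<Sum>b\<in>B. c b *\<^sub>R u b) = (\<Sum>b\<in>B. c b *\<^sub>R snd b)"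
      by (simp add: u_def scaleR_diff_right sum_subtractf)
    also have "\<dots> = y" using c slice_sum[OF fB B, of c] by auto
    finally have "y = (\<Sum>b\<in>U. c b *\<^sub>R u b)"
      using r fB by (subst sum.mono_neutral_left[of B]) (auto simp: U_def u_def)
    also have "\<dots> = P (\<Sum>i\<in>Basis. c (\<beta> i) *\<^sub>R i)"
      unfolding P_def by (simp add: sum.reindex_bij_betw[OF \<beta>, of "\<lambda>b. c b *\<^sub>R u b"])
    finally show "\<exists>x. y = P x" by blast
  qed
  then have injP: "inj P" using linP by (metis linear_surj_imp_inj)
  \<comment> \<open>The number of edge vectors of body \<open>l\<close> is the dimension of the
    corresponding summand of the mixed cell, hence the degree of the volume in
    \<open>s $ l\<close>.\<close>
  define k where "k l = card {i \<in> Basis. idx (\<beta> i) = l}" for l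
  show thesis
  proof (rule that[of k])
    show "(\<Sum>l\<in>UNIV. k l) = DIM('b)"
      unfolding k_def using sum.group[of "Basis::'b set" "UNIV::'l set" "\<lambda>i. idx (\<beta> i)" "\<lambda>_. 1::nat"] by simp
  next
    fix s :: "real^'l" assume s: "\<And>l. 0 < s $ l"
    \<comment> \<open>\<open>\<Phi>\<close> stretches each generator by the weight of its body. It
      maps the cone onto itself and the slice over (1,...,1) onto the slice over
      \<open>s\<close>.\<close>
    obtain \<Phi> :: "(real^'l) \<times> 'b \<Rightarrow> (real^'l) \<times> 'b"
      where \<Phi>: "linear \<Phi>" "\<And>b. b \<in> B \<Longrightarrow> \<Phi> b = (s $ idx b) *\<^sub>R b"
      using linear_independent_extend[OF ind, of "\<lambda>b. (s $ idx b) *\<^sub>R b"] by blast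
    have \<Phi>sum: "\<Phi> (\<Sum>b\<in>B. c b *\<^sub>R b) = (\<Sum>b\<in>B. (c b * s $ idx b) *\<^sub>R b)" for c
      using \<Phi> by (simp add: linear_sum linear_cmul)
    have fst\<Phi>: "fst (\<Phi> z) = (\<chi> l. s $ l * fst z $ l)" for z
    proof -
      obtain c where c: "z = (\<Sum>b\<in>B. c b *\<^sub>R b)" using span span_finite[OF fB] by blast
      have z: "fst z = (\<chi> l. \<Sum>b | b \<in> B \<and> idx b = l. c b)"
        "fst (\<Phi> z) = (\<chi> l. \<Sum>b | b \<in> B \<and> idx b = l. c b * s $ idx b)"
        unfolding c \<Phi>sum by (simp_all add: slice_sum[OF fB, of idx] B)
      show ?thesis unfolding z by (simp add: vec_eq_iff sum_distrib_left mult.commute)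
    qed
    define A where "A x = snd (\<Phi> (0, x))" for x
    define w where "w = snd (\<Phi> (vec 1, 0))"
    have linA: "linear A"
    proof (rule linearI)
      show "A (x + y) = A x + A y" for x y
        using linear_add[OF \<Phi>(1), of "(0, x)" "(0, y)"] by (simp add: A_def)
      show "A (a *\<^sub>R x) = a *\<^sub>R A x" for a x
        using linear_cmul[OF \<Phi>(1), of a "(0, x)"] by (simp add: A_def)
    qed
    have \<Phi>1: "\<Phi> (vec 1, x) = (s, w + A x)" for x
    proof (rule prod_eqI)
      have "(vec 1 :: real^'l, x) = (vec 1, 0) + (0, x)" by simp
      then have "\<Phi> (vec 1, x) = \<Phi> (vec 1, 0) + \<Phi> (0, x)" using \<Phi>(1) by (metis linear_add)
      then show "snd (\<Phi> (vec 1, x)) = snd (s, w + A x)" by (simp add: w_def A_def)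
    qed (simp add: fst\<Phi> vec_eq_iff)
    have slice: "{x. (s, x) \<in> pos_span B} = (+) w ` (A ` {x. (vec 1, x) \<in> pos_span B})"
    proof (intro equalityI subsetI)
      fix x assume "x \<in> {x. (s, x) \<in> pos_span B}"
      then obtain c where c: "\<And>e. e \<in> B \<Longrightarrow> 0 \<le> c e" "(s, x) = (\<Sum>e\<in>B. c e *\<^sub>R e)" by (auto elim!: pos_spanE)
      define z where "z = (\<Sum>b\<in>B. (c b / s $ idx b) *\<^sub>R b)"
      have z: "\<Phi> z = (s, x)" unfolding z_def \<Phi>sum c(2) using s by (simp add: less_imp_neq[symmetric])
      then have "fst z = vec 1" using fst\<Phi>[of z] s by (auto simp: vec_eq_iff less_imp_neq[symmetric])
      then have "z = (vec 1, snd z)" by (simp add: prod_eq_iff)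
      moreover have "z \<in> pos_span B" unfolding z_def
        by (intro pos_spanI[where c="\<lambda>b. c b / s $ idx b"] divide_nonneg_pos c(1) s refl)
      ultimately show "x \<in> (+) w ` (A ` {x. (vec 1, x) \<in> pos_span B})"
        using z \<Phi>1[of "snd z"] by (intro image_eqI[where x="A (snd z)"] imageI) auto
    next
      fix x assume "x \<in> (+) w ` (A ` {x. (vec 1, x) \<in> pos_span B})"
      then obtain y where y: "(vec 1, y) \<in> pos_span B" "x = w + A y" by auto
      obtain c where c: "\<And>e. e \<in> B \<Longrightarrow> 0 \<le> c e" "(vec 1, y) = (\<Sum>e\<in>B. c e *\<^sub>R e)" using y(1) by (auto elim!: pos_spanE)
      have "(s, x) = (\<Sum>b\<in>B. (c b * s $ idx b) *\<^sub>R b)" using \<Phi>1[of y] y(2) c(2) \<Phi>sum by simp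
      then have "(s, x) \<in> pos_span B" 
        by (intro pos_spanI[where c="\<lambda>b. c b * s $ idx b"] mult_nonneg_nonneg c(1) less_imp_le[OF s]) auto
      then show "x \<in> {x. (s, x) \<in> pos_span B}" by simp
    qed
    \<comment> \<open>Each edge vector is multiplied by the weight of its body, so \<open>A\<close>
      becomes the diagonal map \<open>D\<close> in the coordinates given by
      \<open>P\<close>.\<close>
    define D where "D x = (\<Sum>i\<in>Basis. (s $ idx (\<beta> i) * (x \<bullet> i)) *\<^sub>R i)" for x :: 'b
    have AP: "A (P x) = P (D x)" for x
    proof -
      have Au: "A (u b) = (s $ idx b) *\<^sub>R u b" if "b \<in> B" for b
      proof -
        have "(0, u b) = b - r (idx b)" using B[OF that] B[OF r(1)[of "idx b"]] r(2)
          by (simp add: prod_eq_iff u_def)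
        then have "\<Phi> (0, u b) = (s $ idx b) *\<^sub>R (b - r (idx b))"
          using \<Phi>(1) \<Phi>(2)[OF that] \<Phi>(2)[OF r(1)[of "idx b"]] r(2) by (simp add: linear_diff scaleR_diff_right)
        then show ?thesis by (simp add: A_def u_def)
      qed
      moreover have "\<beta> i \<in> B" if "i \<in> Basis" for i using \<beta> that by (auto simp: U_def bij_betw_def)
      ultimately show ?thesis unfolding P_def D_def using linA by (simp add: linear_sum linear_cmul mult.commute)
    qed
    let ?T = "{x. (vec 1, x) \<in> pos_span B}"
    obtain Q where Q: "linear Q" "\<And>x. Q (P x) = x" "\<And>x. P (Q x) = x"
      using linear_injective_isomorphism[OF linP injP] by metis
    have injQ: "inj Q" using Q by (metis injI)
    have T: "?T \<in> lmeasurable" using lmeasurable_slice[OF fB, of idx] B by blast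
    have QT: "Q ` ?T \<in> lmeasurable"
      by (rule lmeasurable_linear_inj_image[OF Q(1) injQ T])
    have DQT: "D ` Q ` ?T \<in> lmeasurable"
      unfolding D_def by (rule lmeasurable_stretch_Basis[OF s QT])
    have "A ` ?T = P ` D ` Q ` ?T" by (simp add: image_image flip: AP) (simp add: Q)
    then have "measure lebesgue (A ` ?T) = measure lebesgue (P ` cbox 0 One) * measure lebesgue (D ` Q ` ?T)"
      using measure_linear_image_scale[OF linP injP DQT] by simp
    also have "measure lebesgue (D ` Q ` ?T) = (\<Prod>i\<in>Basis. s $ idx (\<beta> i)) * measure lebesgue (Q ` ?T)"
      unfolding D_def by (rule measure_stretch_Basis[OF s QT])
    also have "measure lebesgue (P ` cbox 0 One) * ((\<Prod>i\<in>Basis. s $ idx (\<beta> i)) * measure lebesgue (Q ` ?T)) =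
        (\<Prod>i\<in>Basis. s $ idx (\<beta> i)) * measure lebesgue (P ` Q ` ?T)"
      using measure_linear_image_scale[OF linP injP QT] by simp
    also have "P ` Q ` ?T = ?T" by (simp add: image_image Q)
    also have "(\<Prod>i\<in>Basis. s $ idx (\<beta> i)) = (\<Prod>l\<in>UNIV. \<Prod>i | i \<in> Basis \<and> idx (\<beta> i) = l. s $ idx (\<beta> i))"
      by (rule prod.group[symmetric]) auto
    also have "\<dots> = (\<Prod>l\<in>UNIV. s $ l ^ k l)" by (simp add: k_def)
    finally show "measure lebesgue {x. (s, x) \<in> pos_span B} = measure lebesgue ?T * (\<Prod>l\<in>UNIV. (s $ l) ^ k l)"
      unfolding slice measure_translation by simp
  qed
qed

text \<open>The Cayley trick: lying over \<open>s\<close> means that the coefficients on the copy of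
  \<open>V l\<close> add up to \<open>s l\<close>, so this part of the combination is
  \<open>s l\<close> times a convex combination. The unit vectors keep coinciding vertices of
  different bodies apart.\<close>

lemma cayley_slice:
  fixes V :: "'l::finite \<Rightarrow> 'b::euclidean_space set"
  assumes V: "\<And>l. finite (V l)" and s: "\<And>l. 0 < s l"
  shows "(minkowski s (\<lambda>l. convex hull V l)) =
    {x. ((\<chi> l. s l), x) \<in> pos_span (\<Union>l. (\<lambda>v. (axis l 1, v)) ` V l)}" (is "?L = ?R")
proof -
  define E where "E = (\<Union>l. (\<lambda>v. (axis l (1::real), v)) ` V l)"
  have sumE: "(\<Sum>e\<in>E. c e *\<^sub>R e) = ((\<chi> l. \<Sum>v\<in>V l. c (axis l 1, v)), (\<Sum>l\<in>UNIV. \<Sum>v\<in>V l. c (axis l 1, v) *\<^sub>R v))" for c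
  proof -
    have "(\<Sum>e\<in>E. c e *\<^sub>R e) = (\<Sum>l\<in>UNIV. \<Sum>e\<in>(\<lambda>v. (axis l 1, v)) ` V l. c e *\<^sub>R e)"
      unfolding E_def using V by (intro sum.UNION_disjoint) (auto simp: axis_eq_axis)
    also have "\<dots> = (\<Sum>l\<in>UNIV. \<Sum>v\<in>V l. c (axis l 1, v) *\<^sub>R (axis l 1, v))"
      by (intro sum.cong refl) (auto simp: sum.reindex inj_on_def)
    also have "\<dots> = ((\<chi> l. \<Sum>v\<in>V l. c (axis l 1, v)), (\<Sum>l\<in>UNIV. \<Sum>v\<in>V l. c (axis l 1, v) *\<^sub>R v))"
    proof (rule prod_eqI)
      have "(\<Sum>l\<in>UNIV. \<Sum>v\<in>V l. c (axis l 1, v) *\<^sub>R axis l 1) $ k = (\<Sum>v\<in>V k. c (axis k 1, v))" for k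
        by (simp add: axis_def if_distrib[of "(*) _"] cong: if_cong)
           (subst sum.remove[of _ k], auto intro!: sum.neutral)
      then show "fst (\<Sum>l\<in>UNIV. \<Sum>v\<in>V l. c (axis l 1, v) *\<^sub>R (axis l 1, v)) =
        fst ((\<chi> l. \<Sum>v\<in>V l. c (axis l 1, v)), (\<Sum>l\<in>UNIV. \<Sum>v\<in>V l. c (axis l 1, v) *\<^sub>R v))"
        by (simp add: fst_sum vec_eq_iff)
    qed (simp add: snd_sum)
    finally show ?thesis .
  qed
  have "?L \<subseteq> ?R"
  proof
    fix x assume "x \<in> ?L"
    then obtain y where y: "\<And>l. y l \<in> (*\<^sub>R) (s l) ` (convex hull (V l))" "x = (\<Sum>l\<in>UNIV. y l)"
      by (auto simp: set_sum_alt)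
    have "\<exists>u. (\<forall>v\<in>V l. 0 \<le> u v) \<and> sum u (V l) = 1 \<and> y l = s l *\<^sub>R (\<Sum>v\<in>V l. u v *\<^sub>R v)" for l
      using y(1)[of l] by (auto simp: convex_hull_finite[OF V])
    then obtain u where u: "\<And>l v. v \<in> V l \<Longrightarrow> 0 \<le> u l v" "\<And>l. sum (u l) (V l) = 1"
        "\<And>l. y l = s l *\<^sub>R (\<Sum>v\<in>V l. u l v *\<^sub>R v)" by metis
    define idx where "idx e = (THE l. fst e = axis l (1::real))" for e :: "(real^'l) \<times> 'b"
    have idx: "idx (axis l 1, v) = l" for l v by (auto simp: idx_def axis_eq_axis)
    define c where "c e = s (idx e) * u (idx e) (snd e)" for e
    have "((\<chi> l. s l), x) = (\<Sum>e\<in>E. c e *\<^sub>R e)"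
      unfolding sumE y(2) u(3) by (simp add: c_def idx u(2) scaleR_sum_right flip: sum_distrib_left)
    moreover have "0 \<le> c e" if "e \<in> E" for e
      using that less_imp_le[OF s] u(1) by (auto simp: c_def E_def idx)
    ultimately show "x \<in> ?R" unfolding E_def[symmetric] by (auto intro!: pos_spanI[where c=c])
  qed
  moreover have "?R \<subseteq> ?L"
  proof
    fix x assume "x \<in> ?R"
    then obtain c where c: "\<And>e. e \<in> E \<Longrightarrow> 0 \<le> c e" "((\<chi> l. s l), x) = (\<Sum>e\<in>E. c e *\<^sub>R e)"
      by (auto simp: E_def elim!: pos_spanE)
    have sx: "\<And>l. s l = (\<Sum>v\<in>V l. c (axis l 1, v))" "x = (\<Sum>l\<in>UNIV. \<Sum>v\<in>V l. c (axis l 1, v) *\<^sub>R v)"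
      using c(2) by (auto simp: sumE vec_eq_iff)
    have "(\<Sum>v\<in>V l. c (axis l 1, v) *\<^sub>R v) \<in> (*\<^sub>R) (s l) ` (convex hull (V l))" for l
    proof -
      have "(\<Sum>v\<in>V l. (c (axis l 1, v) / s l) *\<^sub>R v) \<in> convex hull (V l)"
      proof (rule convex_sum[OF V convex_convex_hull])
        show "(\<Sum>v\<in>V l. c (axis l 1, v) / s l) = 1"
          using s[of l] sx(1)[of l] by (simp flip: sum_divide_distrib)
        show "0 \<le> c (axis l 1, v) / s l" if "v \<in> V l" for v
          using that s[of l] c(1)[of "(axis l 1, v)"] unfolding E_def by (intro divide_nonneg_pos) auto
      qed (simp add: hull_inc)
      moreover have "(\<Sum>v\<in>V l. c (axis l 1, v) *\<^sub>R v) = s l *\<^sub>R (\<Sum>v\<in>V l. (c (axis l 1, v) / s l) *\<^sub>R v)"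
        using s[of l] by (simp add: scaleR_sum_right)
      ultimately show ?thesis by blast
    qed
    then show "x \<in> ?L" unfolding sx(2) by (auto simp: set_sum_alt)
  qed
  ultimately show ?thesis by blast
qed

text \<open>Slicing the triangulated Cayley cone cuts the Minkowski sum into mixed cells. The volume
  of each cell is one monomial with nonnegative coefficient, and the cells are grouped by their
  exponents. The triangulation is fixed before \<open>s\<close>, so the same cells serve all
  positive \<open>s\<close>.\<close>

proposition polytope_combination_volume:
  fixes V :: "'l::finite \<Rightarrow> 'b::euclidean_space set"
  assumes V: "\<And>l. finite (V l)"
  obtains a :: "('l \<Rightarrow> nat) \<Rightarrow> real" where "\<And>k. 0 \<le> a k"
    "\<And>s. (\<And>l. 0 < s l) \<Longrightarrow> measure lebesgue (minkowski s (\<lambda>l. convex hull V l)) =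
      (\<Sum>k | (\<Sum>l\<in>UNIV. k l) = DIM('b). a k * (\<Prod>l\<in>UNIV. s l ^ k l))"
proof -
  define E where "E = (\<Union>l. (\<lambda>v. (axis l (1::real), v)) ` V l)"
  have E: "finite E" using V by (auto simp: E_def)
  define idx where "idx e = (THE l. fst e = axis l (1::real))" for e :: "(real^'l) \<times> 'b"
  have idx: "fst e = axis (idx e) 1" if "e \<in> E" for e using that by (auto simp: idx_def axis_eq_axis E_def)
  obtain \<T> where \<T>: "finite \<T>" "\<And>B. B \<in> \<T> \<Longrightarrow> B \<subseteq> E \<and> independent B \<and> card B = DIM((real^'l) \<times> 'b)"
    "\<And>z. \<lbrakk>z \<in> pos_span E; \<And>S. S \<subseteq> E \<Longrightarrow> card S < DIM((real^'l) \<times> 'b) \<Longrightarrow> z \<notin> span S\<rbrakk> \<Longrightarrow> \<exists>B\<in>\<T>. z \<in> pos_span B"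
    "\<And>z B B'. \<lbrakk>B \<in> \<T>; B' \<in> \<T>; z \<in> pos_span B; z \<in> pos_span B';
       \<And>S. S \<subseteq> E \<Longrightarrow> card S < DIM((real^'l) \<times> 'b) \<Longrightarrow> z \<notin> span S\<rbrakk> \<Longrightarrow> B = B'"
    by (rule simplicial_cone_decomposition[OF E]) blast
  define T where "T s B = {x. (s, x) \<in> pos_span B}" for s and B :: "((real^'l) \<times> 'b) set"
  have "\<exists>k. (\<Sum>l\<in>UNIV. k l) = DIM('b) \<and> (\<forall>s. (\<forall>l. 0 < s $ l) \<longrightarrow>
    measure lebesgue (T s B) = measure lebesgue (T (vec 1) B) * (\<Prod>l\<in>UNIV. (s $ l) ^ k l))" if "B \<in> \<T>" for B
  proof -
    have "\<And>b. b \<in> B \<Longrightarrow> fst b = axis (idx b) 1" "independent B" "card B = DIM((real^'l) \<times> 'b)"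
      using \<T>(2)[OF that] idx by auto
    then show ?thesis
    proof (rule measure_slice_simplicial)
      fix k :: "'l \<Rightarrow> nat"
      assume k: "(\<Sum>l\<in>UNIV. k l) = DIM('b)"
        "\<And>s. (\<And>l. 0 < s $ l) \<Longrightarrow> measure lebesgue {x. (s, x) \<in> pos_span B} =
          measure lebesgue {x. (vec 1, x) \<in> pos_span B} * (\<Prod>l\<in>UNIV. (s $ l) ^ k l)"
      show ?thesis unfolding T_def by (intro exI[of _ k] conjI allI impI k) blast
    qed
  qed
  then have "\<exists>k. \<forall>B\<in>\<T>. (\<Sum>l\<in>UNIV. k B l) = DIM('b) \<and> (\<forall>s. (\<forall>l. 0 < s $ l) \<longrightarrow>
    measure lebesgue (T s B) = measure lebesgue (T (vec 1) B) * (\<Prod>l\<in>UNIV. (s $ l) ^ k B l))"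
    by (intro bchoice ballI)
  then obtain k where "\<forall>B\<in>\<T>. (\<Sum>l\<in>UNIV. k B l) = DIM('b) \<and> (\<forall>s. (\<forall>l. 0 < s $ l) \<longrightarrow>
    measure lebesgue (T s B) = measure lebesgue (T (vec 1) B) * (\<Prod>l\<in>UNIV. (s $ l) ^ k B l))"
    by (rule exE)
  then have k: "\<And>B. B \<in> \<T> \<Longrightarrow> (\<Sum>l\<in>UNIV. k B l) = DIM('b)"
    "\<And>B s. \<lbrakk>B \<in> \<T>; \<And>l. 0 < s $ l\<rbrakk> \<Longrightarrow>
      measure lebesgue (T s B) = measure lebesgue (T (vec 1) B) * (\<Prod>l\<in>UNIV. (s $ l) ^ k B l)"
    by blast+
  show thesis
  proof (rule that[of "\<lambda>j. \<Sum>B | B \<in> \<T> \<and> k B = j. measure lebesgue (T (vec 1) B)"])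
    show "0 \<le> (\<Sum>B | B \<in> \<T> \<and> k B = j. measure lebesgue (T (vec 1) B))" for j by (simp add: sum_nonneg)
  next
    fix s :: "'l \<Rightarrow> real" assume s: "\<And>l. 0 < s l"
    define sv where "sv = (\<chi> l. s l)"
    \<comment> \<open>Only on this null set of degenerate points can the cells overlap or fail to
      cover the slice.\<close>
    define N where "N = (\<Union>S\<in>{S. S \<subseteq> E \<and> card S < DIM((real^'l) \<times> 'b)}. {x. (sv, x) \<in> span S})"
    have N: "negligible N" unfolding N_def
    proof (rule negligible_Union)
      show "finite ((\<lambda>S. {x. (sv, x) \<in> span S}) ` {S. S \<subseteq> E \<and> card S < DIM((real^'l) \<times> 'b)})"
        using E by simp
      fix t assume "t \<in> (\<lambda>S. {x. (sv, x) \<in> span S}) ` {S. S \<subseteq> E \<and> card S < DIM((real^'l) \<times> 'b)}"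
      then obtain S where S: "S \<subseteq> E" "card S < DIM((real^'l) \<times> 'b)" "t = {x. (sv, x) \<in> span S}" by blast
      show "negligible t" unfolding S(3)
        by (rule negligible_slice_span[where idx=idx]) (use S idx s E finite_subset in \<open>auto simp: sv_def\<close>)
    qed
    have nondeg: "(sv, x) \<notin> span S" if "x \<notin> N" "S \<subseteq> E" "card S < DIM((real^'l) \<times> 'b)" for x S
      using that by (auto simp: N_def)
    have "(minkowski s (\<lambda>l. convex hull V l)) = T sv E"
      unfolding T_def sv_def E_def using V s by (rule cayley_slice)
    moreover have TB: "T sv B \<in> lmeasurable" "T sv B \<subseteq> T sv E" if "B \<in> \<T>" for B
    proof -
      have "finite B" "\<And>b. b \<in> B \<Longrightarrow> fst b = axis (idx b) 1" using \<T>(2)[OF that] E idx finite_subset by auto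
      then show "T sv B \<in> lmeasurable" unfolding T_def by (rule lmeasurable_slice)
      show "T sv B \<subseteq> T sv E" unfolding T_def using pos_span_mono[OF E, of B] \<T>(2)[OF that] by auto
    qed
    have "T sv E - N = (\<Union>B\<in>\<T>. T sv B) - N"
    proof -
      have "\<exists>B\<in>\<T>. x \<in> T sv B" if "x \<in> T sv E" "x \<notin> N" for x
        using \<T>(3)[of "(sv, x)", OF _ nondeg[OF that(2)]] that(1) unfolding T_def by simp
      then show ?thesis using TB(2) by blast
    qed
    then have "negligible (sym_diff (T sv E) (\<Union>B\<in>\<T>. T sv B))"
      by (intro negligible_subset[OF N]) auto
    moreover have "T sv E \<in> lmeasurable"
      unfolding T_def using E idx by (rule lmeasurable_slice)
    ultimately have "measure lebesgue (T sv E) = measure lebesgue (\<Union>B\<in>\<T>. T sv B)"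
      by (intro measure_negligible_symdiff[symmetric])
    also have "\<dots> = (\<Sum>B\<in>\<T>. measure lebesgue (T sv B))"
    proof (rule measure_negligible_finite_Union_image[OF \<T>(1) TB(1)])
      show "pairwise (\<lambda>B B'. negligible (T sv B \<inter> T sv B')) \<T>"
      proof (rule pairwiseI)
        fix B B' assume B: "B \<in> \<T>" "B' \<in> \<T>" "B \<noteq> B'"
        have "T sv B \<inter> T sv B' \<subseteq> N"
        proof
          fix x assume x: "x \<in> T sv B \<inter> T sv B'"
          show "x \<in> N"
          proof (rule ccontr)
            assume "x \<notin> N"
            then have "B = B'"
              using \<T>(4)[OF B(1,2) _ _ nondeg] x unfolding T_def by blast
            then show False using B(3) by simp
          qed
        qed
        then show "negligible (T sv B \<inter> T sv B')" by (rule negligible_subset[OF N])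
      qed
    qed
    also have "\<dots> = (\<Sum>B\<in>\<T>. measure lebesgue (T (vec 1) B) * (\<Prod>l\<in>UNIV. s l ^ k B l))"
      using k(2)[of _ sv] s by (intro sum.cong) (auto simp: sv_def)
    also have "\<dots> = (\<Sum>j\<in>{k. (\<Sum>l\<in>UNIV. k l) = DIM('b)}. \<Sum>B | B \<in> \<T> \<and> k B = j.
        measure lebesgue (T (vec 1) B) * (\<Prod>l\<in>UNIV. s l ^ k B l))"
    proof (rule sum.group[symmetric, OF \<T>(1)])
      show "finite {k::'l \<Rightarrow> nat. (\<Sum>l\<in>UNIV. k l) = DIM('b)}" by (rule finite_exponents)
    qed (use k(1) in auto)
    also have "\<dots> = (\<Sum>j | (\<Sum>l\<in>UNIV. j l) = DIM('b).
        (\<Sum>B | B \<in> \<T> \<and> k B = j. measure lebesgue (T (vec 1) B)) * (\<Prod>l\<in>UNIV. s l ^ j l))"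
      by (auto simp: sum_distrib_right intro!: sum.cong)
    finally show "measure lebesgue (minkowski s (\<lambda>l. convex hull V l)) = (\<Sum>j | (\<Sum>l\<in>UNIV. j l) = DIM('b).
        (\<Sum>B | B \<in> \<T> \<and> k B = j. measure lebesgue (T (vec 1) B)) * (\<Prod>l\<in>UNIV. s l ^ j l))"
      using \<open>(minkowski s (\<lambda>l. convex hull V l)) = T sv E\<close> by simp
  qed
qed

subsection \<open>Minkowski's theorem on mixed volumes\<close>

lemma compact_set_sum:
  fixes A :: "'i \<Rightarrow> 'a::real_normed_vector set"
  assumes "\<And>i. i \<in> I \<Longrightarrow> compact (A i)"
  shows "compact (\<Sum>i\<in>I. A i)"
  using assms
proof (induction I rule: infinite_finite_induct)
  case (insert i I)
  have "A i + (\<Sum>i\<in>I. A i) = {x + y | x y. x \<in> A i \<and> y \<in> (\<Sum>i\<in>I. A i)}" by (auto simp: set_plus_def)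
  then show ?case using insert compact_sums[of "A i" "\<Sum>i\<in>I. A i"] by simp
qed auto

text \<open>Upper semicontinuity of volume: an open set of slightly larger measure contains a
  uniform neighbourhood of the compact set \<open>A\<close>.\<close>

lemma measure_le_of_near:
  fixes A :: "'a::euclidean_space set"
  assumes "compact A" "0 < e"
  obtains r where "0 < r"
    "\<And>B. \<lbrakk>B \<in> lmeasurable; B \<subseteq> (\<Union>x\<in>A. ball x r)\<rbrakk> \<Longrightarrow> measure lebesgue B < measure lebesgue A + e"
proof -
  have A: "A \<in> lmeasurable" using assms(1) by (rule lmeasurable_compact)
  obtain T where T: "open T" "A \<subseteq> T" "T - A \<in> lmeasurable" "emeasure lebesgue (T - A) < ennreal e"
    using sets_lebesgue_outer_open[OF fmeasurableD[OF A] assms(2)] by blast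
  have TA: "T = A \<union> (T - A)" using T(2) by blast
  have Tm: "T \<in> lmeasurable" by (subst TA) (intro fmeasurable.Un A T)
  have "measure lebesgue (T - A) < e"
    using T(3,4) assms(2) by (simp add: emeasure_eq_measure2 ennreal_less_iff)
  moreover have "measure lebesgue T \<le> measure lebesgue A + measure lebesgue (T - A)"
    by (subst TA) (intro measure_Un_le fmeasurableD A T)
  ultimately have Te: "measure lebesgue T < measure lebesgue A + e" by simp
  obtain r where r: "r > 0" "(\<Union>x\<in>A. ball x r) \<subseteq> T"
    using compact_subset_open_imp_ball_epsilon_subset[OF assms(1) T(1,2)] by blast
  show thesis
  proof (rule that[OF r(1)])
    fix B assume B: "B \<in> lmeasurable" "B \<subseteq> (\<Union>x\<in>A. ball x r)"
    then have "measure lebesgue B \<le> measure lebesgue T"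
      using r(2) Tm by (intro measure_mono_fmeasurable fmeasurableD) auto
    then show "measure lebesgue B < measure lebesgue A + e" using Te by simp
  qed
qed

text \<open>Finitely many small cubes centred in \<open>K\<close> cover \<open>K\<close>; the hull
  of their vertices is the polytope. It stays in the neighbourhood because the neighbourhood of a
  convex set is convex.\<close>

lemma polytope_approximation:
  fixes K :: "'a::euclidean_space set"
  assumes K: "compact K" "convex K" and \<delta>: "0 < \<delta>"
  obtains V where "finite V" "K \<subseteq> convex hull V" "convex hull V \<subseteq> (\<Union>x\<in>K. ball x \<delta>)"
proof -
  \<comment> \<open>With half-edge \<open>d\<close>, the bound of the norm by the sum of the
    coordinates keeps every point of a cube within \<open>\<delta> / 2\<close> of its
    centre.\<close>
  define d where "d = \<delta> / (2 * DIM('a))"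
  have d: "0 < d" using \<delta> by (simp add: d_def)
  define D :: 'a where "D = (\<Sum>i\<in>Basis. d *\<^sub>R i)"
  have D: "D \<bullet> i = d" if "i \<in> Basis" for i using that by (simp add: D_def)
  have "\<exists>S. finite S \<and> cbox (x - D) (x + D) = convex hull S" for x
    using cube_convex_hull[OF d, of x] unfolding D_def by metis
  then obtain S where S: "\<And>x. finite (S x)" "\<And>x. cbox (x - D) (x + D) = convex hull S x" by metis
  have "K \<subseteq> (\<Union>x\<in>K. box (x - D) (x + D))"
  proof
    fix x assume "x \<in> K"
    moreover have "x \<in> box (x - D) (x + D)" using d by (simp add: mem_box inner_diff_left inner_add_left D)
    ultimately show "x \<in> (\<Union>x\<in>K. box (x - D) (x + D))" by blast
  qed
  then obtain X where X: "X \<subseteq> K" "finite X" "K \<subseteq> (\<Union>x\<in>X. box (x - D) (x + D))"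
    using compactE_image[OF K(1), of K "\<lambda>x. box (x - D) (x + D)"] by (metis open_box)
  show thesis
  proof (rule that[of "\<Union>x\<in>X. S x"])
    show "finite (\<Union>x\<in>X. S x)" using X S by auto
    show "K \<subseteq> convex hull (\<Union>x\<in>X. S x)"
    proof
      fix y assume "y \<in> K"
      then obtain x where x: "x \<in> X" "y \<in> cbox (x - D) (x + D)" using X(3) box_subset_cbox by blast
      then show "y \<in> convex hull (\<Union>x\<in>X. S x)"
        unfolding S(2) using hull_mono[of "S x" "\<Union>x\<in>X. S x" convex] by blast
    qed
    have "(\<Union>x\<in>K. ball x \<delta>) = (\<Union>x\<in>K. \<Union>y\<in>ball 0 \<delta>. {x + y})"
    proof (intro equalityI subsetI)
      fix z assume "z \<in> (\<Union>x\<in>K. ball x \<delta>)"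
      then obtain x where "x \<in> K" "dist x z < \<delta>" by auto
      then show "z \<in> (\<Union>x\<in>K. \<Union>y\<in>ball 0 \<delta>. {x + y})"
        by (intro UN_I[of x] UN_I[of "z - x"]) (simp_all add: dist_norm norm_minus_commute)
    qed (auto simp: dist_norm intro!: bexI)
    then have "convex (\<Union>x\<in>K. ball x \<delta>)" using convex_sums[OF K(2) convex_ball[of 0 \<delta>]] by metis
    moreover have "(\<Union>x\<in>X. S x) \<subseteq> (\<Union>x\<in>K. ball x \<delta>)"
    proof
      fix y assume "y \<in> (\<Union>x\<in>X. S x)"
      then obtain x where x: "x \<in> X" "y \<in> S x" by blast
      then have y: "y \<in> cbox (x - D) (x + D)" unfolding S(2) by (simp add: hull_inc)
      have "\<bar>(y - x) \<bullet> i\<bar> \<le> d" if "i \<in> Basis" for i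
        using y that D[OF that] by (force simp: mem_box inner_diff_left inner_add_left abs_le_iff)
      then have "norm (y - x) \<le> DIM('a) * d"
        by (intro order_trans[OF norm_le_l1] sum_bounded_above) auto
      also have "\<dots> < \<delta>" using \<delta> by (simp add: d_def)
      finally have "y \<in> ball x \<delta>" by (simp add: dist_norm norm_minus_commute)
      then show "y \<in> (\<Union>x\<in>K. ball x \<delta>)" using x(1) X(1) by blast
    qed
    ultimately show "convex hull (\<Union>x\<in>X. S x) \<subseteq> (\<Union>x\<in>K. ball x \<delta>)" by (rule hull_minimal[rotated])
  qed
qed

lemma finite_family_convergent_subsequence:
  fixes a :: "nat \<Rightarrow> 'i \<Rightarrow> real"
  assumes "finite I" "\<And>i. i \<in> I \<Longrightarrow> bounded (range (\<lambda>n. a n i))"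
  shows "\<exists>r. strict_mono r \<and> (\<forall>i\<in>I. convergent (\<lambda>n. a (r n) i))"
  using assms
proof (induction I)
  case empty
  then show ?case by (auto intro!: exI[of _ id] strict_monoI)
next
  case (insert i I)
  then obtain r where r: "strict_mono r" "\<forall>i\<in>I. convergent (\<lambda>n. a (r n) i)" by auto
  have "bounded (range (\<lambda>n. a (r n) i))"
    using insert.prems[of i] by (rule bounded_subset) auto
  then obtain l q where q: "strict_mono q" "((\<lambda>n. a (r n) i) \<circ> q) \<longlonglongrightarrow> l"
    using bounded_imp_convergent_subsequence by blast
  have "convergent (\<lambda>n. a ((r \<circ> q) n) j)" if "j \<in> insert i I" for j
  proof (cases "j = i")
    case True
    then show ?thesis using q(2) by (auto simp: convergent_def o_def)
  next
    case False
    then have "convergent (\<lambda>n. a (r n) j)" using r(2) that by auto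
    from convergent_subseq_convergent[OF this q(1)] show ?thesis by (simp add: o_def)
  qed
  then show ?case using strict_mono_o[OF r(1) q(1)] by blast
qed

lemma minkowski_sum_near:
  fixes A B :: "'l::finite \<Rightarrow> 'a::real_normed_vector set"
  assumes "\<And>l. B l \<subseteq> (\<Union>x\<in>A l. ball x \<delta>)" "\<And>l. 0 \<le> s l" "(\<Sum>l\<in>UNIV. s l) * \<delta> < r"
  shows "(minkowski s B) \<subseteq> (\<Union>x\<in>(minkowski s A). ball x r)"
proof
  fix y assume "y \<in> (minkowski s B)"
  then obtain v where v: "\<And>l. v l \<in> (*\<^sub>R) (s l) ` B l" "y = (\<Sum>l\<in>UNIV. v l)"
    by (auto simp: set_sum_alt)
  have "\<exists>w x. w \<in> B l \<and> v l = s l *\<^sub>R w \<and> x \<in> A l \<and> dist x w \<le> \<delta>" for l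
    using v(1)[of l] assms(1)[of l] by (force simp: less_imp_le)
  then obtain w x where wx: "\<And>l. v l = s l *\<^sub>R w l" "\<And>l. x l \<in> A l" "\<And>l. dist (x l) (w l) \<le> \<delta>" by metis
  have "dist (\<Sum>l\<in>UNIV. s l *\<^sub>R x l) y = norm (\<Sum>l\<in>UNIV. s l *\<^sub>R (x l - w l))"
    by (simp add: v(2) wx(1) dist_norm sum_subtractf scaleR_diff_right)
  also have "\<dots> \<le> (\<Sum>l\<in>UNIV. s l * \<delta>)"
    using assms(2) wx(3) by (intro order_trans[OF norm_sum] sum_mono) (auto simp: dist_norm mult_left_mono)
  also have "\<dots> < r" using assms(3) by (simp add: sum_distrib_right)
  finally show "y \<in> (\<Union>x\<in>(minkowski s A). ball x r)"
    using wx(2) by (auto simp: set_sum_alt intro!: bexI[of _ "\<Sum>l\<in>UNIV. s l *\<^sub>R x l"] exI[of _ "\<lambda>l. s l *\<^sub>R x l"])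
qed

lemma compact_minkowski_combination:
  fixes K :: "'l::finite \<Rightarrow> 'a::real_normed_vector set"
  assumes "\<And>l. compact (K l)"
  shows "compact (minkowski s K)"
  by (rule compact_set_sum, rule compact_scaling, rule assms)

lemma measure_mono_compact:
  fixes A B :: "'a::euclidean_space set"
  assumes "compact A" "compact B" "A \<subseteq> B"
  shows "measure lebesgue A \<le> measure lebesgue B"
  using assms by (intro measure_mono_fmeasurable fmeasurableD lmeasurable_compact)

text \<open>The volume polynomials of outer polytope approximations have nonnegative coefficients,
  so their value at (1,...,1) bounds each coefficient. A subsequence of coefficients therefore
  converges, and its limit represents the volume at positive \<open>s\<close>.\<close>

theorem minkowski_combination_volume:
  fixes K :: "'l::finite \<Rightarrow> 'a::euclidean_space set"
  assumes K: "\<And>l. convex_body (K l)"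
  obtains a :: "('l \<Rightarrow> nat) \<Rightarrow> real" where "\<And>k. 0 \<le> a k"
    "\<And>s. (\<And>l. 0 \<le> s l) \<Longrightarrow> measure lebesgue (minkowski s K) =
      (\<Sum>k | (\<Sum>l\<in>UNIV. k l) = DIM('a). a k * (\<Prod>l\<in>UNIV. s l ^ k l))"
proof -
  let ?J = "{k :: 'l \<Rightarrow> nat. (\<Sum>l\<in>UNIV. k l) = DIM('a)}"
  have K': "compact (K l)" "convex (K l)" "K l \<noteq> {}" for l using K[of l] by (auto simp: convex_body_def)
  define F where "F s = measure lebesgue (minkowski s K)" for s
  have comp: "compact (minkowski s K)" for s
    using K' by (intro compact_minkowski_combination)
  define V where "V n l = (SOME V. finite V \<and> K l \<subseteq> convex hull V \<and>
    convex hull V \<subseteq> (\<Union>x\<in>K l. ball x (inverse (Suc n))))" for n l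
  have V': "finite (V n l) \<and> K l \<subseteq> convex hull (V n l) \<and>
    convex hull (V n l) \<subseteq> (\<Union>x\<in>K l. ball x (inverse (Suc n)))" for n l
    unfolding V_def
  proof (rule someI_ex, rule polytope_approximation[OF K'(1,2)])
    show "0 < inverse (real (Suc n))" by simp
  qed blast
  then have V: "\<And>l n. finite (V n l)" "\<And>l n. K l \<subseteq> convex hull (V n l)"
      "\<And>l n. convex hull (V n l) \<subseteq> (\<Union>x\<in>K l. ball x (inverse (Suc n)))" by blast+
  define G where "G n s = measure lebesgue (minkowski s (\<lambda>l. convex hull V n l))" for n s
  have compV: "compact (minkowski s (\<lambda>l. convex hull V n l))" for s n
    using V by (intro compact_minkowski_combination finite_imp_compact_convex_hull)
  have "\<exists>b. (\<forall>k. 0 \<le> b k) \<and> (\<forall>s. (\<forall>l. 0 < s l) \<longrightarrow> G n s = (\<Sum>k\<in>?J. b k * (\<Prod>l\<in>UNIV. s l ^ k l)))" for n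
  proof (rule polytope_combination_volume[of "V n"])
    fix b :: "('l \<Rightarrow> nat) \<Rightarrow> real"
    assume "\<And>k. 0 \<le> b k" "\<And>s. (\<And>l. 0 < s l) \<Longrightarrow> measure lebesgue (minkowski s (\<lambda>l. convex hull V n l)) =
      (\<Sum>k\<in>?J. b k * (\<Prod>l\<in>UNIV. s l ^ k l))"
    then show ?thesis unfolding G_def by blast
  qed (rule V)
  then have "\<exists>b. \<forall>n. (\<forall>k. 0 \<le> b n k) \<and> (\<forall>s. (\<forall>l. 0 < s l) \<longrightarrow> G n s = (\<Sum>k\<in>?J. b n k * (\<Prod>l\<in>UNIV. s l ^ k l)))"
    by (intro choice allI)
  then obtain b where b: "\<And>n k. 0 \<le> b n k"
     "\<And>n s. (\<forall>l. 0 < s l) \<longrightarrow> G n s = (\<Sum>k\<in>?J. b n k * (\<Prod>l\<in>UNIV. s l ^ k l))" by blast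
  have lim: "(\<lambda>n. G n s) \<longlonglongrightarrow> F s" if s: "\<And>l. 0 \<le> s l" for s
  proof (rule LIMSEQ_I)
    fix e :: real assume "0 < e"
    obtain r where r: "0 < r" "\<And>B. \<lbrakk>B \<in> lmeasurable; B \<subseteq> (\<Union>x\<in>(minkowski s K). ball x r)\<rbrakk>
        \<Longrightarrow> measure lebesgue B < F s + e"
      using measure_le_of_near[OF comp[of s] \<open>0 < e\<close>] unfolding F_def by blast
    obtain N where N: "inverse (real (Suc N)) < r / ((\<Sum>l\<in>UNIV. s l) + 1)"
      using reals_Archimedean[of "r / ((\<Sum>l\<in>UNIV. s l) + 1)"] r(1) sum_nonneg[of UNIV s] s by (auto simp: add_nonneg_pos)
    have "norm (G n s - F s) < e" if n: "N \<le> n" for n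
    proof -
      have "F s \<le> G n s" unfolding F_def G_def
      proof (rule measure_mono_compact[OF comp compV])
        show "(minkowski s K) \<subseteq> (minkowski s (\<lambda>l. convex hull V n l))"
          using V(2) by (force simp: set_sum_alt)
      qed
      moreover have "G n s < F s + e" unfolding G_def
      proof (rule r(2)[OF lmeasurable_compact[OF compV]])
        have "inverse (real (Suc n)) \<le> inverse (real (Suc N))" using n by simp
        then have "inverse (real (Suc n)) < r / ((\<Sum>l\<in>UNIV. s l) + 1)" using N by (rule le_less_trans)
        moreover have "0 < (\<Sum>l\<in>UNIV. s l) + 1" using sum_nonneg[of UNIV s] s by (simp add: add_nonneg_pos)
        ultimately have "((\<Sum>l\<in>UNIV. s l) + 1) * inverse (real (Suc n)) < r"
          by (subst mult.commute) (simp only: pos_less_divide_eq)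
        moreover have "(\<Sum>l\<in>UNIV. s l) * inverse (real (Suc n)) \<le> ((\<Sum>l\<in>UNIV. s l) + 1) * inverse (real (Suc n))"
          by (intro mult_right_mono) auto
        ultimately show "(minkowski s (\<lambda>l. convex hull V n l)) \<subseteq> (\<Union>x\<in>(minkowski s K). ball x r)"
          by (intro minkowski_sum_near[OF V(3) s]) linarith
      qed
      ultimately show ?thesis by auto
    qed
    then show "\<exists>N. \<forall>n\<ge>N. norm (G n s - F s) < e" by blast
  qed
  have "bounded (range (\<lambda>n. b n k))" if k: "k \<in> ?J" for k
  proof -
    have "bounded (range (\<lambda>n. G n (\<lambda>_. 1)))" using lim[of "\<lambda>_. 1"] by (intro convergent_imp_bounded[of _ "F (\<lambda>_. 1)"]) auto
    then obtain M where M: "\<And>n. norm (G n (\<lambda>_. 1)) \<le> M" by (auto simp: bounded_iff)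
    have "b n k \<le> G n (\<lambda>_. 1)" for n
      using b(2)[of "\<lambda>_. 1" n] k b(1) by (auto intro!: member_le_sum finite_exponents)
    then have "norm (b n k) \<le> M" for n
      using M[of n] b(1)[of n k] abs_ge_self[of "G n (\<lambda>_. 1)"] by (smt (verit) real_norm_def)
    then show ?thesis by (auto simp: bounded_iff)
  qed
  then obtain r where r: "strict_mono r" "\<forall>k\<in>?J. convergent (\<lambda>n. b (r n) k)"
    using finite_family_convergent_subsequence[OF finite_exponents] by blast
  define a where "a k = (if k \<in> ?J then lim (\<lambda>n. b (r n) k) else 0)" for k
  have a: "(\<lambda>n. b (r n) k) \<longlonglongrightarrow> a k" if "k \<in> ?J" for k
    using r(2) that by (simp add: a_def convergent_LIMSEQ_iff)
  have apos: "0 \<le> a k" for k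
  proof (cases "k \<in> ?J")
    case True
    show ?thesis using b(1) by (intro LIMSEQ_le_const[OF a[OF True]]) auto
  qed (auto simp: a_def)
  have Fpos: "F s = (\<Sum>k\<in>?J. a k * (\<Prod>l\<in>UNIV. s l ^ k l))" if s: "\<And>l. 0 < s l" for s
  proof -
    have "(\<lambda>n. G (r n) s) \<longlonglongrightarrow> F s"
      using LIMSEQ_subseq_LIMSEQ[OF lim r(1), of s] s by (simp add: o_def less_imp_le)
    moreover have "(\<lambda>n. G (r n) s) \<longlonglongrightarrow> (\<Sum>k\<in>?J. a k * (\<Prod>l\<in>UNIV. s l ^ k l))"
    proof -
      have "(\<lambda>n. \<Sum>k\<in>?J. b (r n) k * (\<Prod>l\<in>UNIV. s l ^ k l)) \<longlonglongrightarrow> (\<Sum>k\<in>?J. a k * (\<Prod>l\<in>UNIV. s l ^ k l))"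
        by (intro tendsto_sum tendsto_mult_right a)
      then show ?thesis using s b(2) by simp
    qed
    ultimately show ?thesis by (rule LIMSEQ_unique)
  qed
  \<comment> \<open>Points of the orthant with zero coordinates are reached by a squeeze: increasing
    every coordinate by \<open>\<epsilon>\<close> yields a set containing a translate of the
    original sum and contained in a small neighbourhood of it.\<close>
  have "F s = (\<Sum>k\<in>?J. a k * (\<Prod>l\<in>UNIV. s l ^ k l))" if s: "\<And>l. 0 \<le> s l" for s
  proof -
    let ?p = "\<lambda>\<epsilon>. \<Sum>k\<in>?J. a k * (\<Prod>l\<in>UNIV. (s l + \<epsilon>) ^ k l)"
    have plim: "(?p \<longlongrightarrow> ?p 0) (at_right 0)" by (intro tendsto_intros)
    have add: "(minkowski (\<lambda>l. s l + \<epsilon>) K) = (minkowski s K) + (\<Sum>l\<in>UNIV. (*\<^sub>R) \<epsilon> ` K l)"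
      if "0 \<le> \<epsilon>" for \<epsilon>
      using that s K' by (simp add: scaleR_image_add sum.distrib)
    have ge: "F s \<le> ?p \<epsilon>" if "0 < \<epsilon>" for \<epsilon>
    proof -
      have "\<exists>w. w \<in> K l" for l using K'(3) by blast
      then obtain w where "\<And>l. w l \<in> K l" by metis
      then have x: "(\<Sum>l\<in>UNIV. \<epsilon> *\<^sub>R w l) \<in> (\<Sum>l\<in>UNIV. (*\<^sub>R) \<epsilon> ` K l)" (is "?x \<in> _")
        by (auto simp: set_sum_alt)
      have "F s = measure lebesgue ((+) ?x ` (minkowski s K))"
        by (simp add: F_def measure_translation)
      also have "\<dots> \<le> F (\<lambda>l. s l + \<epsilon>)" unfolding F_def
      proof (rule measure_mono_compact[OF compact_translation[OF comp] comp])
        show "(+) ?x ` (minkowski s K) \<subseteq> (minkowski (\<lambda>l. s l + \<epsilon>) K)"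
          
        proof (subst add)
          show "(+) ?x ` (minkowski s K) \<subseteq> (minkowski s K) + (\<Sum>l\<in>UNIV. (*\<^sub>R) \<epsilon> ` K l)"
            using x by (subst add.commute[of "\<Sum>l\<in>UNIV. (*\<^sub>R) (s l) ` K l"]) (auto intro: set_plus_intro)
        qed (use \<open>0 < \<epsilon>\<close> in simp)
      qed
      also have "\<dots> = ?p \<epsilon>" using s that by (intro Fpos) (auto simp: add_nonneg_pos)
      finally show ?thesis .
    qed
    have "F s \<le> ?p 0"
      by (rule tendsto_lowerbound[OF plim]) (auto simp: eventually_at_right_less intro!: eventually_at_rightI[of 0 1] ge)
    moreover have "?p 0 \<le> F s"
    proof (rule field_le_epsilon)
      fix e :: real assume "0 < e"
      obtain q where q: "0 < q" "\<And>B. \<lbrakk>B \<in> lmeasurable; B \<subseteq> (\<Union>x\<in>(minkowski s K). ball x q)\<rbrakk>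
          \<Longrightarrow> measure lebesgue B < F s + e"
        using measure_le_of_near[OF comp[of s] \<open>0 < e\<close>] unfolding F_def by blast
      obtain M where M: "\<And>x. x \<in> (\<Sum>l\<in>UNIV. (*\<^sub>R) 1 ` K l) \<Longrightarrow> norm x \<le> M" "0 < M"
        using compact_imp_bounded[OF comp[of "\<lambda>_. 1"]] by (auto simp: bounded_pos)
      have "?p \<epsilon> \<le> F s + e" if \<epsilon>: "0 < \<epsilon>" "\<epsilon> < q / M" for \<epsilon>
      proof -
        have "(minkowski (\<lambda>l. s l + \<epsilon>) K) \<subseteq> (\<Union>x\<in>(minkowski s K). ball x q)"
        proof
          fix z assume "z \<in> (minkowski (\<lambda>l. s l + \<epsilon>) K)"
          then obtain x y where xy: "x \<in> (minkowski s K)" "y \<in> (\<Sum>l\<in>UNIV. (*\<^sub>R) \<epsilon> ` K l)" "z = x + y"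
            using add[of \<epsilon>] \<epsilon> by (auto elim!: set_plus_elim)
          obtain v where v: "\<And>l. v l \<in> (*\<^sub>R) \<epsilon> ` K l" "y = (\<Sum>l\<in>UNIV. v l)"
            using xy(2) by (auto simp: set_sum_alt)
          have "\<exists>w\<in>K l. v l = \<epsilon> *\<^sub>R w" for l using v(1)[of l] by auto
          then obtain w where w: "\<And>l. w l \<in> K l" "\<And>l. v l = \<epsilon> *\<^sub>R w l" by metis
          have "(\<Sum>l\<in>UNIV. w l) \<in> (\<Sum>l\<in>UNIV. (*\<^sub>R) 1 ` K l)" using w(1) by (auto simp: set_sum_alt)
          moreover have "y = \<epsilon> *\<^sub>R (\<Sum>l\<in>UNIV. w l)" by (simp add: v(2) w(2) scaleR_sum_right)
          ultimately have "norm y \<le> \<epsilon> * M" using M(1) \<epsilon>(1) by (simp add: mult_left_mono)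
          also have "\<dots> < q" using \<epsilon> M(2) by (simp add: pos_less_divide_eq)
          finally show "z \<in> (\<Union>x\<in>(minkowski s K). ball x q)" using xy by (auto simp: dist_norm intro!: bexI[of _ x])
        qed
        then have "F (\<lambda>l. s l + \<epsilon>) < F s + e" unfolding F_def[of "\<lambda>l. s l + \<epsilon>"]
          by (intro q(2) lmeasurable_compact comp)
        then show ?thesis using Fpos[of "\<lambda>l. s l + \<epsilon>"] s \<epsilon> by (simp add: add_nonneg_pos)
      qed
      then show "?p 0 \<le> F s + e"
        using q(1) M(2) by (intro tendsto_upperbound[OF plim] eventually_at_rightI[of 0 "q / M"]) auto
    qed
    ultimately show ?thesis by simp
  qed
  then show thesis using that[of a] apos unfolding F_def by blast
qed

subsection \<open>Bodies with homothetic sections are simplices\<close>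

text \<open>One convex cone holds all dilates of \<open>K\<close>, so Minkowski addition of dilates
  becomes addition in the cone. The condition \<open>0 \<le> s\<close> excludes reflected
  copies.\<close>

definition body_cone :: "'a::real_vector set \<Rightarrow> (real \<times> 'a) set" where
  "body_cone K = {(s, y). 0 \<le> s \<and> y \<in> (*\<^sub>R) s ` K}"

lemma body_cone_iff: "(s, y) \<in> body_cone K \<longleftrightarrow> 0 \<le> s \<and> y \<in> (*\<^sub>R) s ` K"
  by (simp add: body_cone_def)

lemma body_cone_add:
  assumes "convex K" "a \<in> body_cone K" "b \<in> body_cone K"
  shows "a + b \<in> body_cone K"
  using assms by (cases a; cases b) (auto simp: body_cone_iff scaleR_image_add intro!: set_plus_intro)

lemma body_cone_scaleR:
  assumes "a \<in> body_cone K" "0 \<le> c"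
  shows "c *\<^sub>R a \<in> body_cone K"
  using assms by (cases a) (auto simp: body_cone_iff)

lemma body_cone_generator: "k \<in> K \<Longrightarrow> 0 \<le> s \<Longrightarrow> s *\<^sub>R (1, k) \<in> body_cone K"
  by (auto simp: body_cone_iff)

lemma body_cone_zero: "K \<noteq> {} \<Longrightarrow> 0 \<in> body_cone K"
  by (auto simp: zero_prod_def body_cone_iff image_iff)

lemma body_cone_sum:
  assumes "convex K" "K \<noteq> {}" "\<And>i. i \<in> T \<Longrightarrow> i \<in> K \<and> 0 \<le> m i"
  shows "(\<Sum>i\<in>T. m i *\<^sub>R (1, i)) \<in> body_cone K"
  using assms(3)
proof (induction T rule: infinite_finite_induct)
  case (insert i T)
  then have "m i *\<^sub>R (1, i) \<in> body_cone K" by (intro body_cone_generator) auto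
  then show ?case using insert by (simp only: sum.insert not_False_eq_True) (auto intro!: body_cone_add assms(1))
qed (use assms body_cone_zero in auto)

text \<open>A hyperplane separating \<open>a\<close> from \<open>B\<close> contradicts the inclusion
  at the point of \<open>K\<close> where its normal functional is least.\<close>

lemma minkowski_cancellation:
  fixes K B :: "'a::euclidean_space set"
  assumes K: "compact K" "K \<noteq> {}" and B: "closed B" "convex B"
    and sub: "(+) a ` K \<subseteq> B + K"
  shows "a \<in> B"
proof (rule ccontr)
  assume "a \<notin> B"
  then obtain v t where v: "v \<bullet> a < t" "\<And>x. x \<in> B \<Longrightarrow> t < v \<bullet> x"
    using separating_hyperplane_closed_point[OF B(2,1)] by metis
  have "continuous_on K ((\<bullet>) v)" by (intro continuous_intros)
  then obtain k where k: "k \<in> K" "\<And>x. x \<in> K \<Longrightarrow> v \<bullet> k \<le> v \<bullet> x"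
    using continuous_attains_inf[OF K] by blast
  have "a + k \<in> B + K" using sub k(1) by blast
  then obtain x y where xy: "x \<in> B" "y \<in> K" "a + k = x + y" by (auto elim: set_plus_elim)
  have "v \<bullet> a + v \<bullet> k = v \<bullet> x + v \<bullet> y" using xy(3) by (metis inner_add_right)
  then show False using v(1) v(2)[OF xy(1)] k(2)[OF xy(2)] by linarith
qed

lemma measure_homothet:
  fixes K :: "'a::euclidean_space set"
  assumes "0 \<le> r"
  shows "measure lebesgue ((\<lambda>k. y + r *\<^sub>R k) ` K) = r ^ DIM('a) * measure lebesgue K"
  using measure_lebesgue_affine[of r y K] assms by (simp add: add.commute)

lemma compact_homothet:
  fixes K :: "'a::real_normed_vector set"
  assumes "compact K"
  shows "compact ((\<lambda>k. y + r *\<^sub>R k) ` K)"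
  using assms by (intro compact_continuous_image) (auto intro!: continuous_intros)

text \<open>Translates inclusion of homothets into the order given by the cone. Comparing volumes
  shows \<open>\<sigma> \<le> \<rho>\<close>; then \<open>\<rho>K\<close> splits as
  \<open>(\<rho> - \<sigma>)K + \<sigma>K\<close> and the summand \<open>\<sigma>K\<close>
  cancels.\<close>

lemma homothet_subset_homothet:
  fixes K :: "'a::euclidean_space set"
  assumes K: "compact K" "convex K" "0 < measure lebesgue K" and r: "0 \<le> \<sigma>" "0 \<le> \<rho>"
    and sub: "(\<lambda>k. a + \<sigma> *\<^sub>R k) ` K \<subseteq> (\<lambda>k. y + \<rho> *\<^sub>R k) ` K"
  shows "(\<rho> - \<sigma>, a - y) \<in> body_cone K"
proof -
  have ne: "K \<noteq> {}" using K(3) by auto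
  have "\<sigma> ^ DIM('a) * measure lebesgue K \<le> \<rho> ^ DIM('a) * measure lebesgue K"
    using measure_mono_compact[OF compact_homothet compact_homothet sub] K(1) r by (simp add: measure_homothet)
  then have "\<sigma> ^ DIM('a) \<le> \<rho> ^ DIM('a)" using K(3) by simp
  then have le: "\<sigma> \<le> \<rho>" using r by (simp add: power_mono_iff)
  have "a - y \<in> (*\<^sub>R) (\<rho> - \<sigma>) ` K"
  proof (rule minkowski_cancellation)
    show "compact ((*\<^sub>R) \<sigma> ` K)" "closed ((*\<^sub>R) (\<rho> - \<sigma>) ` K)" "convex ((*\<^sub>R) (\<rho> - \<sigma>) ` K)"
      using K by (auto intro!: compact_scaling compact_imp_closed convex_scaling)
    have "(*\<^sub>R) (\<rho> - \<sigma>) ` K + (*\<^sub>R) \<sigma> ` K = (*\<^sub>R) \<rho> ` K"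
      using scaleR_image_add[OF K(2), of "\<rho> - \<sigma>" \<sigma>] le r by simp
    moreover have "(+) (a - y) ` (*\<^sub>R) \<sigma> ` K \<subseteq> (*\<^sub>R) \<rho> ` K"
    proof
      fix z assume "z \<in> (+) (a - y) ` (*\<^sub>R) \<sigma> ` K"
      then obtain k where k: "k \<in> K" "z = a - y + \<sigma> *\<^sub>R k" by auto
      then obtain k' where "k' \<in> K" "a + \<sigma> *\<^sub>R k = y + \<rho> *\<^sub>R k'" using sub by auto
      then show "z \<in> (*\<^sub>R) \<rho> ` K" using k(2) by (auto intro!: image_eqI[of _ _ k'] simp: algebra_simps)
    qed
    ultimately show "(+) (a - y) ` (*\<^sub>R) \<sigma> ` K \<subseteq> (*\<^sub>R) (\<rho> - \<sigma>) ` K + (*\<^sub>R) \<sigma> ` K" by simp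
  qed (use ne in auto)
  then show ?thesis using le by (simp add: body_cone_iff)
qed

text \<open>The displayed set is a horizontal section of the intersection of the cone with a
  translate of itself. The two cone conditions place the apex \<open>(s - \<rho>, y)\<close> of the
  homothetic section in both of these cones.\<close>

definition homothetic_sections :: "'a::euclidean_space set \<Rightarrow> bool" where
  "homothetic_sections K \<longleftrightarrow> (\<forall>s t x. 0 < s \<longrightarrow> 0 < t \<longrightarrow>
     0 < measure lebesgue {y \<in> (*\<^sub>R) s ` K. y + x \<in> (*\<^sub>R) t ` K} \<longrightarrow>
     (\<exists>y \<rho>. 0 \<le> \<rho> \<and> (s - \<rho>, y) \<in> body_cone K \<and> (t - \<rho>, y + x) \<in> body_cone K \<and>
        {y \<in> (*\<^sub>R) s ` K. y + x \<in> (*\<^sub>R) t ` K} = (\<lambda>k. y + \<rho> *\<^sub>R k) ` K))"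

text \<open>
  Two translates of the cone over \<open>K\<close> intersect in a translate of the cone, so the order with this
  positive cone is a lattice order; \<open>d\<close> is the positive part of \<open>a - b\<close>.
\<close>

lemma riesz_decomposition:
  fixes K :: "'a::euclidean_space set"
  assumes K: "compact K" "convex K" "0 < measure lebesgue K" and H: "homothetic_sections K"
    and a: "a \<in> body_cone K" and b: "b \<in> body_cone K" and c: "c \<in> body_cone K" and abc: "b + c - a \<in> body_cone K"
  obtains d where "d \<in> body_cone K" "a - d \<in> body_cone K" "c - d \<in> body_cone K" "b - (a - d) \<in> body_cone K"
proof -
  obtain \<alpha> a' \<beta> b' \<gamma> c' where eq: "a = (\<alpha>, a')" "b = (\<beta>, b')" "c = (\<gamma>, c')" by (metis surj_pair)
  have nn: "0 \<le> \<alpha>" "0 \<le> \<beta>" "0 \<le> \<gamma>" using a b c by (auto simp: eq body_cone_iff)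
  \<comment> \<open>\<open>X\<close> is the section at height \<open>S\<close> of the cone
    intersected with its translate by \<open>a - b\<close>. The summand 1 makes \<open>S\<close>
    exceed the heights of \<open>a\<close> and \<open>c\<close>, so \<open>X\<close> contains a
    homothet of \<open>K\<close> with positive ratio and has positive volume.\<close>
  define S where "S = \<alpha> + \<gamma> + 1"
  define t where "t = S - \<alpha> + \<beta>"
  define X where "X = {y \<in> (*\<^sub>R) S ` K. y + (b' - a') \<in> (*\<^sub>R) t ` K}"
  have sect: "(\<lambda>k. u + (S - \<mu>) *\<^sub>R k) ` K \<subseteq> X"
    if u: "(\<mu>, u) \<in> body_cone K" "(\<mu>, u) - a + b \<in> body_cone K" "\<mu> \<le> S" for \<mu> u
  proof -
    have "u + (S - \<mu>) *\<^sub>R k \<in> X" if k: "k \<in> K" for k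
    proof -
      have g: "(S - \<mu>) *\<^sub>R (1, k) \<in> body_cone K" using body_cone_generator[OF k] u(3) by simp
      have "(\<mu>, u) + (S - \<mu>) *\<^sub>R (1, k) \<in> body_cone K" by (rule body_cone_add[OF K(2) u(1) g])
      moreover have "((\<mu>, u) - a + b) + (S - \<mu>) *\<^sub>R (1, k) \<in> body_cone K" by (rule body_cone_add[OF K(2) u(2) g])
      ultimately show ?thesis by (simp add: X_def body_cone_iff eq t_def algebra_simps)
    qed
    then show ?thesis by blast
  qed
  have aX: "(\<lambda>k. a' + (S - \<alpha>) *\<^sub>R k) ` K \<subseteq> X"
    using a b nn by (intro sect) (auto simp: eq S_def)
  have cX: "(\<lambda>k. c' + (S - \<gamma>) *\<^sub>R k) ` K \<subseteq> X"
    using c abc nn by (intro sect) (auto simp: eq S_def algebra_simps)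
  have "compact X"
  proof -
    have "X = (*\<^sub>R) S ` K \<inter> (\<lambda>y. y - (b' - a')) ` (*\<^sub>R) t ` K"
      by (force simp: X_def image_iff algebra_simps)
    then show ?thesis using K(1) by (auto intro!: compact_Int compact_scaling compact_continuous_image continuous_intros)
  qed
  then have "(S - \<alpha>) ^ DIM('a) * measure lebesgue K \<le> measure lebesgue X"
    using measure_mono_compact[OF compact_homothet[OF K(1)] _ aX] nn by (simp add: measure_homothet S_def)
  moreover have "0 < (S - \<alpha>) ^ DIM('a) * measure lebesgue K" using nn K(3) by (simp add: S_def)
  ultimately have "0 < measure lebesgue X" by simp
  moreover have "0 < S" "0 < t" using nn by (auto simp: S_def t_def)
  ultimately obtain y \<rho> where y: "0 \<le> \<rho>" "(S - \<rho>, y) \<in> body_cone K" "(t - \<rho>, y + (b' - a')) \<in> body_cone K"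
      "X = (\<lambda>k. y + \<rho> *\<^sub>R k) ` K"
    using H unfolding homothetic_sections_def X_def by blast
  show thesis
  proof (rule that[of "(S - \<rho>, y)"])
    show "(S - \<rho>, y) \<in> body_cone K" by (rule y)
    show "a - (S - \<rho>, y) \<in> body_cone K"
      using homothet_subset_homothet[OF K _ y(1), of "S - \<alpha>" a' y] aX nn by (simp add: y(4) eq S_def algebra_simps)
    show "c - (S - \<rho>, y) \<in> body_cone K"
      using homothet_subset_homothet[OF K _ y(1), of "S - \<gamma>" c' y] cX nn by (simp add: y(4) eq S_def algebra_simps)
    show "b - (a - (S - \<rho>, y)) \<in> body_cone K" using y(3) by (simp add: eq t_def algebra_simps)
  qed
qed

text \<open>Rescaled to height 1, the two summands of \<open>l *\<^sub>R (1, v)\<close> exhibit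
  \<open>v\<close> as a convex combination of points of \<open>K\<close>, and both points equal
  \<open>v\<close> by extremality.\<close>

lemma extreme_ray:
  assumes v: "v extreme_point_of K" and d: "d \<in> body_cone K" "l *\<^sub>R (1, v) - d \<in> body_cone K"
  shows "d = fst d *\<^sub>R (1, v) \<and> 0 \<le> fst d"
proof -
  obtain \<delta> d' where eq: "d = (\<delta>, d')" by (cases d)
  obtain k1 k2 where k: "0 \<le> \<delta>" "k1 \<in> K" "d' = \<delta> *\<^sub>R k1" "0 \<le> l - \<delta>" "k2 \<in> K" "l *\<^sub>R v - d' = (l - \<delta>) *\<^sub>R k2"
    using d by (auto simp: eq body_cone_iff)
  have "\<delta> *\<^sub>R v = d'"
  proof (cases "\<delta> = 0 \<or> l = \<delta>")
    case True
    then show ?thesis using k by auto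
  next
    case False
    then have pos: "0 < \<delta>" "0 < l - \<delta>" "0 < l" using k by auto
    have "v = (1 - \<delta> / l) *\<^sub>R k2 + (\<delta> / l) *\<^sub>R k1"
    proof -
      have "l *\<^sub>R v = (l - \<delta>) *\<^sub>R k2 + \<delta> *\<^sub>R k1" using k(3,6) by (metis add.commute diff_add_cancel)
      then have "v = (1 / l) *\<^sub>R ((l - \<delta>) *\<^sub>R k2 + \<delta> *\<^sub>R k1)" using pos by (metis divide_self_if less_irrefl scaleR_one scaleR_scaleR times_divide_eq_left mult_1)
      then show ?thesis using pos by (simp add: scaleR_add_right diff_divide_distrib)
    qed
    then have "k2 \<noteq> k1 \<Longrightarrow> v \<in> open_segment k2 k1"
      using pos by (auto simp: in_segment intro!: exI[of _ "\<delta> / l"])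
    then have "k2 = k1" using v k by (auto simp: extreme_point_of_def)
    then have "v = k1" using \<open>v = (1 - \<delta> / l) *\<^sub>R k2 + (\<delta> / l) *\<^sub>R k1\<close> by (simp flip: scaleR_add_left)
    then show ?thesis using k by simp
  qed
  then show ?thesis using k(1) by (simp add: eq)
qed

text \<open>Riesz decomposition splits \<open>l *\<^sub>R (1, v)\<close> into a part
  \<open>d\<close> below the multiple of \<open>(1, j)\<close> and a rest below the remaining sum.
  As \<open>d\<close> lies on both extreme rays, either \<open>v = j\<close> or
  \<open>d = 0\<close>, and in the latter case the induction continues with
  \<open>J\<close>.\<close>

lemma extreme_ray_below_sum:
  fixes K :: "'a::euclidean_space set"
  assumes K: "compact K" "convex K" "0 < measure lebesgue K" and H: "homothetic_sections K"
    and v: "v extreme_point_of K" "0 < l"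
    and J: "finite J" "\<And>j. j \<in> J \<Longrightarrow> j extreme_point_of K \<and> 0 \<le> m j"
    and le: "(\<Sum>j\<in>J. m j *\<^sub>R (1, j)) - l *\<^sub>R (1, v) \<in> body_cone K"
  shows "v \<in> J"
  using J le
proof (induction J)
  case empty
  then show ?case using v(2) by (auto simp: zero_prod_def body_cone_iff)
next
  case (insert j J)
  have vK: "v \<in> K" and JK: "\<And>i. i \<in> insert j J \<Longrightarrow> i \<in> K" using v insert.prems(1) by (auto simp: extreme_point_of_def)
  have ne: "K \<noteq> {}" using vK by auto
  have sumQ: "(\<Sum>i\<in>J. m i *\<^sub>R (1, i)) \<in> body_cone K"
    using insert.prems(1) JK by (intro body_cone_sum[OF K(2) ne]) auto
  have Q: "l *\<^sub>R (1, v) \<in> body_cone K" "m j *\<^sub>R (1, j) \<in> body_cone K"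
    using vK v(2) JK insert.prems(1) by (auto intro!: body_cone_generator simp del: scaleR_Pair)
  obtain d where d: "d \<in> body_cone K" "l *\<^sub>R (1, v) - d \<in> body_cone K" "m j *\<^sub>R (1, j) - d \<in> body_cone K"
      "(\<Sum>i\<in>J. m i *\<^sub>R (1, i)) - (l *\<^sub>R (1, v) - d) \<in> body_cone K"
  proof (rule riesz_decomposition[OF K H Q(1) sumQ Q(2)])
    show "(\<Sum>i\<in>J. m i *\<^sub>R (1, i)) + m j *\<^sub>R (1, j) - l *\<^sub>R (1, v) \<in> body_cone K"
      using insert.prems(2) insert.hyps by (simp add: add.commute)
  qed
  have dv: "d = fst d *\<^sub>R (1, v)" "0 \<le> fst d" using extreme_ray[OF v(1) d(1,2)] by auto
  have dj: "d = fst d *\<^sub>R (1, j)" using extreme_ray[of j, OF _ d(1,3)] insert.prems(1) by auto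
  show ?case
  proof (cases "fst d = 0")
    case True
    then have "d = 0" using dv by (simp add: zero_prod_def)
    then have "v \<in> J" using insert.IH insert.prems(1) d(4) by simp
    then show ?thesis by simp
  next
    case False
    have "fst d *\<^sub>R v = fst d *\<^sub>R j" using dv(1) dj by (metis scaleR_Pair snd_conv)
    then show ?thesis using False by simp
  qed
qed

text \<open>An affine dependence among extreme points, with its negative terms moved to the other
  side, is an equality of two sums over disjoint sets of rays. A ray from one side lies below the
  sum on the other, so it would have to occur there too.\<close>

proposition homothetic_sections_imp_simplex:
  fixes K :: "'a::euclidean_space set"
  assumes K: "compact K" "convex K" "0 < measure lebesgue K" and H: "homothetic_sections K"
  shows "\<exists>m. m simplex K"
proof -
  define E where "E = {x. x extreme_point_of K}"
  have "\<not> affine_dependent E"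
  proof
    assume "affine_dependent E"
    then obtain T u where T: "finite T" "T \<subseteq> E" "sum u T = 0" "\<exists>v\<in>T. u v \<noteq> 0" "(\<Sum>v\<in>T. u v *\<^sub>R v) = 0"
      unfolding affine_dependent_explicit by blast
    have "\<exists>v\<in>T. 0 < u v"
    proof (rule ccontr)
      assume "\<not> ?thesis"
      then have "\<forall>v\<in>T. u v = 0"
        using T(1,3) sum_nonneg_eq_0_iff[of T "\<lambda>v. - u v"] by (force simp: sum_negf not_less)
      then show False using T(4) by blast
    qed
    then obtain v where v: "v \<in> T" "0 < u v" by blast
    define I where "I = {w \<in> T. 0 < u w}"
    define J where "J = {w \<in> T. u w < 0}"
    have ext: "w extreme_point_of K" if "w \<in> T" for w using that T(2) by (auto simp: E_def)
    then have TK: "w \<in> K" if "w \<in> T" for w using that by (auto simp: extreme_point_of_def)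
    have ne: "K \<noteq> {}" using v TK by auto
    have "(\<Sum>w\<in>T. u w *\<^sub>R (1::real, w)) = 0"
      using T(3,5) by (simp add: prod_eq_iff fst_sum snd_sum)
    moreover have "(\<Sum>w\<in>T. u w *\<^sub>R (1::real, w)) = (\<Sum>w\<in>I. u w *\<^sub>R (1, w)) + (\<Sum>w\<in>J. u w *\<^sub>R (1, w))"
    proof -
      have "(\<Sum>w\<in>T. u w *\<^sub>R (1::real, w)) = (\<Sum>w\<in>I \<union> J. u w *\<^sub>R (1, w))"
        using T(1) by (intro sum.mono_neutral_right) (auto simp: I_def J_def zero_prod_def)
      also have "\<dots> = (\<Sum>w\<in>I. u w *\<^sub>R (1, w)) + (\<Sum>w\<in>J. u w *\<^sub>R (1, w))"
        using T(1) by (intro sum.union_disjoint) (auto simp: I_def J_def)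
      finally show ?thesis .
    qed
    ultimately have IJ: "(\<Sum>w\<in>I. u w *\<^sub>R (1::real, w)) = (\<Sum>w\<in>J. (- u w) *\<^sub>R (1, w))"
      by (simp add: sum_negf eq_neg_iff_add_eq_0 del: scaleR_Pair)
    have "v \<in> J"
    proof (rule extreme_ray_below_sum[OF K H ext[OF v(1)] v(2), of J "\<lambda>w. - u w"])
      show "finite J" using T(1) by (simp add: J_def)
      show "j extreme_point_of K \<and> 0 \<le> - u j" if "j \<in> J" for j using that ext by (auto simp: J_def)
      have "(\<Sum>w\<in>J. (- u w) *\<^sub>R (1::real, w)) - u v *\<^sub>R (1, v) = (\<Sum>w\<in>I - {v}. u w *\<^sub>R (1, w))"
        unfolding IJ[symmetric] using v T(1) by (subst sum.remove[of I v]) (auto simp: I_def)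
      also have "\<dots> \<in> body_cone K"
        using TK by (intro body_cone_sum[OF K(2) ne]) (auto simp: I_def)
      finally show "(\<Sum>w\<in>J. (- u w) *\<^sub>R (1, w)) - u v *\<^sub>R (1, v) \<in> body_cone K" .
    qed
    then show False using v by (auto simp: J_def)
  qed
  moreover have "K = convex hull E" unfolding E_def by (rule Krein_Milman_Minkowski[OF K(1,2)])
  ultimately show ?thesis unfolding simplex_def by (auto intro!: exI[of _ "int (card E) - 1"] exI[of _ E])
qed

subsection \<open>Integrals over products\<close>

lemma nn_integral_power_exp:
  fixes \<alpha> :: real
  assumes "0 < \<alpha>"
  shows "(\<integral>\<^sup>+x. indicator {0..} x * ennreal (x ^ k * exp (- (\<alpha> * x))) \<partial>lborel) = ennreal (fact k / \<alpha> ^ Suc k)"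
proof -
  have "(\<integral>\<^sup>+x. indicator {0..} x * ennreal (x ^ k * exp (- (\<alpha> * x))) \<partial>lborel) =
    ennreal \<bar>1 / \<alpha>\<bar> * (\<integral>\<^sup>+x. indicator {0..} (0 + 1 / \<alpha> * x) * ennreal ((0 + 1 / \<alpha> * x) ^ k * exp (- (\<alpha> * (0 + 1 / \<alpha> * x)))) \<partial>lborel)"
    using assms by (intro nn_integral_real_affine) auto
  also have "(\<integral>\<^sup>+x. indicator {0..} (0 + 1 / \<alpha> * x) * ennreal ((0 + 1 / \<alpha> * x) ^ k * exp (- (\<alpha> * (0 + 1 / \<alpha> * x)))) \<partial>lborel) =
     (\<integral>\<^sup>+x. ennreal (1 / \<alpha> ^ k) * (ennreal (x ^ k * exp (- x)) * indicator {0..} x) \<partial>lborel)"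
    using assms by (intro nn_integral_cong)
      (auto simp: indicator_def zero_le_divide_iff power_divide ennreal_mult'[symmetric])
  also have "\<dots> = ennreal (1 / \<alpha> ^ k) * ennreal (fact k)"
    by (subst nn_integral_cmult) (auto simp: nn_intergal_power_times_exp_Ici)
  finally show ?thesis using assms by (simp add: ennreal_mult'[symmetric] mult.commute)
qed

lemma nn_integral_lborel_vec_prod:
  fixes f :: "'l::finite \<Rightarrow> real \<Rightarrow> ennreal"
  assumes [measurable]: "\<And>l. f l \<in> borel_measurable borel"
  shows "(\<integral>\<^sup>+s. (\<Prod>l\<in>UNIV. f l (s $ l)) \<partial>(lborel :: (real^'l) measure)) = (\<Prod>l\<in>UNIV. \<integral>\<^sup>+x. f l x \<partial>lborel)"
proof -
  have B: "(Basis :: (real^'l) set) = range (\<lambda>l. axis l 1)" by (auto simp: Basis_vec_def)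
  have inj: "inj (\<lambda>l::'l. axis l (1::real))" by (auto simp: inj_def axis_eq_axis)
  define g where "g b = f (THE l. b = axis l (1::real))" for b :: "real^'l"
  have g: "g (axis l 1) = f l" for l by (simp add: g_def axis_eq_axis)
  have "(\<integral>\<^sup>+s. (\<Prod>b\<in>Basis. g b (s \<bullet> b)) \<partial>(lborel :: (real^'l) measure)) = (\<Prod>b\<in>Basis. \<integral>\<^sup>+x. g b x \<partial>lborel)"
    by (rule nn_integral_lborel_prod) (auto simp: g_def)
  then show ?thesis
    unfolding B by (simp add: prod.reindex[OF inj] o_def g inner_axis)
qed

text \<open>A blockwise product formula, with vectors as factors: the scalar coordinates
  \<open>axis i e\<close> of a box are grouped by the block \<open>i\<close>.\<close>

lemma distr_PiM_lborel_vec: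
  "distr (Pi\<^sub>M (UNIV :: 'p::finite set) (\<lambda>_. lborel)) borel (\<lambda>f. \<chi> i. f i) = (lborel :: ('a::euclidean_space^'p) measure)"
proof (rule lborel_eqI[symmetric])
  interpret product_sigma_finite "\<lambda>_::'p. lborel :: 'a measure" by standard
  fix l u :: "'a^'p" assume le: "\<And>b. b \<in> Basis \<Longrightarrow> l \<bullet> b \<le> u \<bullet> b"
  have meas: "(\<lambda>f. \<chi> i. f i) \<in> borel_measurable (Pi\<^sub>M (UNIV :: 'p set) (\<lambda>_. lborel :: 'a measure))"
    by (subst borel_measurable_euclidean_space) (auto simp: Basis_vec_def inner_axis)
  have Basis: "(Basis :: ('a^'p) set) = (\<lambda>(i, e). axis i e) ` (UNIV \<times> Basis)" by (auto simp: Basis_vec_def)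
  have inj: "inj_on (\<lambda>(i, e). axis i e) ((UNIV :: 'p set) \<times> (Basis :: 'a set))"
    by (auto simp: inj_on_def axis_eq_axis)
  have le': "l $ i \<bullet> e \<le> u $ i \<bullet> e" if "e \<in> Basis" for i e
    using le[of "axis i e"] that by (simp add: inner_axis axis_in_Basis_iff)
  have "emeasure (distr (Pi\<^sub>M (UNIV :: 'p set) (\<lambda>_. lborel)) borel (\<lambda>f. \<chi> i. f i)) (box l u) =
    emeasure (Pi\<^sub>M (UNIV :: 'p set) (\<lambda>_. lborel)) (\<Pi>\<^sub>E i\<in>UNIV. box (l $ i) (u $ i))"
  proof -
    have "(\<lambda>f. \<chi> i. f i) -` box l u = (\<Pi>\<^sub>E i\<in>UNIV. box (l $ i) (u $ i))"
      by (auto simp: mem_box Basis_vec_def inner_axis PiE_iff)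
    then show ?thesis using meas by (simp add: emeasure_distr space_PiM)
  qed
  also have "\<dots> = (\<Prod>i\<in>UNIV. emeasure lborel (box (l $ i) (u $ i)))"
    by (subst emeasure_PiM) auto
  also have "\<dots> = (\<Prod>i\<in>UNIV. ennreal (\<Prod>e\<in>Basis. (u $ i - l $ i) \<bullet> e))"
    using le' by (intro prod.cong refl emeasure_lborel_box) auto
  also have "\<dots> = ennreal (\<Prod>i\<in>UNIV. \<Prod>e\<in>Basis. (u $ i - l $ i) \<bullet> e)"
    using le' by (intro prod_ennreal prod_nonneg) (simp add: inner_diff_left)
  also have "(\<Prod>i\<in>UNIV. \<Prod>e\<in>Basis. (u $ i - l $ i) \<bullet> e) = (\<Prod>b\<in>Basis. (u - l) \<bullet> b)"
    unfolding Basis prod.reindex[OF inj] prod.cartesian_product by (simp add: inner_axis split_def)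
  finally show "emeasure (distr (Pi\<^sub>M (UNIV :: 'p set) (\<lambda>_. lborel)) borel (\<lambda>f. \<chi> i. f i)) (box l u) =
    ennreal (\<Prod>b\<in>Basis. (u - l) \<bullet> b)" .
qed simp

lemma emeasure_lborel_vec_prod:
  fixes A :: "'p::finite \<Rightarrow> 'a::euclidean_space set"
  assumes [measurable]: "\<And>i. A i \<in> sets borel"
  shows "emeasure lborel {x :: 'a^'p. \<forall>i. x $ i \<in> A i} = (\<Prod>i\<in>UNIV. emeasure lborel (A i))"
proof -
  interpret product_sigma_finite "\<lambda>_::'p. lborel :: 'a measure" by standard
  have meas: "(\<lambda>f. \<chi> i. f i) \<in> borel_measurable (Pi\<^sub>M (UNIV :: 'p set) (\<lambda>_. lborel :: 'a measure))"
    by (subst borel_measurable_euclidean_space) (auto simp: Basis_vec_def inner_axis)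
  have comp: "(\<lambda>x :: 'a^'p. x $ i) \<in> borel_measurable borel" for i
    by (intro borel_measurable_continuous_onI continuous_intros)
  have "{x :: 'a^'p. \<forall>i. x $ i \<in> A i} = (\<Inter>i. (\<lambda>x. x $ i) -` A i \<inter> space borel)" by auto
  also have "\<dots> \<in> sets borel" by (intro sets.finite_INT measurable_sets[OF comp] assms) auto
  finally have B: "{x :: 'a^'p. \<forall>i. x $ i \<in> A i} \<in> sets borel" .
  have "emeasure (lborel :: ('a^'p) measure) {x. \<forall>i. x $ i \<in> A i} =
      emeasure (Pi\<^sub>M (UNIV :: 'p set) (\<lambda>_. lborel)) (\<Pi>\<^sub>E i\<in>UNIV. A i)"
    unfolding distr_PiM_lborel_vec[symmetric] using meas B
    by (subst emeasure_distr) (auto simp: space_PiM intro!: arg_cong[where f="emeasure _"])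
  also have "\<dots> = (\<Prod>i\<in>UNIV. emeasure lborel (A i))" by (subst emeasure_PiM) auto
  finally show ?thesis .
qed

lemma nn_integral_power_Icc:
  assumes "0 < n" "0 \<le> \<rho>"
  shows "(\<integral>\<^sup>+r. indicator {0..\<rho>} r * ennreal (real n * r ^ (n - 1)) \<partial>lborel) = ennreal (\<rho> ^ n)"
proof -
  have "(\<integral>\<^sup>+r. ennreal (real n * r ^ (n - 1)) * indicator {0..\<rho>} r \<partial>lborel) = ennreal (\<rho> ^ n - 0 ^ n)"
    using assms by (intro nn_integral_FTC_Icc) (auto intro!: derivative_eq_intros)
  then show ?thesis using assms by (simp add: mult.commute)
qed

subsection \<open>Fibers over the Minkowski combinations\<close>

lemma closed_body_cone:
  fixes K :: "'a::euclidean_space set"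
  assumes "compact K"
  shows "closed (body_cone K)"
  unfolding closed_sequential_limits
proof (intro allI impI, elim conjE)
  fix z :: "nat \<Rightarrow> real \<times> 'a" and l
  assume z: "\<forall>n. z n \<in> body_cone K" and lim: "z \<longlonglongrightarrow> l"
  have s: "0 \<le> fst (z n)" "snd (z n) \<in> (*\<^sub>R) (fst (z n)) ` K" for n
    using z[rule_format, of n] by (cases "z n"; simp add: body_cone_iff)+
  then have "\<forall>n. \<exists>k. k \<in> K \<and> snd (z n) = fst (z n) *\<^sub>R k" by blast
  then obtain k where k: "\<And>n. k n \<in> K" "\<And>n. snd (z n) = fst (z n) *\<^sub>R k n" by metis
  obtain k0 r where r: "k0 \<in> K" "strict_mono r" "(k \<circ> r) \<longlonglongrightarrow> k0"
    using assms k(1) unfolding compact_def by metis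
  have zr: "(\<lambda>n. z (r n)) \<longlonglongrightarrow> l" using LIMSEQ_subseq_LIMSEQ[OF lim r(2)] by (simp add: o_def)
  have "(\<lambda>n. fst (z (r n)) *\<^sub>R k (r n)) \<longlonglongrightarrow> fst l *\<^sub>R k0"
    using r(3) by (intro tendsto_scaleR tendsto_fst[OF zr]) (simp add: o_def)
  then have "snd l = fst l *\<^sub>R k0"
    using LIMSEQ_unique[OF tendsto_snd[OF zr]] by (simp add: k(2))
  moreover have "0 \<le> fst l" using LIMSEQ_le_const[OF tendsto_fst[OF lim]] s(1) by blast
  ultimately show "l \<in> body_cone K" using r(1) by (cases l) (auto simp: body_cone_iff)
qed

text \<open>
  The fiber over \<open>(s, x)\<close> is \<open>s\<^sub>0K \<inter> \<Inter>\<^sub>i (s\<^sub>iK - x\<^sub>i)\<close> if \<open>s \<ge> 0\<close>, and empty otherwise.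
\<close>

definition fiber :: "(real^'n) set \<Rightarrow> (real^('p::finite option)) \<times> (real^'n^'p) \<Rightarrow> (real^'n) set" where
  "fiber K z = {y. (fst z $ None, y) \<in> body_cone K \<and> (\<forall>i. (fst z $ Some i, y + snd z $ i) \<in> body_cone K)}"

definition fiber_cone :: "(real^'n) set \<Rightarrow> ((real^('p::finite option)) \<times> (real^'n^'p)) set" where
  "fiber_cone K = {z. fiber K z \<noteq> {}}"

text \<open>Superadditivity of fibers drives both halves of the proof: adding a multiple of the
  diagonal direction produces the inscribed homothet, and adding an arbitrary vector of the cone
  gives the stability behind the equality case.\<close>

lemma fiber_add:
  assumes "convex K" "y \<in> fiber K z" "y' \<in> fiber K z'"
  shows "y + y' \<in> fiber K (z + z')"
proof -
  have "(fst z $ None, y) + (fst z' $ None, y') \<in> body_cone K"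
    using assms by (intro body_cone_add) (auto simp: fiber_def)
  moreover have "(fst z $ Some i, y + snd z $ i) + (fst z' $ Some i, y' + snd z' $ i) \<in> body_cone K" for i
    using assms by (intro body_cone_add) (auto simp: fiber_def)
  ultimately show ?thesis by (simp add: fiber_def algebra_simps)
qed

lemma fiber_diagonal:
  assumes "k \<in> K" "0 \<le> r"
  shows "r *\<^sub>R k \<in> fiber K (r *\<^sub>R (vec 1, 0))"
  using assms by (auto simp add: fiber_def body_cone_iff)

lemma fiber_homothet:
  assumes "convex K" "0 \<le> r" "y \<in> fiber K (z - r *\<^sub>R (vec 1, 0))"
  shows "(\<lambda>k. y + r *\<^sub>R k) ` K \<subseteq> fiber K z"
  using fiber_add[OF assms(1,3) fiber_diagonal[OF _ assms(2)]] by fastforce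

lemma fiber_cone_nonneg: "z \<in> fiber_cone K \<Longrightarrow> 0 \<le> fst z $ l"
  by (cases l) (auto simp: fiber_cone_def fiber_def body_cone_iff)

lemma fiber_cone_add:
  "convex K \<Longrightarrow> z \<in> fiber_cone K \<Longrightarrow> z' \<in> fiber_cone K \<Longrightarrow> z + z' \<in> fiber_cone K"
  unfolding fiber_cone_def using fiber_add by blast

lemma fiber_cone_diagonal: "K \<noteq> {} \<Longrightarrow> 0 \<le> r \<Longrightarrow> r *\<^sub>R (vec 1, 0) \<in> fiber_cone K"
  using fiber_diagonal by (fastforce simp: fiber_cone_def simp del: scaleR_Pair)

lemma convex_body_cone:
  assumes "convex K"
  shows "convex (body_cone K)"
proof (rule convexI)
  fix x y u v assume "x \<in> body_cone K" "y \<in> body_cone K" "0 \<le> u" "0 \<le> v" "u + v = (1::real)"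
  then show "u *\<^sub>R x + v *\<^sub>R y \<in> body_cone K" by (intro body_cone_add[OF assms] body_cone_scaleR)
qed

lemma convex_fiber:
  fixes K :: "(real^'n) set"
  assumes "convex K"
  shows "convex (fiber K z)"
proof (rule convexI)
  fix x y u v assume xy: "x \<in> fiber K z" "y \<in> fiber K z" "0 \<le> u" "0 \<le> v" "u + v = (1::real)"
  have comb: "u *\<^sub>R (a, x + c) + v *\<^sub>R (a, y + c) = (a, u *\<^sub>R x + v *\<^sub>R y + c)" for a :: real and c :: "real^'n"
  proof -
    have "u * a + v * a = a" "u *\<^sub>R c + v *\<^sub>R c = c"
      using xy(5) by (metis distrib_right mult_1, metis scaleR_add_left scaleR_one)
    then show ?thesis by (simp add: scaleR_add_right algebra_simps)
  qed
  have "u *\<^sub>R (a, x + c) + v *\<^sub>R (a, y + c) \<in> body_cone K"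
    if "(a, x + c) \<in> body_cone K" "(a, y + c) \<in> body_cone K" for a c
    using convexD[OF convex_body_cone[OF assms] that xy(3-5)] .
  then have "(a, u *\<^sub>R x + v *\<^sub>R y + c) \<in> body_cone K"
    if "(a, x + c) \<in> body_cone K" "(a, y + c) \<in> body_cone K" for a c
    using that unfolding comb by blast
  from this[of "fst z $ None" 0] this show "u *\<^sub>R x + v *\<^sub>R y \<in> fiber K z"
    using xy(1,2) by (simp add: fiber_def)
qed

lemma closed_fiber_graph:
  fixes K :: "(real^'n) set"
  assumes "compact K"
  shows "closed {(z :: (real^('p::finite option)) \<times> (real^'n^'p), y). y \<in> fiber K z}"
proof -
  have "{(z :: (real^('p option)) \<times> (real^'n^'p), y). y \<in> fiber K z} = (\<lambda>(z, y). (fst z $ None, y)) -` body_cone K \<inter>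
      (\<Inter>i. (\<lambda>(z, y). (fst z $ Some i, y + snd z $ i)) -` body_cone K)"
    by (auto simp: fiber_def)
  moreover have "closed \<dots>"
    unfolding split_beta
    by (intro closed_Int closed_INT ballI closed_vimage closed_body_cone assms continuous_intros)
  ultimately show ?thesis by simp
qed

lemma compact_fiber:
  assumes "compact K"
  shows "compact (fiber K z)"
proof -
  have "fiber K z = (*\<^sub>R) (fst z $ None) ` K \<inter> (\<lambda>y. (z, y)) -` {(z, y). y \<in> fiber K z}"
    by (auto simp: fiber_def body_cone_iff)
  moreover have "closed ((\<lambda>y. (z, y)) -` {(z, y). y \<in> fiber K z})"
    by (intro closed_vimage closed_fiber_graph assms continuous_intros)
  ultimately show ?thesis using compact_Int_closed[OF compact_scaling[OF assms]] by metis
qed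

lemma closed_fiber_cone:
  fixes K :: "(real^'n) set"
  assumes "compact K"
  shows "closed (fiber_cone K :: ((real^('p::finite option)) \<times> (real^'n^'p)) set)"
  unfolding closed_sequential_limits
proof (intro allI impI, elim conjE)
  fix z :: "nat \<Rightarrow> (real^('p option)) \<times> (real^'n^'p)" and l
  assume z: "\<forall>n. z n \<in> fiber_cone K" and lim: "z \<longlonglongrightarrow> l"
  then have "\<forall>n. \<exists>y. y \<in> fiber K (z n)" by (auto simp: fiber_cone_def)
  then obtain y where y: "\<And>n. y n \<in> fiber K (z n)" by metis
  then have "\<forall>n. \<exists>k. k \<in> K \<and> y n = (fst (z n) $ None) *\<^sub>R k" by (auto simp: fiber_def body_cone_iff)
  then obtain k where k: "\<And>n. k n \<in> K" "\<And>n. y n = (fst (z n) $ None) *\<^sub>R k n" by metis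
  obtain k0 r where r: "k0 \<in> K" "strict_mono r" "(k \<circ> r) \<longlonglongrightarrow> k0"
    using assms k(1) unfolding compact_def by metis
  have zr: "(\<lambda>n. z (r n)) \<longlonglongrightarrow> l" using LIMSEQ_subseq_LIMSEQ[OF lim r(2)] by (simp add: o_def)
  have "(\<lambda>n. y (r n)) \<longlonglongrightarrow> (fst l $ None) *\<^sub>R k0"
    unfolding k(2) using r(3) by (intro tendsto_scaleR tendsto_vec_nth tendsto_fst[OF zr]) (simp add: o_def)
  then have "(\<lambda>n. (z (r n), y (r n))) \<longlonglongrightarrow> (l, (fst l $ None) *\<^sub>R k0)"
    by (intro tendsto_Pair zr)
  moreover have "(z (r n), y (r n)) \<in> {(z, y). y \<in> fiber K z}" for n using y by simp
  ultimately have "(l, (fst l $ None) *\<^sub>R k0) \<in> {(z, y). y \<in> fiber K z}"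
    by (rule closed_sequentially[OF closed_fiber_graph[OF assms], rotated])
  then show "l \<in> fiber_cone K" by (auto simp: fiber_cone_def)
qed

definition combined_bodies :: "(real^'n) set \<Rightarrow> 'p::finite option \<Rightarrow> (real^'n^'p) set" where
  "combined_bodies K l = (case l of None \<Rightarrow> (\<lambda>x. - diag_embed x) ` K | Some i \<Rightarrow> factor_embed i ` K)"

lemma convex_body_combined_bodies:
  fixes K :: "(real^'n) set"
  assumes "convex_body K"
  shows "convex_body (combined_bodies K (l :: 'p::finite option))"
proof -
  have "linear (\<lambda>x. - diag_embed x :: real^'n^'p)" "linear (factor_embed i :: real^'n \<Rightarrow> real^'n^'p)" for i
    by (auto intro!: linearI simp: diag_embed_def factor_embed_def vec_eq_iff axis_def)
  then have lin: "linear (case l of None \<Rightarrow> \<lambda>x. - diag_embed x :: real^'n^'p | Some i \<Rightarrow> factor_embed i)"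
    by (cases l) auto
  have eq: "combined_bodies K l = (case l of None \<Rightarrow> \<lambda>x. - diag_embed x :: real^'n^'p | Some i \<Rightarrow> factor_embed i) ` K"
    by (cases l) (auto simp: combined_bodies_def)
  show ?thesis unfolding convex_body_def eq
    using assms lin 
    by (auto simp: convex_body_def linear_conv_bounded_linear
        intro!: convex_linear_image compact_continuous_image linear_continuous_on)
qed

text \<open>In a representation of \<open>x\<close>, the contribution of the diagonal body is
  \<open>- diag_embed y\<close> with \<open>y\<close> in the dilate of \<open>K\<close> by
  \<open>s $ None\<close>, and each \<open>y + x $ i\<close> lies in the dilate by
  \<open>s $ Some i\<close>. The fiber consists of all possible \<open>y\<close>.\<close>

lemma minkowski_sum_combined_bodies:
  fixes K :: "(real^'n) set" and s :: "real^('p::finite option)"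
  assumes s: "\<And>l. 0 \<le> s $ l"
  shows "(minkowski (($) s) (combined_bodies K)) = {x :: real^'n^'p. (s, x) \<in> fiber_cone K}"
proof (intro equalityI subsetI)
  have sum: "(\<Sum>l\<in>UNIV. v l) = v None + (\<Sum>i\<in>UNIV. v (Some i))" for v :: "'p option \<Rightarrow> real^'n^'p"
    by (simp add: UNIV_option_conv sum.reindex)
  have sum_axis: "(\<Sum>i\<in>UNIV. s $ Some i *\<^sub>R factor_embed i (k i)) $ i = s $ Some i *\<^sub>R k i"
    for k :: "'p \<Rightarrow> real^'n" and i
    by (simp add: factor_embed_def axis_def if_distrib[of "(*\<^sub>R) _"] cong: if_cong)
  {
    fix x :: "real^'n^'p" assume "x \<in> (minkowski (($) s) (combined_bodies K))"
    then obtain v where v: "\<And>l. v l \<in> (*\<^sub>R) (s $ l) ` combined_bodies K l" "x = (\<Sum>l\<in>UNIV. v l)"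
      by (auto simp: set_sum_alt)
    obtain k0 where k0: "k0 \<in> K" "v None = s $ None *\<^sub>R (- diag_embed k0)"
      using v(1)[of None] by (auto simp: combined_bodies_def)
    have "\<exists>k. k \<in> K \<and> v (Some i) = s $ Some i *\<^sub>R factor_embed i k" for i
      using v(1)[of "Some i"] by (auto simp: combined_bodies_def)
    then obtain k where k: "\<And>i. k i \<in> K" "\<And>i. v (Some i) = s $ Some i *\<^sub>R factor_embed i (k i)" by metis
    have "x $ i = s $ Some i *\<^sub>R k i - s $ None *\<^sub>R k0" for i
      unfolding v(2) sum k0(2) k(2) vector_add_component sum_axis by (simp add: diag_embed_def)
    then have "s $ None *\<^sub>R k0 \<in> fiber K (s, x)"
      using s k0(1) k(1) by (auto simp: fiber_def body_cone_iff)
    then show "x \<in> {x. (s, x) \<in> fiber_cone K}" by (auto simp: fiber_cone_def)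
  }
  {
    fix x :: "real^'n^'p" assume "x \<in> {x. (s, x) \<in> fiber_cone K}"
    then obtain y where y: "y \<in> fiber K (s, x)" by (auto simp: fiber_cone_def)
    then obtain k0 where k0: "k0 \<in> K" "y = s $ None *\<^sub>R k0" by (auto simp: fiber_def body_cone_iff)
    have "\<exists>k. k \<in> K \<and> y + x $ i = s $ Some i *\<^sub>R k" for i using y by (auto simp: fiber_def body_cone_iff)
    then obtain k where k: "\<And>i. k i \<in> K" "\<And>i. y + x $ i = s $ Some i *\<^sub>R k i" by metis
    define v where "v l = s $ l *\<^sub>R (case l of None \<Rightarrow> - diag_embed k0 | Some i \<Rightarrow> factor_embed i (k i))" for l
    have "v l \<in> (*\<^sub>R) (s $ l) ` combined_bodies K l" for l
      using k0 k by (cases l) (auto simp: v_def combined_bodies_def simp del: scaleR_minus_right)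
    moreover have "x = (\<Sum>l\<in>UNIV. v l)"
    proof (subst vec_eq_iff, intro allI)
      fix i
      have "x $ i = s $ Some i *\<^sub>R k i - y" using k(2)[of i] by (simp add: algebra_simps)
      also have "\<dots> = (\<Sum>l\<in>UNIV. v l) $ i"
        unfolding sum vector_add_component by (simp add: v_def sum_axis k0 diag_embed_def del: sum_component)
      finally show "x $ i = (\<Sum>l\<in>UNIV. v l) $ i" .
    qed
    ultimately show "x \<in> (minkowski (($) s) (combined_bodies K))" by (auto simp: set_sum_alt)
  }
qed

subsection \<open>Laplace integrals\<close>

definition laplace_weight :: "('p::finite option \<Rightarrow> real) \<Rightarrow> (real^('p option)) \<times> (real^'n^'p) \<Rightarrow> ennreal" where
  "laplace_weight \<alpha> z = ennreal (exp (- (\<Sum>l\<in>UNIV. \<alpha> l * fst z $ l)))"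

lemma laplace_weight_measurable [measurable]: "laplace_weight \<alpha> \<in> borel_measurable borel"
  unfolding laplace_weight_def
  by (intro measurable_compose[OF _ measurable_ennreal] borel_measurable_continuous_onI continuous_intros)

lemma nn_integral_lborel_pair:
  fixes f :: "'a::euclidean_space \<times> 'b::euclidean_space \<Rightarrow> ennreal"
  assumes "f \<in> borel_measurable borel"
  shows "(\<integral>\<^sup>+z. f z \<partial>lborel) = (\<integral>\<^sup>+s. \<integral>\<^sup>+x. f (s, x) \<partial>lborel \<partial>lborel)"
proof -
  have "f \<in> borel_measurable (lborel \<Otimes>\<^sub>M lborel)" using assms by (simp add: lborel_prod)
  from lborel.nn_integral_fst[OF this] show ?thesis by (simp add: lborel_prod)
qed

lemma emeasure_lborel_compact:
  fixes A :: "'a::euclidean_space set"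
  assumes "compact A"
  shows "emeasure lborel A = ennreal (measure lebesgue A)"
proof -
  have "emeasure lborel A \<noteq> top" using emeasure_compact_finite[OF assms] by simp
  then have "emeasure lborel A = ennreal (measure lborel A)" by (rule emeasure_eq_ennreal_measure)
  then show ?thesis using borel_compact[OF assms] by (simp add: measure_completion)
qed

lemma laplace_weight_factor:
  "laplace_weight \<alpha> (s, x) = (\<Prod>l\<in>UNIV. ennreal (exp (- (\<alpha> l * s $ l))))"
proof -
  have "exp (- (\<Sum>l\<in>UNIV. \<alpha> l * s $ l)) = (\<Prod>l\<in>UNIV. exp (- (\<alpha> l * s $ l)))"
    by (simp add: exp_sum flip: sum_negf)
  then show ?thesis by (simp add: laplace_weight_def prod_ennreal)
qed

lemma orthant_indicator:
  "(\<Prod>l\<in>UNIV. indicator {0..} (s $ l) * f l :: ennreal) = (if \<forall>l. 0 \<le> s $ l then (\<Prod>l\<in>UNIV. f l) else 0)"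
  for s :: "real^'l::finite"
proof (cases "\<forall>l. 0 \<le> s $ l")
  case False
  then obtain l where "\<not> 0 \<le> s $ l" by blast
  then show ?thesis using False 
    by (subst if_not_P[OF False], intro prod_zero) (auto simp: indicator_def intro!: bexI[of _ l])
qed simp

lemma nn_integral_orthant_monomial:
  fixes \<alpha> :: "'l::finite \<Rightarrow> real"
  assumes "\<And>l. 0 < \<alpha> l"
  shows "(\<integral>\<^sup>+s. (\<Prod>l\<in>UNIV. indicator {0..} (s $ l) * ennreal (s $ l ^ k l * exp (- (\<alpha> l * s $ l)))) \<partial>(lborel :: (real^'l) measure)) =
    ennreal (\<Prod>l\<in>UNIV. fact (k l) / \<alpha> l ^ Suc (k l))"
proof -
  have "(\<integral>\<^sup>+s. (\<Prod>l\<in>UNIV. indicator {0..} (s $ l) * ennreal (s $ l ^ k l * exp (- (\<alpha> l * s $ l)))) \<partial>(lborel :: (real^'l) measure)) =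
    (\<Prod>l\<in>UNIV. \<integral>\<^sup>+x. indicator {0..} x * ennreal (x ^ k l * exp (- (\<alpha> l * x))) \<partial>lborel)"
    by (rule nn_integral_lborel_vec_prod) measurable
  also have "\<dots> = (\<Prod>l\<in>UNIV. ennreal (fact (k l) / \<alpha> l ^ Suc (k l)))"
    using assms by (simp add: nn_integral_power_exp del: power_Suc)
  also have "\<dots> = ennreal (\<Prod>l\<in>UNIV. fact (k l) / \<alpha> l ^ Suc (k l))"
    using assms by (intro prod_ennreal) (simp add: less_imp_le)
  finally show ?thesis .
qed

lemma fiber_cone_borel [measurable]: "compact K \<Longrightarrow> fiber_cone K \<in> sets borel"
  by (intro borel_closed closed_fiber_cone)

lemma laplace_fiber_cone:
  fixes K :: "(real^'n) set" and \<alpha> :: "'p::finite option \<Rightarrow> real"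
  assumes K: "convex_body K" and \<alpha>: "\<And>l. 0 < \<alpha> l" and a: "\<And>k. 0 \<le> a k" and J: "finite J"
    and vol: "\<And>s. (\<And>l. 0 \<le> s l) \<Longrightarrow>
      measure lebesgue (minkowski s (combined_bodies K) :: (real^'n^'p) set) = (\<Sum>k\<in>J. a k * (\<Prod>l\<in>UNIV. s l ^ k l))"
  shows "(\<integral>\<^sup>+z. laplace_weight \<alpha> z * indicator (fiber_cone K) z \<partial>lborel) =
    ennreal (\<Sum>k\<in>J. a k * (\<Prod>l\<in>UNIV. fact (k l) / \<alpha> l ^ Suc (k l)))"
proof -
  have cK: "compact K" using K by (simp add: convex_body_def)
  note fiber_cone_borel[OF cK, measurable]
  have inner: "(\<integral>\<^sup>+x. laplace_weight \<alpha> (s, x) * indicator (fiber_cone K) (s, x) \<partial>lborel) =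
      (\<Sum>k\<in>J. ennreal (a k) * (\<Prod>l\<in>UNIV. indicator {0..} (s $ l) * ennreal (s $ l ^ k l * exp (- (\<alpha> l * s $ l)))))" for s
  proof (cases "\<forall>l. 0 \<le> s $ l")
    case False
    then have "(s, x) \<notin> fiber_cone K" for x :: "real^'n^'p" using fiber_cone_nonneg[of "(s, x)"] by auto
    then show ?thesis unfolding orthant_indicator if_not_P[OF False] by simp
  next
    case True
    have set: "{x :: real^'n^'p. (s, x) \<in> fiber_cone K} = (minkowski (($) s) (combined_bodies K))"
      using True by (intro minkowski_sum_combined_bodies[symmetric]) auto
    have comp: "compact {x :: real^'n^'p. (s, x) \<in> fiber_cone K}"
      unfolding set using convex_body_combined_bodies[OF K]
      by (intro compact_minkowski_combination) (auto simp: convex_body_def)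
    have "(\<integral>\<^sup>+x. laplace_weight \<alpha> (s, x) * indicator (fiber_cone K) (s, x) \<partial>lborel) =
      (\<integral>\<^sup>+x. (\<Prod>l\<in>UNIV. ennreal (exp (- (\<alpha> l * s $ l)))) * indicator {x. (s, x) \<in> fiber_cone K} x \<partial>(lborel :: (real^'n^'p) measure))"
      by (simp add: laplace_weight_factor indicator_def)
    also have "\<dots> = (\<Prod>l\<in>UNIV. ennreal (exp (- (\<alpha> l * s $ l)))) * emeasure lborel {x :: real^'n^'p. (s, x) \<in> fiber_cone K}"
      using borel_compact[OF comp] by (subst nn_integral_cmult_indicator) auto
    also have "emeasure lborel {x :: real^'n^'p. (s, x) \<in> fiber_cone K} = ennreal (\<Sum>k\<in>J. a k * (\<Prod>l\<in>UNIV. s $ l ^ k l))"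
      unfolding emeasure_lborel_compact[OF comp] unfolding set using True by (subst vol) auto
    also have "\<dots> = (\<Sum>k\<in>J. ennreal (a k) * (\<Prod>l\<in>UNIV. ennreal (s $ l ^ k l)))"
      using a True by (subst sum_ennreal[symmetric])
        (auto intro!: mult_nonneg_nonneg prod_nonneg sum.cong simp: ennreal_mult' prod_ennreal)
    also have "(\<Prod>l\<in>UNIV. ennreal (exp (- (\<alpha> l * s $ l)))) * \<dots> =
      (\<Sum>k\<in>J. ennreal (a k) * (\<Prod>l\<in>UNIV. ennreal (s $ l ^ k l * exp (- (\<alpha> l * s $ l)))))"
      using True by (simp add: sum_distrib_left ennreal_mult'' prod.distrib mult_ac)
    finally show ?thesis unfolding orthant_indicator if_P[OF True] .
  qed
  have "(\<integral>\<^sup>+z. laplace_weight \<alpha> z * indicator (fiber_cone K) z \<partial>lborel) =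
     (\<integral>\<^sup>+s. \<integral>\<^sup>+x. laplace_weight \<alpha> (s, x) * indicator (fiber_cone K) (s, x) \<partial>lborel \<partial>lborel)"
    by (rule nn_integral_lborel_pair) measurable
  also have "\<dots> = (\<Sum>k\<in>J. \<integral>\<^sup>+s. ennreal (a k) * (\<Prod>l\<in>UNIV. indicator {0..} (s $ l) * ennreal (s $ l ^ k l * exp (- (\<alpha> l * s $ l))))
       \<partial>(lborel :: (real^('p option)) measure))"
    unfolding inner by (rule nn_integral_sum) measurable
  also have "\<dots> = (\<Sum>k\<in>J. ennreal (a k) * ennreal (\<Prod>l\<in>UNIV. fact (k l) / \<alpha> l ^ Suc (k l)))"
    by (intro sum.cong refl, subst nn_integral_cmult) (measurable, simp only: nn_integral_orthant_monomial[OF \<alpha>])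
  also have "\<dots> = ennreal (\<Sum>k\<in>J. a k * (\<Prod>l\<in>UNIV. fact (k l) / \<alpha> l ^ Suc (k l)))"
    using a \<alpha> by (subst sum_ennreal[symmetric])
      (auto intro!: mult_nonneg_nonneg prod_nonneg sum.cong divide_nonneg_pos simp: ennreal_mult' less_imp_le)
  finally show ?thesis .
qed

lemma fiber_measurable:
  fixes K :: "(real^'n) set"
  assumes "compact K"
  shows "(\<lambda>z :: (real^('p::finite option)) \<times> (real^'n^'p). emeasure lborel (fiber K z)) \<in> borel_measurable borel"
proof -
  have "{(z :: (real^('p option)) \<times> (real^'n^'p), y). y \<in> fiber K z} \<in> sets (borel \<Otimes>\<^sub>M borel)"
    by (subst borel_prod) (rule borel_closed[OF closed_fiber_graph[OF assms]])
  then have "{(z :: (real^('p option)) \<times> (real^'n^'p), y). y \<in> fiber K z} \<in> sets (borel \<Otimes>\<^sub>M lborel)"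
    by (simp cong: sets_pair_measure_cong)
  from lborel.measurable_emeasure_Pair[OF this] show ?thesis by (simp add: vimage_def)
qed

lemma emeasure_lborel_scaleR:
  fixes K :: "'a::euclidean_space set"
  assumes "compact K" "0 \<le> r"
  shows "emeasure lborel ((*\<^sub>R) r ` K) = ennreal (r ^ DIM('a) * measure lebesgue K)"
  using emeasure_lborel_compact[OF compact_scaling[OF assms(1)], of r] measure_homothet[OF assms(2), of 0 K] by simp

text \<open>With \<open>x\<close> integrated first, the conditions decouple: for fixed
  \<open>y\<close> each block \<open>x $ i\<close> ranges over a translate of a dilate of
  \<open>K\<close>, whose volume does not depend on \<open>y\<close>.\<close>

lemma nn_integral_fiber:
  fixes K :: "(real^'n) set" and s :: "real^('p::finite option)"
  assumes K: "compact K" and s: "\<And>l. 0 \<le> s $ l"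
  shows "(\<integral>\<^sup>+x. emeasure lborel (fiber K (s, x)) \<partial>lborel) =
    ennreal (measure lebesgue K ^ Suc CARD('p) * (\<Prod>l\<in>UNIV. s $ l ^ CARD('n)))"
proof -
  let ?A = "\<lambda>l. (*\<^sub>R) (s $ l) ` K"
  have A: "compact (?A l)" for l using K by (rule compact_scaling)
  have graph: "{(x :: real^'n^'p, y). y \<in> fiber K (s, x)} \<in> sets borel"
  proof -
    have "{(x :: real^'n^'p, y). y \<in> fiber K (s, x)} = (\<lambda>(x, y). ((s, x), y)) -` {(z, y). y \<in> fiber K z}" by auto
    moreover have "closed \<dots>" unfolding split_beta by (intro closed_vimage closed_fiber_graph[OF K, unfolded split_beta] continuous_intros)
    ultimately show ?thesis by (metis borel_closed)
  qed
  have meas: "(\<lambda>(x :: real^'n^'p, y). indicator (fiber K (s, x)) y :: ennreal) \<in> borel_measurable (lborel \<Otimes>\<^sub>M lborel)"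
  proof -
    have "(\<lambda>(x :: real^'n^'p, y). indicator (fiber K (s, x)) y :: ennreal) = indicator {(x, y). y \<in> fiber K (s, x)}"
      by (auto simp: indicator_def fun_eq_iff)
    then show ?thesis using borel_measurable_indicator[OF graph] by (simp add: lborel_prod)
  qed
  have fib: "fiber K (s, x) = {y. y \<in> ?A None \<and> (\<forall>i. y + x $ i \<in> ?A (Some i))}" for x
    using s by (auto simp: fiber_def body_cone_iff)
  have "(\<integral>\<^sup>+x. emeasure lborel (fiber K (s, x)) \<partial>lborel) =
     (\<integral>\<^sup>+x. \<integral>\<^sup>+y. indicator (fiber K (s, x)) y \<partial>lborel \<partial>lborel)"
    by (simp add: borel_compact compact_fiber[OF K])
  also have "\<dots> = (\<integral>\<^sup>+y. \<integral>\<^sup>+x. indicator (fiber K (s, x)) y \<partial>lborel \<partial>lborel)"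
    using meas by (rule lborel_pair.Fubini'[symmetric])
  also have "\<dots> = (\<integral>\<^sup>+y. (\<Prod>i\<in>UNIV. emeasure lborel (?A (Some i))) * indicator (?A None) y \<partial>lborel)"
  proof (rule nn_integral_cong)
    fix y :: "real^'n"
    have B: "(\<lambda>v. v - y) ` ?A (Some i) \<in> sets borel" for i
      using A by (intro borel_compact compact_translation_subtract)
    have "(\<integral>\<^sup>+x. indicator (fiber K (s, x)) y \<partial>lborel) =
      (\<integral>\<^sup>+x. indicator (?A None) y * indicator {x. \<forall>i. x $ i \<in> (\<lambda>v. v - y) ` ?A (Some i)} x \<partial>(lborel :: (real^'n^'p) measure))"
      by (intro nn_integral_cong) (auto simp: fib indicator_def image_iff eq_diff_eq add.commute)
    also have "\<dots> = indicator (?A None) y * emeasure lborel {x :: real^'n^'p. \<forall>i. x $ i \<in> (\<lambda>v. v - y) ` ?A (Some i)}"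
    proof (rule nn_integral_cmult_indicator)
      have "compact ((\<lambda>v. v - y) ` ?A (Some i))" for i
        using A by (intro compact_translation_subtract)
      then have "closed (\<Inter>i. (\<lambda>x :: real^'n^'p. x $ i) -` ((\<lambda>v. v - y) ` ?A (Some i)))"
        by (intro closed_INT ballI closed_vimage compact_imp_closed continuous_intros)
      moreover have "{x :: real^'n^'p. \<forall>i. x $ i \<in> (\<lambda>v. v - y) ` ?A (Some i)} = (\<Inter>i. (\<lambda>x. x $ i) -` ((\<lambda>v. v - y) ` ?A (Some i)))"
        by auto
      ultimately show "{x :: real^'n^'p. \<forall>i. x $ i \<in> (\<lambda>v. v - y) ` ?A (Some i)} \<in> sets lborel" by simp
    qed
    also have "emeasure lborel {x :: real^'n^'p. \<forall>i. x $ i \<in> (\<lambda>v. v - y) ` ?A (Some i)} =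
        (\<Prod>i\<in>UNIV. emeasure lborel ((\<lambda>v. v - y) ` ?A (Some i)))"
      by (rule emeasure_lborel_vec_prod[OF B])
    also have "\<dots> = (\<Prod>i\<in>UNIV. emeasure lborel (?A (Some i)))"
      using A by (simp add: emeasure_lborel_compact compact_translation_subtract measure_translation_subtract)
    finally show "(\<integral>\<^sup>+x. indicator (fiber K (s, x)) y \<partial>lborel) =
       (\<Prod>i\<in>UNIV. emeasure lborel (?A (Some i))) * indicator (?A None) y" by (simp add: mult.commute)
  qed
  also have "\<dots> = (\<Prod>i\<in>UNIV. emeasure lborel (?A (Some i))) * emeasure lborel (?A None)"
    using A by (intro nn_integral_cmult_indicator) (simp add: borel_compact)
  also have "\<dots> = (\<Prod>l\<in>UNIV. emeasure lborel (?A l))"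
    by (simp add: UNIV_option_conv prod.reindex mult.commute)
  also have "\<dots> = ennreal (\<Prod>l\<in>UNIV. s $ l ^ CARD('n) * measure lebesgue K)"
    using s K by (simp add: emeasure_lborel_scaleR prod_ennreal)
  also have "(\<Prod>l\<in>UNIV. s $ l ^ CARD('n) * measure lebesgue K) = measure lebesgue K ^ Suc CARD('p) * (\<Prod>l\<in>UNIV. s $ l ^ CARD('n))"
    by (simp add: prod.distrib card_UNIV_option mult.commute)
  finally show ?thesis .
qed

lemma laplace_fiber:
  fixes K :: "(real^'n) set" and \<alpha> :: "'p::finite option \<Rightarrow> real"
  assumes K: "compact K" and \<alpha>: "\<And>l. 0 < \<alpha> l"
  shows "(\<integral>\<^sup>+z. laplace_weight \<alpha> z * emeasure lborel (fiber K z) \<partial>lborel) =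
    ennreal (measure lebesgue K ^ Suc CARD('p) * (\<Prod>l\<in>UNIV. fact CARD('n) / \<alpha> l ^ Suc CARD('n)))"
proof -
  note fiber_measurable[OF K, measurable]
  let ?m = "measure lebesgue K ^ Suc CARD('p)"
  have inner: "(\<integral>\<^sup>+x. laplace_weight \<alpha> (s, x) * emeasure lborel (fiber K (s, x)) \<partial>lborel) =
    ennreal ?m * (\<Prod>l\<in>UNIV. indicator {0..} (s $ l) * ennreal (s $ l ^ CARD('n) * exp (- (\<alpha> l * s $ l))))" for s
  proof (cases "\<forall>l. 0 \<le> s $ l")
    case False
    then have "fiber K (s, x) = {}" for x :: "real^'n^'p"
      using fiber_cone_nonneg[of "(s, x)" K] by (auto simp: fiber_cone_def)
    then show ?thesis unfolding orthant_indicator if_not_P[OF False] by simp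
  next
    case True
    have "(\<integral>\<^sup>+x. laplace_weight \<alpha> (s, x) * emeasure lborel (fiber K (s, x)) \<partial>lborel) =
      (\<Prod>l\<in>UNIV. ennreal (exp (- (\<alpha> l * s $ l)))) * (\<integral>\<^sup>+x. emeasure lborel (fiber K (s, x)) \<partial>lborel)"
      unfolding laplace_weight_factor by (rule nn_integral_cmult) measurable
    also have "\<dots> = (\<Prod>l\<in>UNIV. ennreal (exp (- (\<alpha> l * s $ l)))) * ennreal (?m * (\<Prod>l\<in>UNIV. s $ l ^ CARD('n)))"
      using True by (subst nn_integral_fiber[OF K]) auto
    also have "\<dots> = ennreal ?m * (\<Prod>l\<in>UNIV. ennreal (s $ l ^ CARD('n) * exp (- (\<alpha> l * s $ l))))"
      using True by (simp add: ennreal_mult ennreal_mult'' prod.distrib prod_nonneg mult_ac flip: prod_ennreal)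
    finally show ?thesis unfolding orthant_indicator if_P[OF True] .
  qed
  have "(\<integral>\<^sup>+z. laplace_weight \<alpha> z * emeasure lborel (fiber K z) \<partial>lborel) =
     (\<integral>\<^sup>+s. \<integral>\<^sup>+x. laplace_weight \<alpha> (s, x) * emeasure lborel (fiber K (s, x)) \<partial>lborel \<partial>lborel)"
    by (rule nn_integral_lborel_pair) measurable
  also have "\<dots> = ennreal ?m * (\<integral>\<^sup>+s. (\<Prod>l\<in>UNIV. indicator {0..} (s $ l) * ennreal (s $ l ^ CARD('n) * exp (- (\<alpha> l * s $ l))))
      \<partial>(lborel :: (real^('p option)) measure))"
    unfolding inner by (rule nn_integral_cmult) measurable
  also have "\<dots> = ennreal ?m * ennreal (\<Prod>l\<in>UNIV. fact CARD('n) / \<alpha> l ^ Suc CARD('n))"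
    by (simp only: nn_integral_orthant_monomial[OF \<alpha>])
  also have "\<dots> = ennreal (?m * (\<Prod>l\<in>UNIV. fact CARD('n) / \<alpha> l ^ Suc CARD('n)))"
    by (intro ennreal_mult'[symmetric]) simp
  finally show ?thesis .
qed

text \<open>
  This is \<open>\<rho>(z)\<^sup>n\<close> (and \<open>0\<close> if \<open>z\<close> is not in the cone), written as an integral so that Fubini's theorem applies.
\<close>

definition depth_integral :: "(real^'n) set \<Rightarrow> (real^('p::finite option)) \<times> (real^'n^'p) \<Rightarrow> ennreal" where
  "depth_integral K z = (\<integral>\<^sup>+r. indicator {0..} r * ennreal (CARD('n) * r ^ (CARD('n) - 1)) *
     indicator (fiber_cone K) (z - r *\<^sub>R (vec 1, 0)) \<partial>lborel)"

lemma depth_integral_measurable: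
  fixes K :: "(real^'n) set"
  assumes K: "compact K"
  shows "(depth_integral K :: (real^('p::finite option)) \<times> (real^'n^'p) \<Rightarrow> ennreal) \<in> borel_measurable borel"
proof -
  note fiber_cone_borel[OF K, measurable]
  have "(\<lambda>z :: (real^('p option)) \<times> (real^'n^'p). \<integral>\<^sup>+r. indicator {0..} r * ennreal (CARD('n) * r ^ (CARD('n) - 1)) *
     indicator (fiber_cone K) (z - r *\<^sub>R (vec 1, 0)) \<partial>lborel) \<in> borel_measurable lborel"
    by measurable
  then show ?thesis unfolding depth_integral_def[abs_def] by simp
qed

text \<open>Shifting \<open>z\<close> by \<open>r\<close> times the diagonal direction multiplies
  the weight by \<open>exp (- (A * r))\<close>, where \<open>A\<close> is the sum of the rates. The
  integral over the cone splits off, and integrating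
  \<open>n * r ^ (n - 1) * exp (- (A * r))\<close> over the half-line gives
  \<open>fact n / A ^ n\<close>.\<close>

lemma laplace_depth:
  fixes K :: "(real^'n) set" and \<alpha> :: "'p::finite option \<Rightarrow> real"
  assumes K: "compact K" and \<alpha>: "\<And>l. 0 < \<alpha> l"
  shows "(\<integral>\<^sup>+z. laplace_weight \<alpha> z * depth_integral K z \<partial>lborel) =
    ennreal (fact CARD('n) / (\<Sum>l\<in>UNIV. \<alpha> l) ^ CARD('n)) *
    (\<integral>\<^sup>+z. laplace_weight \<alpha> z * indicator (fiber_cone K) z \<partial>lborel)"
    (is "_ = _ * ?I")
proof -
  note fiber_cone_borel[OF K, measurable]
  define n where "n = CARD('n)"
  have n: "0 < n" by (simp add: n_def)
  define A where "A = (\<Sum>l\<in>UNIV. \<alpha> l)"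
  have A: "0 < A" unfolding A_def using \<alpha> by (intro sum_pos) auto
  define g where "g r = indicator {0..} r * ennreal (n * r ^ (n - 1))" for r :: real
  have [measurable]: "g \<in> borel_measurable borel" unfolding g_def by measurable
  let ?u = "(vec 1, 0) :: (real^('p option)) \<times> (real^'n^'p)"
  have "(\<integral>\<^sup>+z. laplace_weight \<alpha> z * depth_integral K z \<partial>lborel) =
    (\<integral>\<^sup>+z. \<integral>\<^sup>+r. laplace_weight \<alpha> z * (g r * indicator (fiber_cone K) (z - r *\<^sub>R ?u)) \<partial>lborel \<partial>lborel)"
    unfolding depth_integral_def g_def n_def
    by (intro nn_integral_cong nn_integral_cmult[symmetric]) measurable
  also have "\<dots> = (\<integral>\<^sup>+r. \<integral>\<^sup>+z. laplace_weight \<alpha> z * (g r * indicator (fiber_cone K) (z - r *\<^sub>R ?u)) \<partial>lborel \<partial>lborel)"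
    by (rule lborel_pair.Fubini'[symmetric]) measurable
  also have "\<dots> = (\<integral>\<^sup>+r. (g r * ennreal (exp (- (A * r)))) * ?I \<partial>lborel)"
  proof (rule nn_integral_cong)
    fix r :: real
    have [measurable]: "(\<lambda>z. z - r *\<^sub>R ?u) \<in> borel_measurable borel"
      by (intro borel_measurable_continuous_onI continuous_intros)
    have "(\<integral>\<^sup>+z. laplace_weight \<alpha> z * (g r * indicator (fiber_cone K) (z - r *\<^sub>R ?u)) \<partial>lborel) =
      (\<integral>\<^sup>+z. laplace_weight \<alpha> (r *\<^sub>R ?u + 1 *\<^sub>R z) * (g r * indicator (fiber_cone K) (r *\<^sub>R ?u + 1 *\<^sub>R z - r *\<^sub>R ?u)) \<partial>lborel)"
      by (rule nn_integral_lborel_translate_reflect[symmetric, OF _ abs_one]) measurable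
    also have "\<dots> = (\<integral>\<^sup>+z. (g r * ennreal (exp (- (A * r)))) * (laplace_weight \<alpha> z * indicator (fiber_cone K) z) \<partial>lborel)"
    proof (rule nn_integral_cong)
      fix z :: "(real^('p option)) \<times> (real^'n^'p)"
      have "(\<Sum>l\<in>UNIV. \<alpha> l * (r + fst z $ l)) = A * r + (\<Sum>l\<in>UNIV. \<alpha> l * fst z $ l)"
        by (simp add: A_def distrib_left sum.distrib sum_distrib_right)
      then have "laplace_weight \<alpha> (r *\<^sub>R ?u + 1 *\<^sub>R z) = ennreal (exp (- (A * r))) * laplace_weight \<alpha> z"
        by (simp add: laplace_weight_def exp_add[symmetric] flip: ennreal_mult')
      then show "laplace_weight \<alpha> (r *\<^sub>R ?u + 1 *\<^sub>R z) * (g r * indicator (fiber_cone K) (r *\<^sub>R ?u + 1 *\<^sub>R z - r *\<^sub>R ?u)) =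
        (g r * ennreal (exp (- (A * r)))) * (laplace_weight \<alpha> z * indicator (fiber_cone K) z)"
        by (simp only: add_diff_cancel_left' scaleR_one mult_ac)
    qed
    also have "\<dots> = (g r * ennreal (exp (- (A * r)))) * ?I"
      by (rule nn_integral_cmult) measurable
    finally show "(\<integral>\<^sup>+z. laplace_weight \<alpha> z * (g r * indicator (fiber_cone K) (z - r *\<^sub>R ?u)) \<partial>lborel) =
      (g r * ennreal (exp (- (A * r)))) * ?I" .
  qed
  also have "\<dots> = (\<integral>\<^sup>+r. g r * ennreal (exp (- (A * r))) \<partial>lborel) * ?I"
    by (rule nn_integral_multc) measurable
  also have "(\<integral>\<^sup>+r. g r * ennreal (exp (- (A * r))) \<partial>lborel) =
     (\<integral>\<^sup>+r. ennreal n * (indicator {0..} r * ennreal (r ^ (n - 1) * exp (- (A * r)))) \<partial>lborel)"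
    by (intro nn_integral_cong) (auto simp: g_def indicator_def ennreal_mult' mult.assoc)
  also have "\<dots> = ennreal n * ennreal (fact (n - 1) / A ^ Suc (n - 1))"
    by (subst nn_integral_cmult) (measurable, simp only: nn_integral_power_exp[OF A])
  also have "\<dots> = ennreal (fact n / A ^ n)"
    using n by (simp add: fact_reduce[of n] flip: ennreal_mult')
  finally show ?thesis by (simp add: A_def n_def)
qed

section \<open>Depth of a point in the cone and volume of its fiber\<close>

lemma fiber_cone_depth:
  fixes K :: "(real^'n) set" and z :: "(real^('p::finite option)) \<times> (real^'n^'p)"
  assumes K: "compact K" and z: "z \<in> fiber_cone K"
  obtains \<rho> where "0 \<le> \<rho>" "z - \<rho> *\<^sub>R (vec 1, 0) \<in> fiber_cone K"
    "\<And>r. z - r *\<^sub>R (vec 1, 0) \<in> fiber_cone K \<Longrightarrow> r \<le> \<rho>"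
proof -
  \<comment> \<open>The set is closed with the cone, and bounded above because points of the cone
    have nonnegative scale coordinates; so the largest depth is attained.\<close>
  define R where "R = (\<lambda>r. z - r *\<^sub>R (vec 1, 0)) -` (fiber_cone K)"
  have "closed R" unfolding R_def by (intro closed_vimage closed_fiber_cone K continuous_intros)
  moreover have "0 \<in> R" using z by (simp add: R_def zero_prod_def[symmetric])
  moreover have bdd: "bdd_above R"
  proof (rule bdd_aboveI)
    fix r assume "r \<in> R"
    then show "r \<le> fst z $ None"
      using fiber_cone_nonneg[of "z - r *\<^sub>R (vec 1, 0)" K None] by (simp add: R_def)
  qed
  ultimately have "Sup R \<in> R" by (intro closed_contains_Sup) auto
  moreover have "r \<le> Sup R" if "r \<in> R" for r using that bdd by (rule cSup_upper)
  ultimately show thesis using that[of "Sup R"] \<open>0 \<in> R\<close> by (auto simp: R_def)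
qed

lemma depth_integral_le:
  fixes K :: "(real^'n) set" and z :: "(real^('p::finite option)) \<times> (real^'n^'p)"
  assumes "0 \<le> \<rho>" "\<And>r. z - r *\<^sub>R (vec 1, 0) \<in> fiber_cone K \<Longrightarrow> r \<le> \<rho>"
  shows "depth_integral K z \<le> ennreal (\<rho> ^ CARD('n))"
proof -
  have "depth_integral K z \<le> (\<integral>\<^sup>+r. indicator {0..\<rho>} r * ennreal (CARD('n) * r ^ (CARD('n) - 1)) \<partial>lborel)"
    unfolding depth_integral_def using assms(2) by (intro nn_integral_mono) (auto simp: indicator_def)
  also have "\<dots> = ennreal (\<rho> ^ CARD('n))" by (rule nn_integral_power_Icc) (use assms in auto)
  finally show ?thesis .
qed

lemma depth_integral_le_fiber:
  fixes K :: "(real^'n) set" and z :: "(real^('p::finite option)) \<times> (real^'n^'p)"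
  assumes K: "compact K" "convex K" "K \<noteq> {}"
  shows "ennreal (measure lebesgue K) * depth_integral K z \<le> emeasure lborel (fiber K z)"
proof (cases "\<exists>r\<ge>0. z - r *\<^sub>R (vec 1, 0) \<in> fiber_cone K")
  case False
  then have "depth_integral K z = integral\<^sup>N lborel (\<lambda>r::real. 0)"
    unfolding depth_integral_def by (intro nn_integral_cong) (auto simp: indicator_def)
  then show ?thesis by simp
next
  case True
  then obtain r where r: "0 \<le> r" "z - r *\<^sub>R (vec 1, 0) \<in> fiber_cone K" by blast
  have "z - r *\<^sub>R (vec 1, 0) + r *\<^sub>R (vec 1, 0) \<in> fiber_cone K"
    by (rule fiber_cone_add[OF K(2) r(2) fiber_cone_diagonal[OF K(3) r(1)]])
  then have "z \<in> fiber_cone K" by (simp only: diff_add_cancel)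
  then obtain \<rho> where \<rho>: "0 \<le> \<rho>" "z - \<rho> *\<^sub>R (vec 1, 0) \<in> fiber_cone K"
    "\<And>r. z - r *\<^sub>R (vec 1, 0) \<in> fiber_cone K \<Longrightarrow> r \<le> \<rho>"
    using fiber_cone_depth[OF K(1)] by metis
  obtain y where y: "y \<in> fiber K (z - \<rho> *\<^sub>R (vec 1, 0))" using \<rho>(2) by (auto simp: fiber_cone_def)
  have "ennreal (measure lebesgue K) * depth_integral K z \<le> ennreal (measure lebesgue K) * ennreal (\<rho> ^ CARD('n))"
    by (intro mult_left_mono depth_integral_le \<rho>) auto
  also have "\<dots> = ennreal (\<rho> ^ CARD('n) * measure lebesgue K)" using \<rho>(1) by (simp add: ennreal_mult mult.commute)
  also have "\<dots> = ennreal (measure lebesgue ((\<lambda>k. y + \<rho> *\<^sub>R k) ` K))"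
    using measure_homothet[OF \<rho>(1), of y K] by simp
  also have "\<dots> \<le> ennreal (measure lebesgue (fiber K z))"
    by (intro ennreal_leI measure_mono_compact compact_homothet compact_fiber K fiber_homothet \<rho> y)
  also have "\<dots> = emeasure lborel (fiber K z)"
    by (rule emeasure_lborel_compact[OF compact_fiber[OF K(1)], symmetric])
  finally show ?thesis .
qed

text \<open>The part of the interior of \<open>A\<close> outside \<open>B\<close> is open and null,
  hence empty; as \<open>A\<close> is the closure of its interior, the closed set \<open>B\<close>
  contains it.\<close>

lemma compact_convex_eq_of_measure:
  fixes A B :: "'a::euclidean_space set"
  assumes A: "compact A" "convex A" and B: "compact B" "B \<subseteq> A"
    and le: "measure lebesgue A \<le> measure lebesgue B" and pos: "0 < measure lebesgue A"
  shows "A = B"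
proof -
  have Am: "A \<in> lmeasurable" "B \<in> lmeasurable" using A B by (auto intro: lmeasurable_compact)
  have int: "interior A \<noteq> {}"
    using negligible_convex_interior[OF A(2)] pos negligible_imp_measure0[of A] by auto
  have op: "open (interior A - B)" using B by (intro open_Diff) (auto intro: compact_imp_closed)
  have bd: "interior A - B \<in> lmeasurable"
    using op A(1) by (intro lmeasurable_open) (auto intro: bounded_subset[OF compact_imp_bounded] dest: interior_subset[THEN subsetD])
  have "measure lebesgue (interior A - B) = 0"
  proof -
    have "measure lebesgue B + measure lebesgue (interior A - B) = measure lebesgue (B \<union> (interior A - B))"
      using Am bd by (intro measure_Union[symmetric]) (auto simp: fmeasurableD dest: fmeasurableD2 simp del: emeasure_completion)
    also have "\<dots> \<le> measure lebesgue A"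
      using Am bd B(2) interior_subset[of A] by (intro measure_mono_fmeasurable) auto
    finally show ?thesis using le measure_nonneg[of lebesgue "interior A - B"] by linarith
  qed
  then have "negligible (interior A - B)" using bd by (simp add: negligible_iff_measure)
  then have "interior A \<subseteq> B" using open_not_negligible[OF op] by blast
  then have "closure (interior A) \<subseteq> B" using B(1) by (intro closure_minimal compact_imp_closed)
  moreover have "closure (interior A) = A"
    using convex_closure_interior[OF A(2) int] A(1) by (simp add: compact_imp_closed)
  ultimately show ?thesis using B(2) by blast
qed

text \<open>Supplies an open set of arbitrarily small shifts within the cone. The common fiber point
  is the first scale times \<open>c\<close>; the defining inequalities of \<open>O'\<close> keep the
  required points in the dilates of the ball around \<open>c\<close>, and small multiples of the
  diagonal direction satisfy them.\<close>

lemma fiber_cone_interior: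
  fixes K :: "(real^'n) set"
  assumes K: "convex K" "interior K \<noteq> {}" and \<delta>: "0 < \<delta>"
  obtains U where "open U" "U \<noteq> {}" "U \<subseteq> ball 0 \<delta>" "U \<subseteq> (fiber_cone K :: ((real^('p::finite option)) \<times> (real^'n^'p)) set)"
proof -
  obtain c \<eta> where c: "0 < \<eta>" "ball c \<eta> \<subseteq> K" using K(2) by (meson ex_in_conv mem_interior)
  define O' :: "((real^('p option)) \<times> (real^'n^'p)) set" where
    "O' = (\<Inter>l. {z. 0 < fst z $ l}) \<inter>
      (\<Inter>i. {z. norm ((fst z $ None - fst z $ Some i) *\<^sub>R c + snd z $ i) < fst z $ Some i * \<eta>})"
  have "open O'" unfolding O'_def
    by (intro open_Int open_INT ballI finite open_Collect_less continuous_intros)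
  moreover have "O' \<subseteq> fiber_cone K"
  proof
    fix z assume z: "z \<in> O'"
    have "fst z $ None *\<^sub>R c \<in> fiber K z" unfolding fiber_def
    proof (intro CollectI conjI allI)
      have "c \<in> K" using c by auto
      moreover have "0 < fst z $ None" using z by (auto simp: O'_def)
      ultimately show "(fst z $ None, fst z $ None *\<^sub>R c) \<in> body_cone K" by (auto simp: body_cone_iff)
      fix i
      define s where "s = fst z $ Some i"
      define w where "w = (fst z $ None - s) *\<^sub>R c + snd z $ i"
      have s: "0 < s" "norm w < s * \<eta>" using z by (auto simp: O'_def s_def w_def)
      have "dist c (c + w /\<^sub>R s) < \<eta>" using s by (simp add: dist_norm field_simps)
      then have "c + w /\<^sub>R s \<in> K" using c(2) by auto
      moreover have "fst z $ None *\<^sub>R c + snd z $ i = s *\<^sub>R (c + w /\<^sub>R s)"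
        using s by (simp add: scaleR_add_right w_def algebra_simps)
      ultimately show "(fst z $ Some i, fst z $ None *\<^sub>R c + snd z $ i) \<in> body_cone K"
        using s by (auto simp: body_cone_iff s_def)
    qed
    then show "z \<in> fiber_cone K" by (auto simp: fiber_cone_def)
  qed
  moreover have "O' \<inter> ball 0 \<delta> \<noteq> {}"
  proof -
    let ?u = "(vec 1, 0) :: (real^('p option)) \<times> (real^'n^'p)"
    define \<epsilon> where "\<epsilon> = \<delta> / (2 * (norm ?u + 1))"
    have \<epsilon>: "0 < \<epsilon>" using \<delta> by (simp add: \<epsilon>_def add_nonneg_pos)
    have "\<epsilon> *\<^sub>R ?u \<in> O'" using \<epsilon> c(1) by (simp add: O'_def)
    moreover have "norm (\<epsilon> *\<^sub>R ?u) < \<delta>"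
    proof -
      have "norm (\<epsilon> *\<^sub>R ?u) = \<epsilon> * norm ?u" using \<epsilon> by (simp del: scaleR_Pair)
      also have "\<dots> < \<epsilon> * (2 * (norm ?u + 1))" using \<epsilon> by (intro mult_strict_left_mono) (auto intro: add_nonneg_pos)
      also have "\<dots> = \<delta>" unfolding \<epsilon>_def by (simp add: add_nonneg_eq_0_iff)
      finally show ?thesis .
    qed
    ultimately show ?thesis by (auto simp del: scaleR_Pair)
  qed
  ultimately show thesis by (intro that[of "O' \<inter> ball 0 \<delta>"]) auto
qed

subsection \<open>The inequality and its equality case\<close>

lemma fiber_eq_homothet:
  fixes K :: "(real^'n) set" and z :: "(real^('p::finite option)) \<times> (real^'n^'p)"
  assumes K: "compact K" "convex K" "0 < measure lebesgue K"
    and AE: "AE z in (lborel :: ((real^('p option)) \<times> (real^'n^'p)) measure).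
      emeasure lborel (fiber K z) \<le> ennreal (measure lebesgue K) * depth_integral K z"
    and pos: "0 < measure lebesgue (fiber K z)"
  obtains \<rho> y where "0 \<le> \<rho>" "y \<in> fiber K (z - \<rho> *\<^sub>R (vec 1, 0))" "fiber K z = (\<lambda>k. y + \<rho> *\<^sub>R k) ` K"
proof -
  let ?u = "(vec 1, 0) :: (real^('p option)) \<times> (real^'n^'p)"
  let ?m = "measure lebesgue K"
  let ?n = "CARD('n)"
  have ne: "K \<noteq> {}" using K(3) by auto
  have "fiber K z \<noteq> {}" using pos by auto
  then have z: "z \<in> fiber_cone K" by (simp add: fiber_cone_def)
  then obtain \<rho> where \<rho>: "0 \<le> \<rho>" "z - \<rho> *\<^sub>R ?u \<in> fiber_cone K" "\<And>r. z - r *\<^sub>R ?u \<in> fiber_cone K \<Longrightarrow> r \<le> \<rho>"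
    using fiber_cone_depth[OF K(1)] by metis
  have le: "measure lebesgue (fiber K z) \<le> ?m * \<rho> ^ ?n"
  proof (rule ccontr)
    assume "\<not> ?thesis"
    then have lt: "?m * \<rho> ^ ?n < measure lebesgue (fiber K z)" by simp
    \<comment> \<open>If the fiber is too large, there is slack for a depth \<open>\<rho>'\<close>
      beyond \<open>\<rho>\<close>. As \<open>z - \<rho>' *\<^sub>R ?u\<close> lies in the open
      complement of the cone, small shifts of \<open>z\<close> have depth at most
      \<open>\<rho>'\<close>; shifts from the cone do not decrease the fiber volume. So the
      inequality fails on a nonempty open set, against the almost everywhere hypothesis.\<close>
    have "((\<lambda>r. ?m * r ^ ?n) \<longlongrightarrow> ?m * \<rho> ^ ?n) (at_right \<rho>)" by (intro tendsto_intros)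
    then have "\<forall>\<^sub>F r in at_right \<rho>. ?m * r ^ ?n < measure lebesgue (fiber K z) \<and> \<rho> < r"
      using lt by (intro eventually_conj order_tendstoD(2) eventually_at_right_less)
    then obtain \<rho>' where \<rho>': "?m * \<rho>' ^ ?n < measure lebesgue (fiber K z)" "\<rho> < \<rho>'"
      using eventually_happens'[OF trivial_limit_at_right_real] by blast
    have "open (- fiber_cone K :: ((real^('p option)) \<times> (real^'n^'p)) set)"
      by (simp add: open_Compl closed_fiber_cone[OF K(1)])
    moreover have "z - \<rho>' *\<^sub>R ?u \<in> - fiber_cone K" using \<rho>(3)[of \<rho>'] \<rho>'(2) by auto
    ultimately obtain \<delta> where \<delta>: "0 < \<delta>" "ball (z - \<rho>' *\<^sub>R ?u) \<delta> \<subseteq> - fiber_cone K"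
      by (rule openE)
    have int: "interior K \<noteq> {}"
      using negligible_convex_interior[OF K(2)] K(3) negligible_imp_measure0[of K] by auto
    obtain U where U: "open U" "U \<noteq> {}" "U \<subseteq> ball 0 \<delta>" "U \<subseteq> (fiber_cone K :: ((real^('p option)) \<times> (real^'n^'p)) set)"
      by (rule fiber_cone_interior[OF K(2) int \<delta>(1)])
    have "\<not> emeasure lborel (fiber K (z + w)) \<le> ennreal ?m * depth_integral K (z + w)" if w: "w \<in> U" for w
    proof -
      obtain y' where y': "y' \<in> fiber K w" using U(4) w by (auto simp: fiber_cone_def)
      have "r \<le> \<rho>'" if r: "z + w - r *\<^sub>R ?u \<in> fiber_cone K" for r
      proof (rule ccontr)
        assume "\<not> r \<le> \<rho>'"
        then have "(z + w - r *\<^sub>R ?u) + (r - \<rho>') *\<^sub>R ?u \<in> fiber_cone K"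
          by (intro fiber_cone_add[OF K(2)] r fiber_cone_diagonal ne) simp
        then have "z - \<rho>' *\<^sub>R ?u + w \<in> fiber_cone K" by (simp add: algebra_simps del: scaleR_Pair)
        moreover have "z - \<rho>' *\<^sub>R ?u + w \<in> ball (z - \<rho>' *\<^sub>R ?u) \<delta>" using U(3) w by (auto simp: dist_norm)
        ultimately show False using \<delta>(2) by blast
      qed
      then have "depth_integral K (z + w) \<le> ennreal (\<rho>' ^ ?n)"
        using \<rho>(1) \<rho>'(2) by (intro depth_integral_le) auto
      then have "ennreal ?m * depth_integral K (z + w) \<le> ennreal ?m * ennreal (\<rho>' ^ ?n)" by (intro mult_left_mono) auto
      also have "\<dots> = ennreal (?m * \<rho>' ^ ?n)" by (simp add: ennreal_mult')
      also have "\<dots> < ennreal (measure lebesgue (fiber K z))"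
        using \<rho>'(1) pos by (intro ennreal_lessI)
      also have "\<dots> = ennreal (measure lebesgue ((+) y' ` fiber K z))" by (simp add: measure_translation)
      also have "\<dots> \<le> ennreal (measure lebesgue (fiber K (z + w)))"
      proof (intro ennreal_leI measure_mono_compact compact_translation compact_fiber K(1))
        show "(+) y' ` fiber K z \<subseteq> fiber K (z + w)"
          using fiber_add[OF K(2) _ y', of _ z] by (auto simp: add.commute)
      qed
      also have "\<dots> = emeasure lborel (fiber K (z + w))"
        by (rule emeasure_lborel_compact[OF compact_fiber[OF K(1)], symmetric])
      finally show ?thesis by simp
    qed
    then have sub: "(+) z ` U \<subseteq> {z. \<not> emeasure lborel (fiber K z) \<le> ennreal ?m * depth_integral K z}" by blast
    have "AE z' in lborel. z' \<notin> (+) z ` U" using AE by (rule eventually_mono) (use sub in blast)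
    moreover have op: "open ((+) z ` U)" using U(1) by (rule open_translation)
    ultimately have "(+) z ` U \<in> null_sets lborel" by (subst AE_iff_null_sets) auto
    then have "negligible ((+) z ` U)" by (simp add: negligible_iff_null_sets null_sets_completionI)
    then show False using open_not_negligible[OF op] U(2) by blast
  qed
  obtain y where y: "y \<in> fiber K (z - \<rho> *\<^sub>R ?u)" using \<rho>(2) by (auto simp: fiber_cone_def)
  have "fiber K z = (\<lambda>k. y + \<rho> *\<^sub>R k) ` K"
  proof (rule compact_convex_eq_of_measure[OF compact_fiber[OF K(1)] convex_fiber[OF K(2)] compact_homothet[OF K(1)]
        fiber_homothet[OF K(2) \<rho>(1) y] _ pos])
    show "measure lebesgue (fiber K z) \<le> measure lebesgue ((\<lambda>k. y + \<rho> *\<^sub>R k) ` K)"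
      using le by (simp add: measure_homothet[OF \<rho>(1)] mult.commute)
  qed
  then show thesis using that \<rho>(1) y by blast
qed

text \<open>Two homothets of \<open>K\<close> occur as a fiber by choosing the remaining \<open>p - 1\<close> homothets very large.\<close>

lemma homothetic_sections_of_fibers:
  fixes K :: "(real^'n) set"
  assumes K: "compact K" "convex K" "0 < measure lebesgue K"
    and AE: "AE z in (lborel :: ((real^('p::finite option)) \<times> (real^'n^'p)) measure).
      emeasure lborel (fiber K z) \<le> ennreal (measure lebesgue K) * depth_integral K z"
  shows "homothetic_sections K"
  unfolding homothetic_sections_def
proof (intro allI impI)
  fix s t :: real and x :: "real^'n"
  assume st: "0 < s" "0 < t" and pos: "0 < measure lebesgue {y \<in> (*\<^sub>R) s ` K. y + x \<in> (*\<^sub>R) t ` K}"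
  \<comment> \<open>An arbitrary factor, which carries the second homothet.\<close>
  obtain i0 :: 'p where True by simp
  have "interior K \<noteq> {}"
    using negligible_convex_interior[OF K(2)] K(3) negligible_imp_measure0[of K] by auto
  then obtain c \<eta> where c: "0 < \<eta>" "ball c \<eta> \<subseteq> K" by (meson ex_in_conv mem_interior)
  obtain M where M: "0 < M" "\<And>y. y \<in> (*\<^sub>R) s ` K \<Longrightarrow> norm y \<le> M"
    using compact_imp_bounded[OF compact_scaling[OF K(1), of s]] unfolding bounded_pos by blast
  \<comment> \<open>With this choice \<open>R\<close> times the ball in \<open>K\<close> around
    \<open>c\<close> has radius \<open>R * \<eta> = 2 * M > M\<close>, so the translated dilate of
    \<open>K\<close> swallows all of \<open>s\<close> times \<open>K\<close> and imposes no further
    condition on the fiber.\<close>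
  define R where "R = 2 * M / \<eta>"
  have R: "0 < R" "M < R * \<eta>" using M(1) c(1) by (auto simp: R_def)
  have big: "y + R *\<^sub>R c \<in> (*\<^sub>R) R ` K" if y: "y \<in> (*\<^sub>R) s ` K" for y
  proof -
    have "norm y < R * \<eta>" using M(2)[OF y] R(2) by simp
    then have "dist c (c + y /\<^sub>R R) < \<eta>" using R(1) by (simp add: dist_norm field_simps)
    then have "c + y /\<^sub>R R \<in> K" using c(2) by auto
    moreover have "y + R *\<^sub>R c = R *\<^sub>R (c + y /\<^sub>R R)" using R(1) by (simp add: scaleR_add_right add.commute)
    ultimately show ?thesis by blast
  qed
  define z :: "(real^('p option)) \<times> (real^'n^'p)" where
    "z = ((\<chi> l. case l of None \<Rightarrow> s | Some i \<Rightarrow> if i = i0 then t else R), (\<chi> i. if i = i0 then x else R *\<^sub>R c))"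
  have fib: "fiber K z = {y \<in> (*\<^sub>R) s ` K. y + x \<in> (*\<^sub>R) t ` K}"
    using st R(1) big by (auto simp: fiber_def z_def body_cone_iff split: if_splits)
  have posf: "0 < measure lebesgue (fiber K z)" using pos by (simp only: fib)
  obtain \<rho> y where \<rho>: "0 \<le> \<rho>" "y \<in> fiber K (z - \<rho> *\<^sub>R (vec 1, 0))" "fiber K z = (\<lambda>k. y + \<rho> *\<^sub>R k) ` K"
    by (rule fiber_eq_homothet[OF K AE posf])
  have "(s - \<rho>, y) \<in> body_cone K" using \<rho>(2) by (simp add: fiber_def z_def)
  moreover have "(t - \<rho>, y + x) \<in> body_cone K"
  proof -
    have "(fst (z - \<rho> *\<^sub>R (vec 1, 0)) $ Some i0, y + snd (z - \<rho> *\<^sub>R (vec 1, 0)) $ i0) \<in> body_cone K"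
      using \<rho>(2) by (simp add: fiber_def)
    then show ?thesis by (simp add: z_def)
  qed
  ultimately show "\<exists>y \<rho>. 0 \<le> \<rho> \<and> (s - \<rho>, y) \<in> body_cone K \<and> (t - \<rho>, y + x) \<in> body_cone K \<and>
        {y \<in> (*\<^sub>R) s ` K. y + x \<in> (*\<^sub>R) t ` K} = (\<lambda>k. y + \<rho> *\<^sub>R k) ` K"
    using \<rho>(1,3) unfolding fib by blast
qed

text \<open>Multiplied by the volume of \<open>K\<close>, \<open>L\<close> and \<open>R\<close> are
  the integrals of the inscribed homothet volume and of the fiber volume; positivity of that volume
  allows it to be cancelled.\<close>

proposition laplace_volume_inequality:
  fixes K :: "(real^'n) set" and \<alpha> :: "'p::finite option \<Rightarrow> real"
  assumes K: "convex_body K" "0 < measure lebesgue K" and \<alpha>: "\<And>l. 0 < \<alpha> l" and a: "\<And>k. 0 \<le> a k" and J: "finite J"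
    and vol: "\<And>s. (\<And>l. 0 \<le> s l) \<Longrightarrow>
      measure lebesgue (minkowski s (combined_bodies K) :: (real^'n^'p) set) = (\<Sum>k\<in>J. a k * (\<Prod>l\<in>UNIV. s l ^ k l))"
  defines "L \<equiv> fact CARD('n) / (\<Sum>l\<in>UNIV. \<alpha> l) ^ CARD('n) * (\<Sum>k\<in>J. a k * (\<Prod>l\<in>UNIV. fact (k l) / \<alpha> l ^ Suc (k l)))"
    and "R \<equiv> measure lebesgue K ^ CARD('p) * (\<Prod>l\<in>UNIV. fact CARD('n) / \<alpha> l ^ Suc CARD('n))"
  shows "L \<le> R" and "L = R \<Longrightarrow> homothetic_sections K"
proof -
  let ?m = "measure lebesgue K"
  let ?M = "lborel :: ((real^('p option)) \<times> (real^'n^'p)) measure"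
  have K': "compact K" "convex K" "K \<noteq> {}" using K(1) by (auto simp: convex_body_def)
  note fiber_measurable[OF K'(1), measurable] depth_integral_measurable[OF K'(1), measurable]
  have "0 < (\<Sum>l\<in>UNIV. \<alpha> l)" using \<alpha> by (intro sum_pos) auto
  have R0: "0 \<le> R" unfolding R_def using \<alpha> by (intro mult_nonneg_nonneg prod_nonneg ballI divide_nonneg_pos) auto
  have intD: "(\<integral>\<^sup>+z. laplace_weight \<alpha> z * (ennreal ?m * depth_integral K z) \<partial>?M) = ennreal (?m * L)"
  proof -
    have "(\<integral>\<^sup>+z. laplace_weight \<alpha> z * (ennreal ?m * depth_integral K z) \<partial>?M) =
      (\<integral>\<^sup>+z. ennreal ?m * (laplace_weight \<alpha> z * depth_integral K z) \<partial>?M)"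
      by (simp add: mult_ac)
    also have "\<dots> = ennreal ?m * (\<integral>\<^sup>+z. laplace_weight \<alpha> z * depth_integral K z \<partial>?M)"
      by (rule nn_integral_cmult) measurable
    also have "(\<integral>\<^sup>+z. laplace_weight \<alpha> z * depth_integral K z \<partial>?M) = ennreal L"
    proof -
      have "(\<integral>\<^sup>+z. laplace_weight \<alpha> z * indicator (fiber_cone K) z \<partial>?M) =
          ennreal (\<Sum>k\<in>J. a k * (\<Prod>l\<in>UNIV. fact (k l) / \<alpha> l ^ Suc (k l)))"
        by (rule laplace_fiber_cone[OF K(1) \<alpha> a J]) (rule vol)
      then show ?thesis
        unfolding laplace_depth[OF K'(1) \<alpha>] L_def
        using \<open>0 < (\<Sum>l\<in>UNIV. \<alpha> l)\<close> by (simp only:) (intro ennreal_mult'[symmetric], simp)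
    qed
    finally show ?thesis by (simp add: ennreal_mult')
  qed
  have intH: "(\<integral>\<^sup>+z. laplace_weight \<alpha> z * emeasure lborel (fiber K z) \<partial>?M) = ennreal (?m * R)"
    unfolding laplace_fiber[OF K'(1) \<alpha>] by (simp add: R_def mult.assoc)
  have le: "laplace_weight \<alpha> z * (ennreal ?m * depth_integral K z) \<le> laplace_weight \<alpha> z * emeasure lborel (fiber K z)" for z
    by (intro mult_left_mono depth_integral_le_fiber K') auto
  have "ennreal (?m * L) \<le> ennreal (?m * R)"
    unfolding intD[symmetric] intH[symmetric] by (intro nn_integral_mono le)
  then show "L \<le> R" using K(2) R0 by (simp add: ennreal_le_iff)
  show "homothetic_sections K" if eq: "L = R"
  proof (rule homothetic_sections_of_fibers[OF K'(1,2) K(2)])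
    \<comment> \<open>Both integrals are finite and the integrands are ordered pointwise, so
      equality forces their difference to vanish almost everywhere; the positive weight then
      cancels.\<close>
    have "(\<integral>\<^sup>+z. laplace_weight \<alpha> z * emeasure lborel (fiber K z) - laplace_weight \<alpha> z * (ennreal ?m * depth_integral K z) \<partial>?M) =
      ennreal (?m * R) - ennreal (?m * L)"
      unfolding intD[symmetric] intH[symmetric]
      by (rule nn_integral_diff) (measurable, use intD le in auto)
    then have "(\<integral>\<^sup>+z. laplace_weight \<alpha> z * emeasure lborel (fiber K z) - laplace_weight \<alpha> z * (ennreal ?m * depth_integral K z) \<partial>?M) = 0"
      by (simp add: eq)
    then have "AE z in ?M. laplace_weight \<alpha> z * emeasure lborel (fiber K z) - laplace_weight \<alpha> z * (ennreal ?m * depth_integral K z) = 0"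
      by (subst (asm) nn_integral_0_iff_AE) measurable
    then show "AE z in ?M. emeasure lborel (fiber K z) \<le> ennreal ?m * depth_integral K z"
    proof eventually_elim
      case (elim z)
      have "laplace_weight \<alpha> z * emeasure lborel (fiber K z) \<le> laplace_weight \<alpha> z * (ennreal ?m * depth_integral K z)"
        using elim by (rule ennreal_minus_eq_0)
      then show ?case by (subst (asm) ennreal_mult_le_mult_iff) (auto simp: laplace_weight_def)
    qed
  qed
qed

section \<open>Multinomial sums and mixed volumes as coefficients\<close>

lemma multinomial_normalized:
  fixes x :: "'i \<Rightarrow> real"
  assumes "finite I"
  shows "(\<Sum>j | (\<forall>i. i \<notin> I \<longrightarrow> j i = 0) \<and> (\<Sum>i\<in>I. j i) = n. \<Prod>i\<in>I. x i ^ j i / fact (j i)) = (\<Sum>i\<in>I. x i) ^ n / fact n"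
  using assms
proof (induction I arbitrary: n)
  case empty
  have "{j :: 'i \<Rightarrow> nat. (\<forall>i. j i = 0) \<and> 0 = n} = (if n = 0 then {\<lambda>_. 0} else {})" by auto
  then show ?case by simp
next
  case (insert a I)
  let ?C = "\<lambda>I n. {j :: 'i \<Rightarrow> nat. (\<forall>i. i \<notin> I \<longrightarrow> j i = 0) \<and> (\<Sum>i\<in>I. j i) = n}"
  have fin: "finite (?C I m)" for m
  proof (rule finite_subset)
    show "?C I m \<subseteq> (\<lambda>f i. if i \<in> I then f i else 0) ` (I \<rightarrow>\<^sub>E {..m})"
    proof
      fix j assume j: "j \<in> ?C I m"
      then have "j i \<le> m" if "i \<in> I" for i using member_le_sum[of i I j] that insert.hyps(1) by auto
      then have "restrict j I \<in> I \<rightarrow>\<^sub>E {..m}" by auto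
      then show "j \<in> (\<lambda>f i. if i \<in> I then f i else 0) ` (I \<rightarrow>\<^sub>E {..m})"
        using j by (intro image_eqI[of _ _ "restrict j I"]) auto
    qed
  qed (use insert.hyps in \<open>simp add: finite_PiE\<close>)
  \<comment> \<open>The exponent \<open>m\<close> of \<open>a\<close> is split off. Dividing by
    factorials makes the recursion a plain convolution, closed by the binomial theorem; requiring
    \<open>j\<close> to vanish outside the index set makes the splitting bijective.\<close>
  have "(\<Sum>j\<in>?C (insert a I) n. \<Prod>i\<in>insert a I. x i ^ j i / fact (j i)) =
    (\<Sum>(m, j)\<in>Sigma {..n} (\<lambda>m. ?C I (n - m)). x a ^ m / fact m * (\<Prod>i\<in>I. x i ^ j i / fact (j i)))"
  proof (rule sum.reindex_bij_witness[where i="\<lambda>(m, j). j(a := m)" and j="\<lambda>j. (j a, j(a := 0))"])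
    fix j assume j: "j \<in> ?C (insert a I) n"
    have s: "(\<Sum>i\<in>I. (j(a := 0)) i) = (\<Sum>i\<in>I. j i)" using insert.hyps by (intro sum.cong) auto
    show "(case (j a, j(a := 0)) of (m, j) \<Rightarrow> j(a := m)) = j" by simp
    show "(j a, j(a := 0)) \<in> Sigma {..n} (\<lambda>m. ?C I (n - m))" using j insert.hyps s by auto
    have "(\<Prod>i\<in>I. x i ^ (j(a := 0)) i / fact ((j(a := 0)) i)) = (\<Prod>i\<in>I. x i ^ j i / fact (j i))"
      using insert.hyps by (intro prod.cong) auto
    then show "(case (j a, j(a := 0)) of (m, j) \<Rightarrow> x a ^ m / fact m * (\<Prod>i\<in>I. x i ^ j i / fact (j i))) =
      (\<Prod>i\<in>insert a I. x i ^ j i / fact (j i))" using insert.hyps by simp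
  next
    fix mj assume "mj \<in> Sigma {..n} (\<lambda>m. ?C I (n - m))"
    then obtain m j where mj: "mj = (m, j)" "m \<le> n" "j \<in> ?C I (n - m)" by auto
    have s: "(\<Sum>i\<in>I. (j(a := m)) i) = (\<Sum>i\<in>I. j i)" using insert.hyps by (intro sum.cong) auto
    have ja: "j a = 0" using mj(3) insert.hyps by auto
    show "(case mj of (m, j) \<Rightarrow> j(a := m)) \<in> ?C (insert a I) n" using mj insert.hyps s by auto
    show "((case mj of (m, j) \<Rightarrow> j(a := m)) a, (case mj of (m, j) \<Rightarrow> j(a := m))(a := 0)) = mj"
      using mj(1) ja by (auto simp: fun_eq_iff)
  qed
  also have "\<dots> = (\<Sum>m\<le>n. x a ^ m / fact m * ((\<Sum>i\<in>I. x i) ^ (n - m) / fact (n - m)))"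
  proof (subst sum.Sigma[symmetric])
    show "(\<Sum>m\<le>n. \<Sum>j\<in>?C I (n - m). x a ^ m / fact m * (\<Prod>i\<in>I. x i ^ j i / fact (j i))) =
        (\<Sum>m\<le>n. x a ^ m / fact m * ((\<Sum>i\<in>I. x i) ^ (n - m) / fact (n - m)))"
      by (simp only: sum_distrib_left[symmetric] insert.IH)
  qed (use fin in auto)
  also have "\<dots> = (\<Sum>m\<le>n. real (n choose m) * x a ^ m * (\<Sum>i\<in>I. x i) ^ (n - m)) / fact n"
    by (auto simp: sum_divide_distrib binomial_fact intro!: sum.cong)
  also have "\<dots> = (x a + (\<Sum>i\<in>I. x i)) ^ n / fact n" by (simp add: binomial_ring)
  finally show ?case using insert.hyps by simp
qed

lemma compositions_le: "j \<in> compositions n \<Longrightarrow> j l \<le> n"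
  using member_le_sum[of l UNIV j] by (auto simp: compositions_def)

lemma sum_multinom:
  fixes x :: "'p::finite option \<Rightarrow> real"
  shows "(\<Sum>j\<in>compositions n. multinom n j * (\<Prod>l\<in>UNIV. x l ^ j l)) = (\<Sum>l\<in>UNIV. x l) ^ n"
proof -
  have "(\<Sum>j\<in>compositions n. multinom n j * (\<Prod>l\<in>UNIV. x l ^ j l)) =
      fact n * (\<Sum>j\<in>compositions n. \<Prod>l\<in>UNIV. x l ^ j l / fact (j l))"
    by (simp add: multinom_def prod_dividef sum_distrib_left)
  also have "(\<Sum>j\<in>compositions n. \<Prod>l\<in>UNIV. x l ^ j l / fact (j l)) = (\<Sum>l\<in>UNIV. x l) ^ n / fact n"
    using multinomial_normalized[where I = "UNIV :: 'p option set" and n = n and x = x] by (simp add: compositions_def)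
  finally show ?thesis by simp
qed

text \<open>Mapping \<open>combined_bodies K\<close> over this list of indices produces the list of
  bodies in \<open>W\<close>, which brings it into the form required by
  \<open>mixed_volume_map\<close>.\<close>

definition factor_list :: "('p::{finite,linorder} option \<Rightarrow> nat) \<Rightarrow> 'p option list" where
  "factor_list m = replicate (m None) None @ concat (map (\<lambda>i. replicate (m (Some i)) (Some i)) (sorted_list_of_set UNIV))"

lemma count_list_replicate: "count_list (replicate n x) y = (if x = y then n else 0)"
  by (induction n) auto

lemma count_list_factor_list: "count_list (factor_list m) = m"
proof
  fix l
  have aux: "count_list (concat (map (\<lambda>i. replicate (m (Some i)) (Some i)) xs)) (Some i) = (if i \<in> set xs then m (Some i) else 0)"
    if "distinct xs" for xs :: "'a list" and i
    using that by (induction xs) (auto simp: count_list_replicate)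
  have none: "count_list (concat (map (\<lambda>i. replicate (m (Some i)) (Some i)) xs)) None = 0" for xs :: "'a list"
    by (induction xs) (auto simp: count_list_replicate)
  show "count_list (factor_list m) l = m l"
    by (cases l) (auto simp: factor_list_def count_list_replicate aux none)
qed

lemma length_factor_list: "length (factor_list m) = (\<Sum>l\<in>UNIV. m l)"
  using sum_count_set[of "factor_list m" UNIV] by (simp add: count_list_factor_list)

lemma sum_complement_composition:
  fixes j :: "'p::finite option \<Rightarrow> nat"
  assumes "j \<in> compositions n"
  shows "(\<Sum>l\<in>UNIV. n - j l) = n * CARD('p)"
proof -
  have "(\<Sum>l\<in>UNIV. n - j l) + (\<Sum>l\<in>UNIV. j l) = (\<Sum>l\<in>(UNIV :: 'p option set). n)"
    using compositions_le[OF assms] by (subst sum.distrib[symmetric]) (intro sum.cong, auto)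
  then show ?thesis using assms by (simp add: compositions_def card_UNIV_option)
qed

lemma W_eq_coefficient:
  fixes K :: "(real^'n) set" and j :: "'p::{finite,linorder} option \<Rightarrow> nat"
  assumes K: "convex_body K" and j: "j \<in> compositions CARD('n)"
    and vol: "\<And>s. (\<And>l. 0 \<le> s l) \<Longrightarrow>
      measure lebesgue (minkowski s (combined_bodies K) :: (real^'n^'p::{finite,linorder}) set) =
      (\<Sum>k | (\<Sum>l\<in>UNIV. k l) = CARD('n) * CARD('p). a k * (\<Prod>l\<in>UNIV. s l ^ k l))"
  shows "W K j = a (\<lambda>l. CARD('n) - j l) * (\<Prod>l\<in>UNIV. fact (CARD('n) - j l)) / fact (CARD('n) * CARD('p))"
proof -
  let ?ls = "factor_list (\<lambda>l. CARD('n) - j l)"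
  have len: "length ?ls = CARD('n) * CARD('p)"
    by (simp add: length_factor_list sum_complement_composition[OF j])
  have "W K j = mixed_volume (map (combined_bodies K :: 'p option \<Rightarrow> (real^'n^'p::{finite,linorder}) set) ?ls)"
    unfolding W_def factor_list_def
    by (simp add: map_concat combined_bodies_def o_def)
  also have "\<dots> = a (count_list ?ls) * (\<Prod>l\<in>UNIV. fact (count_list ?ls l)) / fact (length ?ls)"
    using convex_body_combined_bodies[OF K, where 'p='p] vol
    by (intro mixed_volume_map) (auto simp: convex_body_def len)
  finally show ?thesis by (simp add: len count_list_factor_list)
qed

text \<open>If \<open>v\<close> is constant on \<open>K\<close>, then the block
  \<open>x $ i0\<close> of a point of the sum, being a difference of two points of \<open>K\<close>,
  is orthogonal to \<open>v\<close>. This handles bodies of volume 0, where the factor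
  \<open>measure lebesgue K\<close> cannot be cancelled.\<close>

lemma flat_body_combination_volume:
  fixes K :: "(real^'n) set"
  assumes K: "convex_body K" "measure lebesgue K = 0"
  shows "measure lebesgue (\<Sum>l\<in>UNIV. (*\<^sub>R) 1 ` combined_bodies K l :: (real^'n^'p::finite) set) = 0"
proof -
  have K': "compact K" "convex K" using K(1) by (auto simp: convex_body_def)
  have "negligible K" using K lmeasurable_compact[OF K'(1)] by (simp add: negligible_iff_measure)
  then have "interior K = {}" using negligible_convex_interior[OF K'(2)] by simp
  then obtain v b where v: "v \<noteq> 0" "K \<subseteq> {x. v \<bullet> x = b}"
    using empty_interior_subset_hyperplane[OF K'(2)] by metis
  obtain i0 :: 'p where True by simp
  have "(\<Sum>l\<in>UNIV. (*\<^sub>R) 1 ` combined_bodies K l :: (real^'n^'p) set) \<subseteq> {x. axis i0 v \<bullet> x = 0}"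
  proof
    fix x :: "real^'n^'p" assume "x \<in> (\<Sum>l\<in>UNIV. (*\<^sub>R) 1 ` combined_bodies K l)"
    then have "(vec 1, x) \<in> fiber_cone K"
      using minkowski_sum_combined_bodies[of "vec 1 :: real^('p option)" K] by auto
    then obtain y where "y \<in> K" "y + x $ i0 \<in> K" by (auto simp: fiber_cone_def fiber_def body_cone_iff)
    then have "v \<bullet> y = b" "v \<bullet> (y + x $ i0) = b" using v(2) by auto
    then have "v \<bullet> x $ i0 = 0" by (simp add: inner_add_right)
    then show "x \<in> {x. axis i0 v \<bullet> x = 0}" by (simp add: inner_axis' inner_axis)
  qed
  moreover have "negligible {x :: real^'n^'p. axis i0 v \<bullet> x = 0}"
    using v(1) by (intro negligible_hyperplane) (simp add: axis_eq_0_iff)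
  ultimately show ?thesis by (intro negligible_imp_measure0) (rule negligible_subset)
qed

text \<open>The segment from the vertex \<open>axis l 1\<close> to a relative interior point can be
  prolonged within \<open>Theta\<close>; a vanishing coordinate would become negative there.\<close>

lemma rel_interior_Theta_pos:
  assumes "t \<in> rel_interior Theta"
  shows "0 < t $ l"
proof -
  have conv: "convex (Theta :: (real^('p::finite option)) set)"
    by (auto simp: convex_def Theta_def sum.distrib simp flip: sum_distrib_left)
  have ax: "axis l 1 \<in> Theta" by (auto simp: Theta_def axis_def)
  then obtain e where e: "1 < e" "(1 - e) *\<^sub>R axis l 1 + e *\<^sub>R t \<in> Theta"
    using assms convex_rel_interior_iff[OF conv, of t] by blast
  then have "0 \<le> (1 - e) + e * t $ l" by (auto simp: Theta_def axis_def dest!: spec[of _ l])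
  then have "0 < e * t $ l" using e(1) by linarith
  then show ?thesis using e(1) by (simp add: zero_less_mult_iff)
qed

lemma weight_tendsto:
  "((\<lambda>\<epsilon>. weight n (t + \<epsilon> *\<^sub>R vec 1) j) \<longlongrightarrow> weight n t j) (at_right 0)"
proof -
  have "((\<lambda>\<epsilon>. weight n (t + \<epsilon> *\<^sub>R vec 1) j) \<longlongrightarrow> weight n (t + 0 *\<^sub>R vec 1) j) (at_right 0)"
    unfolding weight_def by (intro tendsto_intros)
  then show ?thesis by simp
qed

text \<open>
  The Laplace integral at \<open>\<alpha> = 1/t\<close> also contains the coefficients \<open>a k\<close> of the volume polynomial with some
  \<open>k l > n\<close>. They vanish, but as they are nonnegative it suffices to drop them.
\<close>

lemma mixed_volume_sum_bound:
  fixes K :: "(real^'n) set" and t :: "real^('p::{finite,linorder} option)"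
  assumes K: "convex_body K" and t: "\<And>l. 0 < t $ l"
  defines "A \<equiv> \<Sum>j\<in>compositions CARD('n). weight CARD('n) t j * W K j"
    and "B \<equiv> fact CARD('n) ^ CARD('p) / fact (CARD('n) * CARD('p)) *
              (\<Sum>j\<in>compositions CARD('n). multinom CARD('n) j * weight CARD('n) t j * measure lebesgue K ^ CARD('p))"
  shows "A \<le> B" and "0 < measure lebesgue K \<Longrightarrow> A = B \<Longrightarrow> homothetic_sections K"
proof -
  define n where "n = CARD('n)"
  define p where "p = CARD('p)"
  define m where "m = measure lebesgue K"
  let ?J = "{k :: 'p option \<Rightarrow> nat. (\<Sum>l\<in>UNIV. k l) = n * p}"
  have n: "0 < n" and p: "0 < p" by (auto simp: n_def p_def)
  have dim: "DIM(real^'n^'p::{finite,linorder}) = n * p" by (simp add: n_def p_def mult.commute)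
  obtain a :: "('p option \<Rightarrow> nat) \<Rightarrow> real" where a: "\<And>k. 0 \<le> a k"
    and vol: "\<And>s. (\<And>l. 0 \<le> s l) \<Longrightarrow>
      measure lebesgue (minkowski s (combined_bodies K) :: (real^'n^'p::{finite,linorder}) set) = (\<Sum>k\<in>?J. a k * (\<Prod>l\<in>UNIV. s l ^ k l))"
    using minkowski_combination_volume[of "combined_bodies K :: 'p option \<Rightarrow> (real^'n^'p::{finite,linorder}) set", OF convex_body_combined_bodies[OF K]]
    unfolding dim by blast
  have W: "W K j = a (\<lambda>l. n - j l) * (\<Prod>l\<in>UNIV. fact (n - j l)) / fact (n * p)" if "j \<in> compositions n" for j
    unfolding n_def p_def using that vol by (intro W_eq_coefficient K) (auto simp: n_def p_def)
  define S where "S = (\<Sum>k\<in>?J. a k * (\<Prod>l\<in>UNIV. fact (k l) * t $ l ^ k l))"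
  have AS: "A \<le> S / fact (n * p)"
  proof -
    have "A = (\<Sum>j\<in>compositions n. a (\<lambda>l. n - j l) * (\<Prod>l\<in>UNIV. fact (n - j l) * t $ l ^ (n - j l))) / fact (n * p)"
      unfolding A_def n_def[symmetric] sum_divide_distrib
      by (intro sum.cong refl) (simp add: W weight_def prod.distrib)
    also have "(\<Sum>j\<in>compositions n. a (\<lambda>l. n - j l) * (\<Prod>l\<in>UNIV. fact (n - j l) * t $ l ^ (n - j l))) =
      (\<Sum>k\<in>(\<lambda>j l. n - j l) ` compositions n. a k * (\<Prod>l\<in>UNIV. fact (k l) * t $ l ^ k l))"
    proof (subst sum.reindex)
      show "inj_on (\<lambda>j l. n - j l) (compositions n :: ('p option \<Rightarrow> nat) set)"
      proof (rule inj_onI)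
        fix j j' :: "'p option \<Rightarrow> nat" assume jj: "j \<in> compositions n" "j' \<in> compositions n" "(\<lambda>l. n - j l) = (\<lambda>l. n - j' l)"
        have "j l = j' l" for l
          using fun_cong[OF jj(3), of l] compositions_le[OF jj(1), of l] compositions_le[OF jj(2), of l] by simp
        then show "j = j'" by auto
      qed
    qed simp
    also have "\<dots> \<le> S" unfolding S_def
    proof (rule sum_mono2)
      show "finite ?J" by (rule finite_exponents)
      show "(\<lambda>j l. n - j l) ` compositions n \<subseteq> ?J"
        by (auto simp: sum_complement_composition p_def)
      show "0 \<le> a k * (\<Prod>l\<in>UNIV. fact (k l) * t $ l ^ k l)" for k
        using a t by (intro mult_nonneg_nonneg prod_nonneg) (auto intro: less_imp_le)
    qed
    finally show ?thesis by (simp add: divide_right_mono)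
  qed
  define T where "T = (\<Prod>l\<in>UNIV. t $ l)"
  have T: "0 < T" unfolding T_def using t by (intro prod_pos) auto
  define H where "H = (\<Sum>l\<in>UNIV. 1 / t $ l)"
  have H: "0 < H" unfolding H_def using t by (intro sum_pos) auto
  \<comment> \<open>Pulling out \<open>T ^ n\<close> turns the weights into monomials in the
    reciprocals of \<open>t\<close>, and the multinomial theorem evaluates the sum.\<close>
  have BS: "B = fact n ^ p / fact (n * p) * (T ^ n * H ^ n * m ^ p)"
  proof -
    have "weight n t j = T ^ n * (\<Prod>l\<in>UNIV. (1 / t $ l) ^ j l)" if "j \<in> compositions n" for j
    proof -
      have "t $ l ^ (n - j l) = t $ l ^ n * (1 / t $ l) ^ j l" for l
        using t[of l] compositions_le[OF that, of l] by (simp add: power_diff power_one_over divide_inverse power_inverse)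
      then show ?thesis by (simp add: weight_def T_def prod.distrib prod_power_distrib)
    qed
    then have "(\<Sum>j\<in>compositions n. multinom n j * weight n t j * m ^ p) =
      T ^ n * m ^ p * (\<Sum>j\<in>compositions n. multinom n j * (\<Prod>l\<in>UNIV. (1 / t $ l) ^ j l))"
      unfolding sum_distrib_left by (intro sum.cong) auto
    also have "\<dots> = T ^ n * m ^ p * H ^ n" by (simp only: sum_multinom H_def)
    finally show ?thesis unfolding B_def by (simp add: n_def p_def m_def mult_ac)
  qed
  have main: "S \<le> fact n ^ p * (T ^ n * H ^ n * m ^ p)"
    and eq: "0 < m \<Longrightarrow> S = fact n ^ p * (T ^ n * H ^ n * m ^ p) \<Longrightarrow> homothetic_sections K"
  proof -
    let ?L = "fact CARD('n) / (\<Sum>l\<in>UNIV. 1 / t $ l) ^ CARD('n) * (\<Sum>k\<in>?J. a k * (\<Prod>l\<in>UNIV. fact (k l) / (1 / t $ l) ^ Suc (k l)))"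
    let ?R = "measure lebesgue K ^ CARD('p) * (\<Prod>l\<in>UNIV. fact CARD('n) / (1 / t $ l) ^ Suc CARD('n))"
    have \<alpha>: "0 < 1 / t $ l" for l using t by simp
    \<comment> \<open>The factor common to both sides collects the depth constant
      \<open>fact n / H ^ n\<close> and the surplus power of each \<open>t $ l\<close> coming from
      \<open>Suc (k l)\<close>.\<close>
    have L: "?L = (fact n * T / H ^ n) * S"
    proof -
      have "(\<Prod>l\<in>UNIV. fact (k l) / (1 / t $ l) ^ Suc (k l)) = T * (\<Prod>l\<in>UNIV. fact (k l) * t $ l ^ k l)" for k :: "'p option \<Rightarrow> nat"
        by (simp add: T_def power_one_over prod.distrib mult_ac)
      then show ?thesis by (simp add: S_def H_def n_def sum_distrib_left mult_ac)
    qed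
    have R: "?R = (fact n * T / H ^ n) * (fact n ^ p * (T ^ n * H ^ n * m ^ p))"
    proof -
      have "(\<Prod>l\<in>UNIV. fact n / (1 / t $ l) ^ Suc n) = fact n ^ Suc p * (T * T ^ n)"
        by (simp add: T_def p_def power_one_over prod.distrib prod_power_distrib card_UNIV_option mult_ac)
      then show ?thesis using H by (simp add: n_def p_def m_def)
    qed
    have c: "0 < fact n * T / H ^ n" using T H by simp
    show "S \<le> fact n ^ p * (T ^ n * H ^ n * m ^ p)"
    \<comment> \<open>For a flat body the nonnegative coefficients add up to the volume at
      (1,...,1), which is 0, so all of them vanish.\<close>
    proof (cases "m = 0")
      case True
      have "(\<Sum>k\<in>?J. a k) = 0"
        using vol[of "\<lambda>_. 1"] flat_body_combination_volume[OF K, where 'p='p] True by (simp add: m_def)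
      then have "a k = 0" if "k \<in> ?J" for k
        using that a finite_exponents by (subst (asm) sum_nonneg_eq_0_iff) auto
      then have "S = 0" unfolding S_def by (intro sum.neutral) auto
      then show ?thesis using True p by (simp add: zero_power)
    next
      case False
      then have "0 < measure lebesgue K" using measure_nonneg[of lebesgue K] by (simp add: m_def less_le)
      then have "?L \<le> ?R"
        by (rule laplace_volume_inequality(1)[OF K _ \<alpha> a finite_exponents]) (rule vol)
      then have "(fact n * T / H ^ n) * S \<le> (fact n * T / H ^ n) * (fact n ^ p * (T ^ n * H ^ n * m ^ p))"
        unfolding L R .
      then show ?thesis using c by (simp only: mult_le_cancel_left_pos)
    qed
    show "homothetic_sections K" if "0 < m" "S = fact n ^ p * (T ^ n * H ^ n * m ^ p)"
    proof (rule laplace_volume_inequality(2)[OF K _ \<alpha> a finite_exponents])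
      show "measure lebesgue (minkowski s (combined_bodies K) :: (real^'n^'p::{finite,linorder}) set) =
          (\<Sum>k\<in>?J. a k * (\<Prod>l\<in>UNIV. s l ^ k l))" if "\<And>l. 0 \<le> s l" for s
        by (rule vol[OF that])
      show "0 < measure lebesgue K" using that by (simp add: m_def)
      show "?L = ?R" unfolding L R using that(2) by simp
    qed
  qed
  have B': "B = fact n ^ p * (T ^ n * H ^ n * m ^ p) / fact (n * p)" unfolding BS by simp
  have "S / fact (n * p) \<le> B" unfolding B' using main by (intro divide_right_mono) auto
  then show "A \<le> B" using AS by simp
  show "homothetic_sections K" if "0 < measure lebesgue K" "A = B"
  proof -
    have "S / fact (n * p) = B" using \<open>S / fact (n * p) \<le> B\<close> AS that(2) by simp
    then have "S = fact n ^ p * (T ^ n * H ^ n * m ^ p)" unfolding B' by simp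
    then show ?thesis using eq that(1) by (simp add: m_def)
  qed
qed

theorem theorem7p3:
  fixes K :: "(real^'n) set"
  assumes "CARD('n) \<ge> 2" and "convex_body K"
  shows "(\<forall>t \<in> (Theta :: (real^('p::{finite,linorder} option)) set).
            (\<Sum>j\<in>compositions CARD('n). weight CARD('n) t j * W K j)
            \<le> fact CARD('n) ^ CARD('p) / fact (CARD('n) * CARD('p)) *
              (\<Sum>j\<in>compositions CARD('n).
                 multinom CARD('n) j * weight CARD('n) t j * measure lebesgue K ^ CARD('p)))
       \<and> (aff_dim K = int CARD('n) \<and>
          (\<exists>t \<in> rel_interior (Theta :: (real^('p::{finite,linorder} option)) set).
            (\<Sum>j\<in>compositions CARD('n). weight CARD('n) t j * W K j)
            = fact CARD('n) ^ CARD('p) / fact (CARD('n) * CARD('p)) *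
              (\<Sum>j\<in>compositions CARD('n).
                 multinom CARD('n) j * weight CARD('n) t j * measure lebesgue K ^ CARD('p)))
          \<longrightarrow> (\<exists>m. m simplex K))"
proof (intro conjI ballI impI)
  fix t :: "real^('p option)" assume t: "t \<in> Theta"
  let ?A = "\<lambda>t :: real^('p option). \<Sum>j\<in>compositions CARD('n). weight CARD('n) t j * W K j"
  let ?B = "\<lambda>t :: real^('p option). fact CARD('n) ^ CARD('p) / fact (CARD('n) * CARD('p)) *
              (\<Sum>j\<in>compositions CARD('n). multinom CARD('n) j * weight CARD('n) t j * measure lebesgue K ^ CARD('p))"
  \<comment> \<open>The shifted points leave \<open>Theta\<close>, but their coordinates are
    positive, which is all that the bound asks of them; it passes to the limit because the weights
    are continuous.\<close>
  have "((\<lambda>\<epsilon>. ?A (t + \<epsilon> *\<^sub>R vec 1)) \<longlongrightarrow> ?A t) (at_right 0)"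
    "((\<lambda>\<epsilon>. ?B (t + \<epsilon> *\<^sub>R vec 1)) \<longlongrightarrow> ?B t) (at_right 0)"
    by (intro tendsto_intros weight_tendsto)+
  moreover have "\<forall>\<^sub>F \<epsilon> in at_right 0. ?A (t + \<epsilon> *\<^sub>R vec 1) \<le> ?B (t + \<epsilon> *\<^sub>R vec 1)"
    using t by (intro eventually_at_rightI[of 0 1] mixed_volume_sum_bound(1) assms(2)) (auto simp: Theta_def add_nonneg_pos)
  ultimately show "?A t \<le> ?B t" by (intro tendsto_le[OF trivial_limit_at_right_real])
next
  assume *: "aff_dim K = int CARD('n) \<and>
          (\<exists>t \<in> rel_interior (Theta :: (real^('p option)) set).
            (\<Sum>j\<in>compositions CARD('n). weight CARD('n) t j * W K j)
            = fact CARD('n) ^ CARD('p) / fact (CARD('n) * CARD('p)) *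
              (\<Sum>j\<in>compositions CARD('n).
                 multinom CARD('n) j * weight CARD('n) t j * measure lebesgue K ^ CARD('p)))"
  have K: "compact K" "convex K" using assms(2) by (auto simp: convex_body_def)
  have pos: "0 < measure lebesgue K"
  proof (rule ccontr)
    assume "\<not> 0 < measure lebesgue K"
    then have "negligible K"
      using lmeasurable_compact[OF K(1)] measure_nonneg[of lebesgue K] by (simp add: negligible_iff_measure)
    then have "interior K = {}" using negligible_convex_interior[OF K(2)] by simp
    then obtain v b where v: "v \<noteq> 0" "K \<subseteq> {x. v \<bullet> x = b}"
      using empty_interior_subset_hyperplane[OF K(2)] by metis
    then have "aff_dim K \<le> int DIM(real^'n) - 1"
      using aff_dim_subset[OF v(2)] aff_dim_hyperplane[OF v(1), of b] by simp
    then show False using * by simp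
  qed
  show "\<exists>m. m simplex K"
    using * mixed_volume_sum_bound(2)[OF assms(2) rel_interior_Theta_pos pos]
    by (intro homothetic_sections_imp_simplex K pos) blast
qed

end
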